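(* Let $k=\mathbb F_q$ be a finite field of characteristic $p$ and $r\ge1$. Let $\mathbf x\in\mathcal G$ and assume there exist $\mathbf t\in(k^\times)^r$, a non-zero integer $N$, subsets $U_m\subseteq T_m$ for every $m\ge1$ and complex numbers $D_m$ ($m\ge1$) such that $\lim_{m\to\infty}|U_m|/|T_m|=1$ and $(\chi(\mathbf t)\,ev_{m,\chi}(\mathbf x))^N=D_m$ for every $m\ge1$ and every $\chi\in U_m$. Then $\mathbf x\in\mathcal H$.
   Context: $k_m$ is the degree $m$ extension of $k$ in a fixed algebraic closure; characters of $k^\times$ are regarded as characters of $k_m^\times$ via the norm; $\mathbf 1$ is the trivial character. $G_m(\chi)=-\sum_{t\in k_m^\times}\chi(t)\psi_m(t)$ with $\psi_m(t)=\exp(2\pi i\,\mathrm{Tr}_{k_m/\mathbb F_p}(t)/p)$. $T_m$ is the set of $r$-tuples $\chi=(\chi_1,\ldots,\chi_r)$ of characters of $k_m^\times$ (so $|T_m|=(q^m-1)^r$), $\chi^{\mathbf a}=\prod_j\chi_j^{a_j}$ and $\chi(\mathbf t)=\prod_j\chi_j(t_j)$. $\mathcal G$ is the free abelian multiplicative group with basis $\{\mathbf e_{\eta,\mathbf a}\}$ indexed by pairs $(\eta,\mathbf a)$ with $\eta:k^\times\to\mathbb C^\times$ a character and $\mathbf a\in\mathbb Z^r$ non-zero. For $\chi\in T_m$, $ev_{m,\chi}:\mathcal G\to\mathbb C$ is the multiplicative map with $ev_{m,\chi}(\mathbf e_{\eta,\mathbf a})=G_m(\eta\chi^{\mathbf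 a})$. Define $P(\eta,\mathbf a)=\mathbf e_{\eta,\mathbf a}\mathbf e_{\bar\eta,-\mathbf a}$, $Q(\eta,\mathbf a)=\mathbf e_{\eta^p,p\mathbf a}^{-1}\mathbf e_{\eta,\mathbf a}$, and for positive $d\mid q-1$, $R(\eta,\mathbf a,d)=\mathbf e_{\eta^d,d\mathbf a}^{-1}\prod_{\xi}\mathbf e_{\eta\xi,\mathbf a}$, the product over the characters $\xi$ of $k^\times$ with $\xi^d=\mathbf 1$. $\mathcal H\subseteq\mathcal G$ is the subgroup generated by all $P(\eta,\mathbf a)$, $Q(\eta,\mathbf a)$, $R(\eta,\mathbf a,d)$ for all characters $\eta$ of $k^\times$, non-zero $\mathbf a\in\mathbb Z^r$ and positive $d\mid q-1$. *)

theory Defs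
  imports
    "HOL-Analysis.Analysis"
    "HOL-Algebra.Algebraic_Closure_Type"
    "HOL-Algebra.Free_Abelian_Groups"
    "HOL-Algebra.Generated_Groups"
    "HOL-Algebra.Sylow"
    "HOL-Number_Theory.Residues"
begin

text \<open>
  The ground field \<open>k\<close> is a type \<open>'a :: finite_field\<close>, so \<open>q = CARD('a)\<close> and \<open>p = CHAR('a)\<close>, and
  its fixed algebraic closure is \<open>'a alg_closure\<close>.  The rank \<open>r \<ge> 1\<close> is \<open>CARD('r)\<close> for a
  finite index type \<open>'r\<close>.
\<close>

subsection \<open>The extensions of the ground field\<close>

text \<open>
  The degree \<open>m\<close> extension \<open>k\<^sub>m\<close> inside the algebraic closure (for \<open>m \<ge> 1\<close>), as the set of fixed
  points of the \<open>m\<close>-th power of the \<open>q\<close>-Frobenius.  It is a subfield containing \<open>k\<close>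
  (\<open>ext_field_closed\<close>), of dimension \<open>m\<close> over \<open>k\<close> (\<open>dim_ext_field\<close>), and it is the only such
  subfield (\<open>ext_field_unique\<close>).
\<close>

definition ext_field :: "nat \<Rightarrow> 'a :: finite_field alg_closure set" where
  "ext_field m = {x. x ^ (CARD('a) ^ m) = x}"

text \<open>Norm of \<open>k\<^sub>m / k\<close>: the product of the conjugates \<open>x ^ (q ^ i)\<close>, seen as an element of \<open>k\<close>
  (see \<open>to_ac_ext_norm\<close>).\<close>

definition ext_norm :: "nat \<Rightarrow> 'a :: finite_field alg_closure \<Rightarrow> 'a" where
  "ext_norm m x = of_ac (\<Prod>i<m. x ^ (CARD('a) ^ i))"

text \<open>
  Trace of \<open>k\<^sub>m\<close> over the prime field: the sum of the conjugates \<open>x ^ (p ^ i)\<close>, where the number of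
  summands is the degree \<open>n\<close> of \<open>k\<^sub>m\<close> over the prime field, that is, \<open>p ^ n = q ^ m\<close>
  (\<open>CHAR_power_multiplicity\<close>).
\<close>

definition abs_trace :: "nat \<Rightarrow> 'a :: finite_field alg_closure \<Rightarrow> 'a alg_closure" where
  "abs_trace m x = (\<Sum>i<multiplicity CHAR('a) (CARD('a) ^ m). x ^ (CHAR('a) ^ i))"

text \<open>The representative in \<open>{0..<p}\<close> of an element of the prime field
  (for traces, see \<open>of_nat_prime_field_rep\<close>).\<close>

definition prime_field_rep :: "'a :: finite_field alg_closure \<Rightarrow> nat" where
  "prime_field_rep y = (THE j. j < CHAR('a) \<and> of_nat j = y)"

definition add_char :: "nat \<Rightarrow> 'a :: finite_field alg_closure \<Rightarrow> complex" where
  "add_char m x =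
     exp (2 * of_real pi * \<i> * of_nat (prime_field_rep (abs_trace m x)) / of_nat CHAR('a))"


subsection \<open>Multiplicative characters and Gauss sums\<close>

text \<open>
  Characters of the group \<open>F - {0}\<close> for a subfield \<open>F\<close>, extended by \<open>0\<close> to the whole type so that
  equality of characters is equality of functions.
\<close>

definition mult_chars :: "'b :: field set \<Rightarrow> ('b \<Rightarrow> complex) set" where
  "mult_chars F = {\<omega>.
     (\<forall>x\<in>F - {0}. \<omega> x \<noteq> 0) \<and>
     (\<forall>x\<in>F - {0}. \<forall>y\<in>F - {0}. \<omega> (x * y) = \<omega> x * \<omega> y) \<and>
     (\<forall>x. x \<notin> F - {0} \<longrightarrow> \<omega> x = 0)}"

definition triv_char :: "'a :: finite_field \<Rightarrow> complex" where
  "triv_char x = (if x = 0 then 0 else 1)"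

definition gauss_sum :: "nat \<Rightarrow> ('a :: finite_field alg_closure \<Rightarrow> complex) \<Rightarrow> complex" where
  "gauss_sum m \<omega> = - (\<Sum>t\<in>ext_field m - {0}. \<omega> t * add_char m t)"

definition char_tuples :: "nat \<Rightarrow> (('a :: finite_field alg_closure \<Rightarrow> complex) ^ 'r) set" where
  "char_tuples m = {\<omega>. \<forall>j. \<omega> $ j \<in> mult_chars (ext_field m)}"

text \<open>\<open>\<eta> \<omega>\<^sup>a\<close>, where \<open>\<eta>\<close> is regarded as a character of \<open>k\<^sub>m\<close> via the norm.\<close>

definition twisted_char ::
  "nat \<Rightarrow> ('a :: finite_field \<Rightarrow> complex) \<Rightarrow> ('a alg_closure \<Rightarrow> complex) ^ 'r \<Rightarrow> int ^ 'r
     \<Rightarrow> 'a alg_closure \<Rightarrow> complex" where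
  "twisted_char m \<eta> \<omega> a t = \<eta> (ext_norm m t) * (\<Prod>j\<in>UNIV. (\<omega> $ j) t powi (a $ j))"

definition tuple_eval ::
  "('a :: finite_field alg_closure \<Rightarrow> complex) ^ 'r \<Rightarrow> 'a ^ 'r \<Rightarrow> complex" where
  "tuple_eval \<omega> t = (\<Prod>j\<in>UNIV. (\<omega> $ j) (to_ac (t $ j)))"


subsection \<open>The free abelian group and its subgroup of relations\<close>

type_synonym ('a, 'r) symb = "('a \<Rightarrow> complex) \<times> (int ^ 'r)"

definition symbols :: "('a :: finite_field, 'r :: finite) symb set" where
  "symbols = mult_chars UNIV \<times> {a. a \<noteq> 0}"

text \<open>
  The free abelian group is written additively: the basis element \<open>e\<^bsub>\<eta>,a\<^esub>\<close> is
  \<open>frag_of (\<eta>, a)\<close>, and products and inverses become sums and negatives.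
\<close>

definition symb_group :: "(('a :: finite_field, 'r :: finite) symb \<Rightarrow>\<^sub>0 int) monoid" where
  "symb_group = free_Abelian_group symbols"

text \<open>The multiplicative map sending \<open>e\<^bsub>\<eta>,a\<^esub>\<close> to the Gauss sum of \<open>\<eta> \<omega>\<^sup>a\<close>.\<close>

definition ev ::
  "nat \<Rightarrow> ('a :: finite_field alg_closure \<Rightarrow> complex) ^ 'r \<Rightarrow> (('a, 'r) symb \<Rightarrow>\<^sub>0 int) \<Rightarrow> complex" where
  "ev m \<omega> x = (\<Prod>b\<in>Poly_Mapping.keys x.
     gauss_sum m (twisted_char m (fst b) \<omega> (snd b)) powi Poly_Mapping.lookup x b)"

definition rel_P ::
  "('a :: finite_field \<Rightarrow> complex) \<Rightarrow> int ^ 'r \<Rightarrow> (('a, 'r) symb \<Rightarrow>\<^sub>0 int)" where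
  "rel_P \<eta> a = frag_of (\<eta>, a) + frag_of (\<lambda>t. cnj (\<eta> t), - a)"

definition rel_Q ::
  "('a :: finite_field \<Rightarrow> complex) \<Rightarrow> int ^ 'r \<Rightarrow> (('a, 'r) symb \<Rightarrow>\<^sub>0 int)" where
  "rel_Q \<eta> a = - frag_of (\<lambda>t. \<eta> t ^ CHAR('a), of_nat CHAR('a) *s a) + frag_of (\<eta>, a)"

definition rel_R ::
  "('a :: finite_field \<Rightarrow> complex) \<Rightarrow> int ^ 'r \<Rightarrow> nat \<Rightarrow> (('a, 'r) symb \<Rightarrow>\<^sub>0 int)" where
  "rel_R \<eta> a d = - frag_of (\<lambda>t. \<eta> t ^ d, of_nat d *s a) +
     (\<Sum>\<xi>\<in>{\<xi> \<in> mult_chars UNIV. (\<lambda>t. \<xi> t ^ d) = triv_char}. frag_of (\<lambda>t. \<eta> t * \<xi> t, a))"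

definition rel_subgroup :: "(('a :: finite_field, 'r :: finite) symb \<Rightarrow>\<^sub>0 int) set" where
  "rel_subgroup = generate symb_group
     ({rel_P \<eta> a | \<eta> a. \<eta> \<in> mult_chars UNIV \<and> a \<noteq> 0} \<union>
      {rel_Q \<eta> a | \<eta> a. \<eta> \<in> mult_chars UNIV \<and> a \<noteq> 0} \<union>
      {rel_R \<eta> a d | \<eta> a d. \<eta> \<in> mult_chars UNIV \<and> a \<noteq> 0 \<and> d > 0 \<and> d dvd CARD('a) - 1})"


subsection \<open>Consistency of the definitions\<close>

interpretation ac: vector_space "\<lambda>(c :: 'a :: field) (x :: 'a alg_closure). to_ac c * x"
  by unfold_locales (simp_all add: algebra_simps)

lemma CARD_eq_CHAR_power: "\<exists>n>0. CARD('a :: finite_field) = CHAR('a) ^ n"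
proof -
  let ?p = "CHAR('a)"
  let ?m = "multiplicity ?p CARD('a)"
  define G where "G = \<lparr>carrier = (UNIV :: 'a set), monoid.mult = (+), one = (0 :: 'a)\<rparr>"
  interpret G: group G
  proof (rule groupI)
    fix x assume "x \<in> carrier G"
    show "\<exists>y\<in>carrier G. y \<otimes>\<^bsub>G\<^esub> x = \<one>\<^bsub>G\<^esub>"
      by (intro bexI[of _ "-x"]) (auto simp: G_def)
  qed (auto simp: G_def add_ac)
  have pow: "x [^]\<^bsub>G\<^esub> n = of_nat n * x" for x and n :: nat
    by (induction n) (auto simp: G_def nat_pow_def algebra_simps)
  have fin: "finite (carrier G)" by (simp add: G_def)
  have ord: "Coset.order G = CARD('a)" by (simp add: order_def G_def)
  have "r = ?p" if r: "Factorial_Ring.prime r" "r dvd CARD('a)" for r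
  proof -
    obtain k where "CARD('a) = r * k" using r(2) by (elim dvdE)
    then obtain H where H: "subgroup H G" "card H = r"
      using sylow_thm[of r G 1 k] r(1) fin ord G.group_axioms by auto
    have "H \<noteq> {0}" using H(2) r(1) by auto
    moreover have "0 \<in> H" using subgroup.one_closed[OF H(1)] by (simp add: G_def)
    ultimately have "\<exists>x\<in>H. x \<noteq> 0" by auto
    then obtain x where x: "x \<in> H" "x \<noteq> 0" by (elim bexE)
    interpret H: group "G\<lparr>carrier := H\<rparr>"
      using H(1) by (rule G.subgroup_imp_group)
    have "x [^]\<^bsub>G\<lparr>carrier := H\<rparr>\<^esub> Coset.order (G\<lparr>carrier := H\<rparr>) = \<one>\<^bsub>G\<lparr>carrier := H\<rparr>\<^esub>"
      using x by (intro H.pow_order_eq_1) simp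
    hence "x [^]\<^bsub>G\<^esub> r = 0"
      using H(2) by (simp add: order_def nat_pow_def G_def)
    hence "of_nat r = (0 :: 'a)" using x by (simp add: pow)
    hence "?p dvd r" by (simp add: of_nat_eq_0_iff_char_dvd)
    thus ?thesis using r(1) by (metis CHAR_prime primes_dvd_imp_eq)
  qed
  hence "prime_factors CARD('a) \<subseteq> {?p}" by (auto simp: prime_factors_dvd)
  moreover have "prime_factors CARD('a) \<noteq> {}"
    using CHAR_dvd_CARD[where ?'a = 'a] CHAR_prime[where ?'a = 'a]
    by (auto simp: prime_factors_dvd)
  ultimately have pf: "prime_factors CARD('a) = {?p}" by blast
  have "CARD('a) = (\<Prod>p\<in>prime_factors CARD('a). p ^ multiplicity p CARD('a))"
    using prime_factorization_nat[of "CARD('a)"] by simp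
  hence "CARD('a) = ?p ^ ?m" by (simp add: pf)
  moreover have "?m > 0"
    using CHAR_dvd_CARD[where ?'a = 'a] by (simp add: multiplicity_gt_zero_iff)
  ultimately show ?thesis by blast
qed

lemma CHAR_power_multiplicity:
  "CHAR('a :: finite_field) ^ multiplicity CHAR('a) (CARD('a) ^ m) = CARD('a) ^ m"
proof -
  obtain n where n: "CARD('a) = CHAR('a) ^ n" using CARD_eq_CHAR_power by blast
  hence "CARD('a) ^ m = CHAR('a) ^ (n * m)" by (simp only: power_mult)
  moreover have "multiplicity CHAR('a) (CHAR('a) ^ (n * m)) = n * m"
    by (intro multiplicity_prime_power prime_imp_prime_elem CHAR_prime)
  ultimately show ?thesis by (simp only:)
qed

lemma CARD_ge_2: "CARD('a :: finite_field) > 1"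
  using card_mono[of UNIV "{0, 1 :: 'a}"] by simp

lemma frobenius_add:
  "(x + y :: 'a :: finite_field alg_closure) ^ (CARD('a) ^ m) = x ^ (CARD('a) ^ m) + y ^ (CARD('a) ^ m)"
  by (rule freshmans_dream'[where n = "multiplicity CHAR('a) (CARD('a) ^ m)"])
     (simp_all add: CHAR_power_multiplicity)

lemma ext_field_closed:
  fixes x y :: "'a :: finite_field alg_closure" and c :: 'a
  shows "to_ac c \<in> ext_field m"
    and "x \<in> ext_field m \<Longrightarrow> y \<in> ext_field m \<Longrightarrow> x + y \<in> ext_field m"
    and "x \<in> ext_field m \<Longrightarrow> y \<in> ext_field m \<Longrightarrow> x * y \<in> ext_field m"
    and "x \<in> ext_field m \<Longrightarrow> - x \<in> ext_field m"
    and "x \<in> ext_field m \<Longrightarrow> inverse x \<in> ext_field m"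
proof -
  show c: "to_ac c \<in> ext_field m" for c :: 'a
    by (simp add: ext_field_def finite_field_power_card_power_eq_same flip: to_ac_power)
  show m: "x \<in> ext_field m \<Longrightarrow> y \<in> ext_field m \<Longrightarrow> x * y \<in> ext_field m" for x y :: "'a alg_closure"
    by (simp add: ext_field_def power_mult_distrib)
  show "x \<in> ext_field m \<Longrightarrow> - x \<in> ext_field m"
    using m[OF c[of "-1"], of x] by simp
qed (simp_all add: ext_field_def frobenius_add power_inverse)

lemma card_ext_field:
  assumes "m > 0"
  shows "card (ext_field m :: 'a :: finite_field alg_closure set) = CARD('a) ^ m"
proof -
  let ?n = "CARD('a) ^ m"
  have n: "?n > 1" using CARD_ge_2[where ?'a = 'a] assms by (intro one_less_power)
  define P :: "'a alg_closure poly" where "P = Polynomial.monom 1 ?n - Polynomial.monom 1 1"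
  have deg: "Polynomial.degree P = ?n"
    using n unfolding P_def diff_conv_add_uminus
    by (subst degree_add_eq_left) (simp_all add: degree_monom_eq)
  have P0: "P \<noteq> 0" using deg n by auto
  have lc: "Polynomial.coeff P (Polynomial.degree P) = 1" using n unfolding deg by (simp add: P_def)
  have roots: "poly P x = 0 \<longleftrightarrow> x \<in> ext_field m" for x
    by (auto simp: P_def poly_monom ext_field_def)
  have "CHAR('a alg_closure) dvd ?n"
    using CHAR_dvd_CARD[where ?'a = 'a] assms by (simp add: dvd_power_le dvd_trans[OF _ dvd_power])
  hence "of_nat ?n = (0 :: 'a alg_closure)" by (simp only: of_nat_eq_0_iff_char_dvd)
  hence der: "pderiv P = -1"
    by (simp add: P_def pderiv_diff pderiv_monom monom_0 flip: of_nat_power one_pCons)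
  obtain A where A: "size A = Polynomial.degree P" "P = Polynomial.smult (Polynomial.coeff P (Polynomial.degree P)) (\<Prod>x\<in>#A. [:-x, 1:])"
    using alg_closed_imp_factorization[OF P0] by blast
  have PA: "P = (\<Prod>x\<in>#A. [:-x, 1:])" using A(2) lc by simp
  have "set_mset A = ext_field m"
    by (auto simp flip: roots simp: PA poly_prod_mset prod_mset_zero_iff)
  moreover have "count A x \<le> 1" for x
  proof (rule ccontr)
    assume "\<not> ?thesis"
    hence "{#x, x#} \<subseteq># A"
      by (simp add: subseteq_mset_def)
    then obtain B where "A = {#x, x#} + B" by (metis subset_mset.le_iff_add)
    hence "P = [:-x, 1:] * ([:-x, 1:] * (\<Prod>x\<in>#B. [:-x, 1:]))" by (simp add: PA)
    hence "poly (pderiv P) x = 0" by (simp only: pderiv_mult poly_add poly_mult) simp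
    thus False by (simp add: der)
  qed
  hence "A = mset_set (set_mset A)"
    by (intro multiset_eqI) (metis count_mset_set(1) count_mset_set(3) count_greater_eq_one_iff dual_order.antisym finite_set_mset not_in_iff)
  ultimately show ?thesis using A(1) deg by (metis size_mset_set)
qed

lemma finite_ext_field [simp]: "m > 0 \<Longrightarrow> finite (ext_field m :: 'a :: finite_field alg_closure set)"
  using card_ext_field[where ?'a = 'a, of m] CARD_ge_2[where ?'a = 'a] by (intro card_ge_0_finite) simp

lemma card_ac_span:
  fixes B :: "'a :: finite_field alg_closure set"
  assumes "finite B" "ac.independent B"
  shows "card (ac.span B) = CARD('a) ^ card B"
proof -
  let ?f = "\<lambda>u. \<Sum>v\<in>B. to_ac (u v) * v"
  have inj: "inj_on ?f (B \<rightarrow>\<^sub>E UNIV)"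
  proof (rule inj_onI)
    fix u w :: "'a alg_closure \<Rightarrow> 'a"
    assume uw: "u \<in> B \<rightarrow>\<^sub>E UNIV" "w \<in> B \<rightarrow>\<^sub>E UNIV" "?f u = ?f w"
    have "(\<Sum>v\<in>B. to_ac (u v - w v) * v) = 0"
      using uw(3) by (simp add: algebra_simps sum_subtractf)
    hence "\<forall>v\<in>B. u v - w v = 0"
      using ac.independentD[OF assms(2,1) order_refl, of "\<lambda>v. u v - w v"] by simp
    thus "u = w" using uw by (intro PiE_ext) auto
  qed
  have img: "?f ` (B \<rightarrow>\<^sub>E UNIV) = ac.span B"
  proof -
    have "?f u \<in> ?f ` (B \<rightarrow>\<^sub>E UNIV)" for u
      by (intro image_eqI[of _ _ "restrict u B"]) auto
    thus ?thesis using assms(1) by (auto simp: ac.span_finite)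
  qed
  have "card (ac.span B) = card (B \<rightarrow>\<^sub>E (UNIV :: 'a set))"
    using card_image[OF inj] unfolding img .
  thus ?thesis using assms(1) by (simp add: card_PiE)
qed

lemma subspace_ext_field: "ac.subspace (ext_field m :: 'a :: finite_field alg_closure set)"
  using ext_field_closed(1)[where ?'a = 'a, of 0 m]
  by (auto simp: ac.subspace_def intro: ext_field_closed)

lemma dim_ext_field:
  assumes "m > 0"
  shows "ac.dim (ext_field m :: 'a :: finite_field alg_closure set) = m"
proof -
  let ?V = "ext_field m :: 'a alg_closure set"
  obtain B where B: "B \<subseteq> ?V" "ac.independent B" "?V \<subseteq> ac.span B" "card B = ac.dim ?V"
    using ac.basis_exists by blast
  have "finite B" using B(1) assms finite_subset finite_ext_field by blast
  moreover have "ac.span B = ?V"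
    using B subspace_ext_field by (metis ac.span_subspace)
  ultimately have "CARD('a) ^ ac.dim ?V = CARD('a) ^ m"
    using card_ac_span[of B] B card_ext_field[OF assms, where ?'a = 'a] by simp
  thus ?thesis using CARD_ge_2[where ?'a = 'a] by (simp add: power_inject_exp)
qed

lemma ext_field_unique:
  fixes F :: "'a :: finite_field alg_closure set"
  assumes "m > 0"
    and sub: "range to_ac \<subseteq> F"
    and add: "\<And>x y. x \<in> F \<Longrightarrow> y \<in> F \<Longrightarrow> x + y \<in> F"
    and mult: "\<And>x y. x \<in> F \<Longrightarrow> y \<in> F \<Longrightarrow> x * y \<in> F"
    and dim: "ac.dim F = m"
  shows "F = ext_field m"
proof -
  obtain B where B: "B \<subseteq> F" "ac.independent B" "F \<subseteq> ac.span B" "card B = ac.dim F"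
    using ac.basis_exists by blast
  have fB: "finite B" using B(4) dim \<open>m > 0\<close> by (intro card_ge_0_finite) simp
  have "to_ac 0 \<in> F" using sub by blast
  hence "ac.subspace F" using sub by (auto simp: ac.subspace_def intro: add mult)
  hence "ac.span B = F" using B by (metis ac.span_subspace)
  hence card: "card F = CARD('a) ^ m" using card_ac_span[OF fB B(2)] B(4) dim by simp
  have fin: "finite F" using card CARD_ge_2[where ?'a = 'a] by (intro card_ge_0_finite) simp
  have "F \<subseteq> ext_field m"
  proof
    fix x assume x: "x \<in> F"
    show "x \<in> ext_field m"
    proof (cases "x = 0")
      case False
      have inj: "inj_on ((*) x) (F - {0})" using False by (auto intro: inj_onI)
      have "(*) x ` (F - {0}) = F - {0}"
        using inj fin x False by (intro endo_inj_surj) (auto intro: mult)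
      hence "\<Prod>(F - {0}) = (\<Prod>y\<in>F - {0}. x * y)"
        using prod.reindex[OF inj, of "\<lambda>y. y"] by (simp add: o_def)
      also have "\<dots> = x ^ card (F - {0}) * \<Prod>(F - {0})" by (simp add: prod.distrib)
      finally have "x ^ card (F - {0}) = 1" using fin by (simp add: prod_zero_iff)
      hence "x ^ Suc (card (F - {0})) = x" by simp
      moreover have "Suc (card (F - {0})) = card F"
        using \<open>to_ac 0 \<in> F\<close> fin by (metis card.remove to_ac_0)
      ultimately show ?thesis by (simp add: ext_field_def card)
    qed (use ext_field_closed(1)[where ?'a = 'a, of 0 m] in simp)
  qed
  thus ?thesis
    using card card_ext_field[OF \<open>m > 0\<close>, where ?'a = 'a] finite_ext_field[OF \<open>m > 0\<close>, where ?'a = 'a]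
    by (intro card_subset_eq) auto
qed

lemma ext_field_1: "ext_field 1 = (range to_ac :: 'a :: finite_field alg_closure set)"
proof -
  have "card (range to_ac :: 'a alg_closure set) = CARD('a)"
    by (intro card_image inj_to_ac)
  thus ?thesis
    using card_ext_field[where ?'a = 'a, of 1] finite_ext_field[where ?'a = 'a, of 1]
    by (intro sym[OF card_subset_eq]) (auto intro: ext_field_closed)
qed

lemma to_ac_ext_norm:
  fixes x :: "'a :: finite_field alg_closure"
  assumes "x \<in> ext_field m"
  shows "to_ac (ext_norm m x) = (\<Prod>i<m. x ^ (CARD('a) ^ i))"
proof -
  let ?N = "\<Prod>i<m. x ^ (CARD('a) ^ i)"
  have "?N ^ CARD('a) = (\<Prod>i<m. x ^ (CARD('a) ^ Suc i))"
    by (simp add: prod_power_distrib mult.commute flip: power_mult)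
  also have "\<dots> * x = (\<Prod>i<Suc m. x ^ (CARD('a) ^ i))"
    by (subst prod.lessThan_Suc_shift) (simp add: mult.commute)
  also have "\<dots> = ?N * x" using assms by (simp add: ext_field_def)
  finally have "?N ^ CARD('a) * x = ?N * x" .
  moreover have "?N ^ CARD('a) = ?N" if "x = 0"
  proof -
    have "?N = 0 \<or> ?N = 1"
      using that by (cases m) (auto simp: prod.lessThan_Suc_shift)
    thus ?thesis using CARD_ge_2[where ?'a = 'a] by (elim disjE) (simp_all only: power_one, simp)
  qed
  ultimately have "?N ^ CARD('a) = ?N" using mult_right_cancel[of x] by blast
  hence "?N \<in> ext_field 1" by (simp add: ext_field_def)
  thus ?thesis unfolding ext_norm_def ext_field_1 by (rule to_ac_of_ac)
qed

lemma of_nat_prime_field_rep: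
  fixes x :: "'a :: finite_field alg_closure"
  assumes "x \<in> ext_field m"
  shows "prime_field_rep (abs_trace m x) < CHAR('a)"
    and "of_nat (prime_field_rep (abs_trace m x)) = abs_trace m x"
proof -
  let ?p = "CHAR('a)" and ?n = "multiplicity CHAR('a) (CARD('a) ^ m)"
  define y where "y = abs_trace m x"
  have "y ^ ?p = (\<Sum>i<?n. x ^ (?p ^ Suc i))"
    unfolding y_def abs_trace_def
    by (subst freshmans_dream_sum) (simp_all add: mult.commute flip: power_mult)
  also have "\<dots> + x = (\<Sum>i<Suc ?n. x ^ (?p ^ i))"
    by (subst sum.lessThan_Suc_shift) simp
  also have "\<dots> = y + x"
    using assms by (simp add: y_def abs_trace_def CHAR_power_multiplicity ext_field_def)
  finally have y: "y ^ ?p = y" by simp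
  have inj: "inj_on (of_nat :: nat \<Rightarrow> 'a alg_closure) {..<?p}"
    by (auto simp: inj_on_def of_nat_eq_iff_cong_CHAR cong_def)
  let ?R = "{z :: 'a alg_closure. z ^ ?p = z}"
  define P :: "'a alg_closure poly" where "P = Polynomial.monom 1 ?p - Polynomial.monom 1 1"
  have p: "?p > 1" using CHAR_prime[where ?'a = 'a] prime_gt_1_nat by blast
  have deg: "Polynomial.degree P = ?p"
    using p unfolding P_def diff_conv_add_uminus
    by (subst degree_add_eq_left) (simp_all add: degree_monom_eq)
  hence "P \<noteq> 0" using p by auto
  moreover have "{z. poly P z = 0} = ?R" by (auto simp: P_def poly_monom)
  ultimately have R: "finite ?R" "card ?R \<le> ?p"
    using poly_roots_finite[of P] card_poly_roots_bound[of P] deg by auto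
  have "(of_nat k :: 'a alg_closure) ^ ?p = of_nat k" for k
    by (induction k) (simp_all add: freshmans_dream power_0_left)
  hence "of_nat ` {..<?p} \<subseteq> ?R" by auto
  hence "of_nat ` {..<?p} = ?R"
    using R inj by (intro card_seteq) (simp_all add: card_image)
  with y have "y \<in> of_nat ` {..<?p}" by simp
  then obtain k where k: "k < ?p" "y = of_nat k" by auto
  hence "\<exists>!j. j < ?p \<and> of_nat j = y"
    using inj by (intro ex1I[of _ k]) (auto dest: inj_onD)
  from theI'[OF this] show "prime_field_rep (abs_trace m x) < ?p"
    "of_nat (prime_field_rep (abs_trace m x)) = abs_trace m x"
    by (auto simp: prime_field_rep_def y_def)
qed

lemma finite_mult_chars:
  fixes F :: "'b :: field set"
  assumes "n > 0" "finite F" "1 \<in> F" and mult: "\<And>x y. x \<in> F \<Longrightarrow> y \<in> F \<Longrightarrow> x * y \<in> F"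
    and pow: "\<And>x. x \<in> F - {0} \<Longrightarrow> x ^ n = 1"
  shows "finite (mult_chars F)"
proof -
  have "\<omega> x ^ n = 1" if \<omega>: "\<omega> \<in> mult_chars F" and x: "x \<in> F - {0}" for \<omega> x
  proof -
    have "1 \<in> F - {0}" using assms(3) by simp
    hence "\<omega> (1 * 1) = \<omega> 1 * \<omega> 1" "\<omega> 1 \<noteq> 0"
      using \<omega> unfolding mult_chars_def by blast+
    hence 1: "\<omega> 1 = 1" by simp
    have "x ^ k \<in> F - {0} \<and> \<omega> (x ^ k) = \<omega> x ^ k" for k
      using x \<omega> by (induction k) (auto simp: 1 assms(3) mult mult_chars_def)
    thus ?thesis using pow[OF x] 1 by metis
  qed
  hence "mult_chars F \<subseteq>
      {\<omega>. \<forall>x. (x \<in> F - {0} \<longrightarrow> \<omega> x \<in> {z. z ^ n = 1}) \<and> (x \<notin> F - {0} \<longrightarrow> \<omega> x = 0)}"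
    by (auto simp: mult_chars_def)
  moreover have "finite {z :: complex. z ^ n = 1}"
    using assms(1) finite_roots_unity[of n] by simp
  ultimately show ?thesis
    using assms(2) finite_set_of_finite_funs[of "F - {0}" "{z :: complex. z ^ n = 1}" 0]
    by (meson finite_Diff finite_subset)
qed

lemma finite_mult_chars_UNIV: "finite (mult_chars (UNIV :: 'a :: finite_field set))"
proof (rule finite_mult_chars[where n = "CARD('a) - 1"])
  fix x :: 'a assume "x \<in> UNIV - {0}"
  moreover have "x * x ^ (CARD('a) - 1) = x"
    using finite_field_power_card_eq_same[of x] CARD_ge_2[where ?'a = 'a]
    by (simp flip: power_Suc)
  ultimately show "x ^ (CARD('a) - 1) = 1" by simp
qed (use CARD_ge_2[where ?'a = 'a] in auto)

lemma finite_mult_chars_ext_field: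
  assumes "m > 0"
  shows "finite (mult_chars (ext_field m :: 'a :: finite_field alg_closure set))"
proof (rule finite_mult_chars[where n = "CARD('a) ^ m - 1"])
  have n: "CARD('a) ^ m > 1" using CARD_ge_2[where ?'a = 'a] assms by (intro one_less_power)
  thus "CARD('a) ^ m - 1 > 0" by simp
  fix x :: "'a alg_closure" assume "x \<in> ext_field m - {0}"
  moreover from this have "x * x ^ (CARD('a) ^ m - 1) = x"
    using n by (simp add: ext_field_def flip: power_Suc)
  ultimately show "x ^ (CARD('a) ^ m - 1) = 1" by simp
qed (use assms ext_field_closed(1)[where ?'a = 'a, of 1 m] in \<open>auto intro: ext_field_closed\<close>)

end

theory Submission
  imports Defs "Jordan_Normal_Form.Char_Poly"
begin

text \<open>
  By Stickelberger's theorem, the valuation of a Gauss sum of the \<open>(-k)\<close>-th power of the Teichmueller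
  character of \<open>k\<^sub>m\<close> is governed by the sum of the base \<open>p\<close> digits of \<open>k\<close>.  Writing \<open>\<omega>\<close> in terms of
  an integer vector \<open>u\<close> of exponents, the hypothesis says that a certain combination of digit sums of
  the integers \<open>u \<bullet> a + e (q\<^sup>m - 1) / (q - 1)\<close> takes the same value for almost all \<open>u\<close>.  The difference of the
  digit sums of \<open>k + b\<close> and \<open>k\<close> is determined by the \<open>p\<close>-adic valuations of the integers between
  them, so it depends on \<open>u\<close> in a locally constant way \<open>p\<close>-adically, except that it jumps whenever the
  valuation of \<open>k + j\<close> grows, for \<open>u\<close> close to the hyperplane \<open>u \<bullet> a - e / (q - 1) + j = 0\<close>.
  Letting \<open>u\<close> approach a rational point \<open>A / M\<close> with \<open>p\<close> not dividing \<open>M\<close>, the jumps must cancel: the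
  exponents of \<open>x\<close>, weighted by which symbols have a hyperplane through that point, sum to zero.  These functionals vanish
  on the relations, and they detect every nonzero element in a normal form to which each element can
  be reduced by the relations.
\<close>

text \<open>The constant \<open>D m\<close> is unknown, so only differences between good tuples
  carry information. One difference, from \<open>u\<close> to \<open>u + w\<close>, turns a digit
  sum into a sum of valuations of consecutive integers, most of which depend on \<open>u\<close> in
  a way that cannot be controlled symbol by symbol. A second difference, between two orders of
  approximation to \<open>A / M\<close>, removes the locally constant part and leaves pure counts of
  hyperplanes. Hence four tuples have to be good at once, which density one permits by a union
  bound. The values at \<open>t\<close> are roots of unity and have valuation 0, and
  \<open>N\<close> only scales valuations. The direction \<open>w\<close> is generic: it pairs to a
  nonzero integer with every vector in \<open>x\<close>. Its sign selects one symbol from each pair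
  linked by \<open>rel_P\<close>, and its length fixes the window of hyperplanes that a functional
  sees. No prime ideal is constructed. Valuations are read off from a ring homomorphism from Z[z] to
  the algebraic closure of k, z a root of unity, with the Gauss sum \<open>gs 1\<close> in the role
  of a uniformiser.\<close>

subsection \<open>Reduction of roots of unity to characteristic p\<close>

text \<open>The matrix is the circulant one: it has the sum as an eigenvalue, with eigenvector the powers of \<open>z\<close>.\<close>

lemma algebraic_int_root_of_unity_sum:
  fixes z :: complex and c :: "nat \<Rightarrow> int"
  assumes "M > 0" "z ^ M = 1"
  shows "algebraic_int (\<Sum>r<M. of_int (c r) * z ^ r)"
proof -
  define A :: "int mat" where "A = mat M M (\<lambda>(i, j). c ((j + (M - i)) mod M))"
  define v :: "complex vec" where "v = vec M (\<lambda>j. z ^ j)"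
  define s where "s = (\<Sum>r<M. of_int (c r) * z ^ r)"
  have A: "A \<in> carrier_mat M M" and cA: "(map_mat of_int A :: complex mat) \<in> carrier_mat M M"
    by (auto simp: A_def)
  have zm: "z ^ (k mod M) = z ^ k" for k
  proof -
    have "z ^ k = z ^ (M * (k div M) + k mod M)" by simp
    also have "\<dots> = z ^ (k mod M)" by (simp only: power_add power_mult assms) simp
    finally show ?thesis by simp
  qed
  have "map_mat of_int A *\<^sub>v v = s \<cdot>\<^sub>v v"
  proof (rule eq_vecI)
    fix i assume "i < dim_vec (s \<cdot>\<^sub>v v)"
    hence i: "i < M" by (simp add: v_def)
    have bij: "bij_betw (\<lambda>j. (j + (M - i)) mod M) {..<M} {..<M}"
    proof (rule bij_betwI[where g = "\<lambda>r. (r + i) mod M"])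
      fix j assume "j \<in> {..<M}"
      thus "((j + (M - i)) mod M + i) mod M = j" using i
        by (simp add: mod_simps add.assoc)
    next
      fix j assume "j \<in> {..<M}"
      moreover have "((j + i) mod M + (M - i)) mod M = (j + (i + (M - i))) mod M"
        by (simp only: mod_add_left_eq add.assoc)
      ultimately show "((j + i) mod M + (M - i)) mod M = j" using i by simp
    qed (use assms in auto)
    have "(map_mat of_int A *\<^sub>v v) $ i = (\<Sum>j<M. of_int (c ((j + (M - i)) mod M)) * z ^ j)"
      using i by (simp add: A_def v_def scalar_prod_def atLeast0LessThan)
    also have "\<dots> = (\<Sum>j<M. of_int (c ((j + (M - i)) mod M)) * z ^ (((j + (M - i)) mod M) + i))"
    proof (intro sum.cong refl arg_cong2[where f = "(*)"])
      fix j assume "j \<in> {..<M}"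
      hence "z ^ j = z ^ ((j + M) mod M)" by simp
      also have "\<dots> = z ^ (j + (M - i) + i)" unfolding zm using i by simp
      finally show "z ^ j = z ^ (((j + (M - i)) mod M) + i)"
        by (simp only: power_add zm)
    qed
    also have "\<dots> = (\<Sum>r<M. of_int (c r) * z ^ (r + i))"
      using sum.reindex_bij_betw[OF bij, of "\<lambda>r. of_int (c r) * z ^ (r + i)"] by simp
    also have "\<dots> = s * z ^ i" by (simp add: s_def sum_distrib_right power_add mult.assoc)
    finally show "(map_mat of_int A *\<^sub>v v) $ i = (s \<cdot>\<^sub>v v) $ i"
      using i by (simp add: v_def)
  qed (simp add: A_def v_def)
  moreover have "v \<noteq> 0\<^sub>v M"
  proof
    assume "v = 0\<^sub>v M"
    hence "v $ 0 = 0" using assms by simp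
    thus False using assms by (simp add: v_def)
  qed
  ultimately have "eigenvalue (map_mat of_int A) s"
    unfolding eigenvalue_def eigenvector_def by (intro exI[of _ v]) (auto simp: v_def A_def)
  hence "poly (char_poly (map_mat of_int A)) s = 0"
    using eigenvalue_root_char_poly[OF cA] by simp
  hence "poly (map_poly of_int (char_poly A)) s = 0"
    by (simp add: of_int_hom.char_poly_hom[OF A])
  moreover have "Polynomial.lead_coeff (char_poly A) = 1"
    using degree_monic_char_poly[OF A] by simp
  ultimately show ?thesis unfolding algebraic_int_altdef_ipoly s_def by blast
qed

text \<open>Otherwise 1/p would be a rational algebraic integer, hence an integer. So
  \<open>p\<close> is not invertible in Z[z], which is what lets a reduction modulo \<open>p\<close>
  exist.\<close>

lemma prime_multiple_root_of_unity_sum_neq_1: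
  fixes z :: complex
  assumes "M > 0" "z ^ M = 1" "p > 1"
  shows "of_nat p * (\<Sum>r<M. of_int (c r) * z ^ r) \<noteq> (1 :: complex)"
proof
  let ?s = "\<Sum>r<M. of_int (c r) * z ^ r"
  assume *: "of_nat p * ?s = 1"
  hence "?s = 1 / of_nat p" using assms by (simp add: field_simps)
  hence "?s \<in> \<rat>" by simp
  hence "?s \<in> \<int>" using algebraic_int_root_of_unity_sum[OF assms(1,2)] rational_algebraic_int_is_int
    by blast
  then obtain k where "?s = of_int k" by (elim Ints_cases)
  with * have "of_int (int p * k) = (1 :: complex)" by simp
  hence "int p * k = 1" unfolding of_int_eq_1_iff .
  thus False using assms(3) by (simp add: zmult_eq_1_iff)
qed

lemma coeff_of_int_poly: "Polynomial.coeff (of_int_poly f :: 'c :: comm_ring_1 poly) i = of_int (Polynomial.coeff f i)"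
  by (simp add: coeff_map_poly)

lemma ext_field_diff_0_iff:
  assumes "m > 0"
  shows "x \<in> ext_field m - {0} \<longleftrightarrow> x ^ (CARD('a) ^ m - 1) = (1 :: 'a :: finite_field alg_closure)"
proof -
  let ?n = "CARD('a) ^ m"
  have n: "?n > 1" using CARD_ge_2[where ?'a = 'a] assms by (intro one_less_power)
  then obtain k where k: "?n = Suc k" "k > 0" by (cases ?n) auto
  show ?thesis unfolding ext_field_def k(1) using k(2) by (cases "x = 0") (auto simp: power_0_left)
qed

lemma card_ext_field_diff_0:
  assumes "m > 0"
  shows "card (ext_field m - {0 :: 'a :: finite_field alg_closure}) = CARD('a) ^ m - 1"
proof -
  have "0 \<in> (ext_field m :: 'a alg_closure set)" using ext_field_closed(1)[of "0::'a" m] by simp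
  thus ?thesis using card_ext_field[OF assms, where ?'a = 'a] by simp
qed

lemma poly_of_int_ext_field:
  "x \<in> ext_field m \<Longrightarrow> poly (of_int_poly f) x \<in> (ext_field m :: 'a :: finite_field alg_closure set)"
proof (induction f)
  case 0
  show ?case using ext_field_closed(1)[of "0::'a" m] by simp
next
  case (pCons a f)
  have "of_int a = to_ac (of_int a :: 'a)" by simp
  hence "of_int a \<in> (ext_field m :: 'a alg_closure set)" by (metis ext_field_closed(1))
  thus ?case using pCons by (auto simp: map_poly_pCons intro: ext_field_closed)
qed

lemma degree_monom_minus_1:
  assumes "k > 0"
  shows "Polynomial.degree (Polynomial.monom 1 k - 1 :: 'c :: comm_ring_1 poly) = k
    \<and> Polynomial.lead_coeff (Polynomial.monom 1 k - 1 :: 'c poly) = 1"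
proof -
  have "Polynomial.degree (Polynomial.monom 1 k + (-1) :: 'c poly) = Polynomial.degree (Polynomial.monom 1 k :: 'c poly)"
    using assms by (intro degree_add_eq_left) (simp_all add: degree_monom_eq)
  thus ?thesis using assms by (simp add: degree_monom_eq)
qed

text \<open>
  If every point \<open>y\<close> of the algebraic closure failed for some \<open>F y\<close>, then the product of the \<open>1 - F y ^ n\<close> over
  all \<open>n\<close>-th roots of unity \<open>y\<close> would vanish at all of them but be \<open>1\<close> at \<open>z\<close>; its \<open>p\<close>-th power lies in the ideal
  generated by \<open>p\<close> and \<open>X ^ (p * n) - 1\<close>, so \<open>1 / p\<close> would be an algebraic integer.
\<close>

lemma root_of_unity_reduction:
  fixes z :: complex
  assumes m: "m > 0" and z: "z ^ (CHAR('a) * (CARD('a) ^ m - 1)) = 1"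
  shows "\<exists>y :: 'a :: finite_field alg_closure.
           \<forall>f :: int poly. poly (of_int_poly f) z = 0 \<longrightarrow> poly (of_int_poly f) y = 0"
proof (rule ccontr)
  assume "\<not> ?thesis"
  then obtain F :: "'a alg_closure \<Rightarrow> int poly" where
    F: "\<And>y. poly (of_int_poly (F y)) z = 0" "\<And>y. poly (of_int_poly (F y)) y \<noteq> 0" by metis
  define p where "p = CHAR('a)"
  define n where "n = CARD('a) ^ m - 1"
  define M where "M = p * n"
  define S where "S = ext_field m - {0 :: 'a alg_closure}"
  have p: "Factorial_Ring.prime p" unfolding p_def by (rule CHAR_prime)
  have p1: "p > 1" using p prime_gt_1_nat by blast
  have "CARD('a) ^ m > 1" using CARD_ge_2[where ?'a = 'a] m by (intro one_less_power)
  hence n: "n > 0" by (simp add: n_def)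
  have M: "M > 0" using n p1 by (simp add: M_def)
  have charK: "CHAR('a alg_closure) = p" by (simp add: p_def)
  have S_iff: "y \<in> S \<longleftrightarrow> y ^ n = 1" for y
    unfolding S_def n_def by (rule ext_field_diff_0_iff[OF m])
  have fS: "finite S" using m by (simp add: S_def)
  have cS: "card S = n" unfolding S_def n_def by (rule card_ext_field_diff_0[OF m])
  define H where "H = (\<Prod>y\<in>S. 1 - F y ^ n)"
  have Hz: "poly (of_int_poly H) z = 1"
    by (simp add: H_def of_int_poly_hom.hom_prod of_int_poly_hom.hom_minus of_int_poly_hom.hom_power
          poly_prod F n zero_power)
  have Hy: "poly (of_int_poly H) y = 0" if y: "y \<in> S" for y :: "'a alg_closure"
  proof -
    have "poly (of_int_poly (F y)) y \<in> S"
      using y F(2)[of y] by (auto simp: S_def intro: poly_of_int_ext_field)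
    hence "poly (of_int_poly (F y)) y ^ n = 1" by (simp add: S_iff)
    hence "poly (of_int_poly (1 - F y ^ n)) y = 0"
      by (simp add: of_int_poly_hom.hom_minus of_int_poly_hom.hom_power)
    thus ?thesis using y fS unfolding H_def of_int_poly_hom.hom_prod poly_prod
      by (intro prod_zero) auto
  qed
  define E :: "'a alg_closure poly" where "E = Polynomial.monom 1 n - 1"
  have Xroot: "poly E y = 0 \<longleftrightarrow> y \<in> S" for y
    by (simp add: E_def poly_monom S_iff)
  have X0: "E \<noteq> 0" using degree_monom_minus_1[OF n, where ?'c = "'a alg_closure"] n unfolding E_def by auto
  \<comment> \<open>The \<open>n\<close> elements of \<open>S\<close> would all be roots of a
    nonzero remainder of degree less than \<open>n\<close>.\<close>
  have "of_int_poly H mod E = 0"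
  proof (rule ccontr)
    assume nz: "of_int_poly H mod E \<noteq> 0"
    have "S \<subseteq> {y. poly (of_int_poly H mod E) y = 0}"
    proof safe
      fix y assume y: "y \<in> S"
      have "poly (of_int_poly H) y = poly (E * (of_int_poly H div E) + of_int_poly H mod E) y"
        by simp
      thus "poly (of_int_poly H mod E) y = 0"
        using Hy[OF y] y Xroot[of y] by (simp only: poly_add poly_mult) simp
    qed
    hence "n \<le> card {y. poly (of_int_poly H mod E) y = 0}"
      using poly_roots_finite[OF nz] cS by (metis card_mono)
    also have "\<dots> \<le> Polynomial.degree (of_int_poly H mod E)"
      by (rule card_poly_roots_bound[OF nz])
    also have "\<dots> < Polynomial.degree E"
      using degree_mod_less[OF X0, of "of_int_poly H"] nz by auto
    also have "\<dots> = n" using degree_monom_minus_1[OF n, where ?'c = "'a alg_closure"] by (simp add: E_def)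
    finally show False by simp
  qed
  hence XH: "E dvd of_int_poly H" by (rule dvd_eq_mod_eq_0[THEN iffD2])
  have "(E + 1) ^ p = E ^ p + 1 ^ p"
    by (rule freshmans_dream) (use p charK in simp_all)
  hence "E ^ p = Polynomial.monom 1 n ^ p - 1" by (simp add: E_def)
  also have "\<dots> = Polynomial.monom 1 M - 1" by (simp add: M_def monom_power mult.commute)
  finally have Xp: "E ^ p = Polynomial.monom 1 M - 1" .
  define P :: "int poly" where "P = Polynomial.monom 1 M - 1"
  have P0: "P \<noteq> 0" using degree_monom_minus_1[OF M, where ?'c = int] M unfolding P_def by auto
  have degP: "Polynomial.degree P = M"
    unfolding P_def using degree_monom_minus_1[OF M, where ?'c = int] by blast
  have lcP: "Polynomial.lead_coeff P = 1"
    unfolding P_def using degree_monom_minus_1[OF M, where ?'c = int] by blast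
  \<comment> \<open>\<open>P\<close> is monic, so pseudo-division is genuine division with remainder
    although the coefficients are integers.\<close>
  obtain g r where gr: "pseudo_divmod (H ^ p) P = (g, r)" by (cases "pseudo_divmod (H ^ p) P") auto
  have eq: "H ^ p = P * g + r"
    using pseudo_divmod(1)[OF P0 gr] unfolding lcP by simp
  have deg: "r = 0 \<or> Polynomial.degree r < M"
    using pseudo_divmod(2)[OF P0 gr] unfolding degP .
  have PK: "of_int_poly P = E ^ p"
    by (simp add: Xp P_def of_int_poly_hom.hom_minus)
  have "E ^ p dvd of_int_poly H ^ p" using XH by (rule dvd_power_same)
  moreover have "(of_int_poly H :: 'a alg_closure poly) ^ p = E ^ p * of_int_poly g + of_int_poly r"
    by (simp add: eq PK of_int_poly_hom.hom_add of_int_poly_hom.hom_mult flip: of_int_poly_hom.hom_power)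
  ultimately have dvd: "E ^ p dvd of_int_poly r" by (simp add: dvd_add_right_iff)
  have r0: "(of_int_poly r :: 'a alg_closure poly) = 0"
  proof (rule ccontr)
    assume nz: "(of_int_poly r :: 'a alg_closure poly) \<noteq> 0"
    have "M = Polynomial.degree (E ^ p)"
      unfolding Xp using degree_monom_minus_1[OF M, where ?'c = "'a alg_closure"] by simp
    also have "\<dots> \<le> Polynomial.degree (of_int_poly r :: 'a alg_closure poly)"
      using dvd nz by (rule dvd_imp_degree_le)
    also have "\<dots> \<le> Polynomial.degree r" by (rule degree_map_poly_le)
    finally show False using deg nz by auto
  qed
  have "int p dvd Polynomial.coeff r i" for i
  proof -
    have "of_int (Polynomial.coeff r i) = (0 :: 'a alg_closure)"
      using r0 by (metis coeff_of_int_poly coeff_0)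
    thus ?thesis by (simp add: of_int_eq_0_iff_char_dvd p_def)
  qed
  then obtain c where c: "\<And>i. Polynomial.coeff r i = int p * c i" unfolding dvd_def by metis
  \<comment> \<open>At \<open>z\<close> only the remainder survives, and its coefficients are
    divisible by \<open>p\<close>: this exhibits 1 as \<open>p\<close> times an element of
    Z[z].\<close>
  have "1 = poly (of_int_poly (H ^ p)) z" by (simp add: of_int_poly_hom.hom_power Hz)
  also have "\<dots> = poly (of_int_poly P) z * poly (of_int_poly g) z + poly (of_int_poly r) z"
    by (simp add: eq of_int_poly_hom.hom_add of_int_poly_hom.hom_mult)
  also have "poly (of_int_poly P) z = 0"
    using z by (simp add: P_def of_int_poly_hom.hom_minus poly_monom M_def p_def n_def)
  also have "poly (of_int_poly r) z = (\<Sum>i<M. of_int (Polynomial.coeff r i) * z ^ i)"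
  proof -
    have le: "Polynomial.degree (of_int_poly r :: complex poly) < M"
      using deg M degree_map_poly_le[of "of_int :: int \<Rightarrow> complex" r] by auto
    have "poly (of_int_poly r) z = (\<Sum>i\<le>Polynomial.degree (of_int_poly r :: complex poly). of_int (Polynomial.coeff r i) * z ^ i)"
      by (simp add: poly_altdef coeff_of_int_poly)
    also have "\<dots> = (\<Sum>i<M. of_int (Polynomial.coeff r i) * z ^ i)"
    proof (rule sum.mono_neutral_left)
      show "\<forall>i\<in>{..<M} - {..Polynomial.degree (of_int_poly r :: complex poly)}.
        of_int (Polynomial.coeff r i) * z ^ i = 0"
        by (auto simp flip: coeff_of_int_poly simp: coeff_eq_0)
    qed (use le in auto)
    finally show ?thesis .
  qed
  also have "\<dots> = of_nat p * (\<Sum>i<M. of_int (c i) * z ^ i)"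
    by (simp add: c sum_distrib_left mult_ac)
  finally show False
    using prime_multiple_root_of_unity_sum_neq_1[of M z p c] M z p1
    by (simp add: M_def p_def n_def)
qed

no_notation Matrix.vec_index (infixl "$" 100)

section \<open>Pairings, digit sums and complex roots of unity\<close>

definition dot :: "int ^ 'r \<Rightarrow> int ^ 'r \<Rightarrow> int" where
  "dot u a = (\<Sum>j\<in>UNIV. u $ j * a $ j)"

lemma geometric_sum_nat: "c > 0 \<Longrightarrow> (c - 1) * (\<Sum>i<m. c ^ i) = c ^ m - (1 :: nat)"
proof -
  assume "c > 0"
  then obtain d where c: "c = Suc d" by (cases c) auto
  have "Suc (d * (\<Sum>i<m. Suc d ^ i)) = Suc d ^ m" by (induction m) (auto simp: algebra_simps)
  thus ?thesis unfolding c by (metis diff_Suc_1)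
qed

text \<open>By Legendre's formula, this is the sum of the base \<open>p\<close> digits of \<open>k\<close>.\<close>

definition digsum :: "nat \<Rightarrow> nat \<Rightarrow> int" where
  "digsum p k = (\<Sum>j=1..k. 1 - (int p - 1) * int (multiplicity p j))"

lemma digsum_0 [simp]: "digsum p 0 = 0"
  by (simp add: digsum_def)

lemma digsum_Suc: "digsum p (Suc k) = digsum p k + 1 - (int p - 1) * int (multiplicity p (Suc k))"
  by (simp add: digsum_def)

text \<open>From p k to p (k + 1) there are p - 1 integers prime to p and one multiple of p, whose
  multiplicity exceeds that of k + 1 by one. The extra p - 1 cancels all but one of the p increments
  1.\<close>

lemma digsum_mult:
  assumes "Factorial_Ring.prime p"
  shows "digsum p (p * k) = digsum p k"
proof (induction k)
  case (Suc k)
  have p: "p > 1" using assms prime_gt_1_nat by blast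
  have low: "digsum p (p * k + i) = digsum p (p * k) + int i" if "i < p" for i
    using that
  proof (induction i)
    case (Suc i)
    have "\<not> p dvd p * k + Suc i"
    proof
      assume "p dvd p * k + Suc i"
      hence "p dvd Suc i" using dvd_add_right_iff[of p "p * k" "Suc i"] by simp
      thus False using Suc.prems by (auto dest: dvd_imp_le)
    qed
    hence "multiplicity p (Suc (p * k + i)) = 0" by (simp add: not_dvd_imp_multiplicity_0)
    thus ?case using Suc by (simp add: digsum_Suc)
  qed simp
  have "multiplicity p (p * Suc k) = Suc (multiplicity p (Suc k))"
    using assms p by (intro multiplicity_times_same) (auto simp: prime_gt_0_nat)
  moreover have "p * Suc k = Suc (p * k + (p - 1))" using p by simp
  ultimately have "digsum p (p * Suc k) =
      digsum p (p * k + (p - 1)) + 1 - (int p - 1) * int (Suc (multiplicity p (Suc k)))"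
    by (metis digsum_Suc)
  moreover have "digsum p (p * k + (p - 1)) = digsum p k + int (p - 1)"
    using low[of "p - 1"] p Suc.IH by simp
  ultimately show ?case using p by (simp add: digsum_Suc algebra_simps of_nat_diff)
qed simp

lemma cis_2pi_mult_eq_1_iff: "cis (2 * pi * x) = 1 \<longleftrightarrow> x \<in> \<int>"
proof -
  have "cis (2 * pi * x) = 1 \<longleftrightarrow> (\<exists>k::int. 2 * pi * x = of_int (2 * k) * pi)"
    by (simp add: cis_conv_exp exp_eq_1)
  also have "\<dots> \<longleftrightarrow> (\<exists>k::int. x = of_int k)"
    by (intro ex_cong1) (auto simp: field_simps)
  finally show ?thesis by (auto simp: Ints_def)
qed

lemma root_of_unity_cis:
  assumes "z ^ n = 1" "n > 0"
  obtains j where "j < n" "z = cis (2 * pi * real j / real n)"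
  using Complex.bij_betw_roots_unity[OF assms(2)] assms(1) unfolding bij_betw_def
  by (auto simp: set_eq_iff image_iff)

lemma divide_Ints_iff: "n > 0 \<Longrightarrow> (real_of_int k / real n \<in> \<int>) \<longleftrightarrow> int n dvd k"
proof
  assume n: "n > 0" and "real_of_int k / real n \<in> \<int>"
  then obtain j :: int where "real_of_int k / real n = j" by (elim Ints_cases)
  hence "real_of_int k = real_of_int (int n * j)" using n by (simp add: field_simps)
  hence "k = int n * j" by (simp only: of_int_eq_iff)
  thus "int n dvd k" by simp
qed (auto elim!: dvdE)

lemma of_nat_card_minus_1:
  assumes "m > 0"
  shows "(of_nat (CARD('a) ^ m - 1) :: 'a :: finite_field alg_closure) = -1"
proof -
  have "CHAR('a) dvd CARD('a) ^ m"
    using CHAR_dvd_CARD[where ?'a = 'a] assms by (intro dvd_trans[OF _ dvd_power]) auto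
  hence "of_nat (CARD('a) ^ m) = (0 :: 'a alg_closure)"
    by (simp add: of_nat_eq_0_iff_char_dvd del: of_nat_power)
  moreover obtain k where k: "CARD('a) ^ m = Suc k" by (metis not0_implies_Suc power_not_zero zero_less_card_finite less_not_refl)
  ultimately have "(of_nat k :: 'a alg_closure) = -1"
    by (simp add: eq_neg_iff_add_eq_0 add.commute del: of_nat_power)
  thus ?thesis unfolding k by simp
qed

subsection \<open>Gauss sums and Stickelberger's theorem\<close>

text \<open>
  \<open>R\<close> is a ring of integers with a reduction map \<open>\<phi>\<close> to characteristic \<open>p\<close>, and \<open>\<omega>\<close> is the Teichmueller character.
\<close>

locale teichmuller =
  fixes m :: nat and R :: "complex set" and \<phi> :: "complex \<Rightarrow> 'a :: finite_field alg_closure"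
    and \<omega> :: "'a alg_closure \<Rightarrow> complex"
  assumes m: "m \<ge> 2"
    and R_one: "1 \<in> R"
    and R_add: "x \<in> R \<Longrightarrow> y \<in> R \<Longrightarrow> x + y \<in> R"
    and R_minus: "x \<in> R \<Longrightarrow> - x \<in> R"
    and R_mult: "x \<in> R \<Longrightarrow> y \<in> R \<Longrightarrow> x * y \<in> R"
    and phi_one: "\<phi> 1 = 1"
    and phi_add: "x \<in> R \<Longrightarrow> y \<in> R \<Longrightarrow> \<phi> (x + y) = \<phi> x + \<phi> y"
    and phi_mult: "x \<in> R \<Longrightarrow> y \<in> R \<Longrightarrow> \<phi> (x * y) = \<phi> x * \<phi> y"
    and R_zeta: "cis (2 * pi / CHAR('a)) \<in> R"
    and phi_zeta: "\<phi> (cis (2 * pi / CHAR('a))) = 1"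
    and R_omega: "t \<in> ext_field m - {0} \<Longrightarrow> \<omega> t \<in> R"
    and phi_omega: "t \<in> ext_field m - {0} \<Longrightarrow> \<phi> (\<omega> t) = t"
    and omega_mult: "s \<in> ext_field m - {0} \<Longrightarrow> t \<in> ext_field m - {0} \<Longrightarrow> \<omega> (s * t) = \<omega> s * \<omega> t"
    and omega_power: "t \<in> ext_field m - {0} \<Longrightarrow> \<omega> t ^ (CARD('a) ^ m - 1) = 1"
begin

section \<open>The multiplicative group of k_m and its characters\<close>

abbreviation "K \<equiv> ext_field m :: 'a alg_closure set"
abbreviation "Kx \<equiv> ext_field m - {0} :: 'a alg_closure set"

definition "n = CARD('a) ^ m - 1"

lemma prime_p: "Factorial_Ring.prime CHAR('a)" by (rule CHAR_prime)

lemma p_gt_1: "CHAR('a) > 1" using prime_p prime_gt_1_nat by blast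

text \<open>The bound \<open>m \<ge> 2\<close> excludes q = 2, m = 1, where the group is trivial and
  \<open>gs 1\<close> would be 1 instead of reducing to 0.\<close>

lemma Suc_n: "Suc n = CARD('a) ^ m" and n_ge_3: "n \<ge> 3"
proof -
  have "2 ^ 2 \<le> CARD('a) ^ 2" using CARD_ge_2[where ?'a = 'a] by (intro power_mono) auto
  also have "\<dots> \<le> CARD('a) ^ m" using CARD_ge_2[where ?'a = 'a] m by (intro power_increasing) auto
  finally show "Suc n = CARD('a) ^ m" "n \<ge> 3" by (auto simp: n_def)
qed

lemma of_nat_n: "(of_nat n :: 'a alg_closure) = -1"
  unfolding n_def using m by (intro of_nat_card_minus_1) simp

lemma Kx_iff: "t \<in> Kx \<longleftrightarrow> t ^ n = 1"
  unfolding n_def using m by (intro ext_field_diff_0_iff) simp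

lemma fin_K [simp]: "finite K" using m by simp

lemma zero_K [simp]: "0 \<in> K" using ext_field_closed(1)[of "0 :: 'a" m] by simp

lemma one_Kx: "1 \<in> Kx" by (simp only: Kx_iff power_one)

lemma card_Kx: "card Kx = n"
  unfolding n_def using m by (intro card_ext_field_diff_0) simp

lemma Kx_mult: "s \<in> Kx \<Longrightarrow> t \<in> Kx \<Longrightarrow> s * t \<in> Kx"
  by (simp only: Kx_iff power_mult_distrib mult_1)

lemma Kx_inverse: "t \<in> Kx \<Longrightarrow> inverse t \<in> Kx"
  by (simp only: Kx_iff power_inverse inverse_1)

lemma Kx_power: "t \<in> Kx \<Longrightarrow> t ^ k \<in> Kx"
  by (induction k) (use one_Kx Kx_mult in auto)

lemma Kx_powi: "t \<in> Kx \<Longrightarrow> t powi k \<in> Kx"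
  by (cases "k \<ge> 0") (simp_all only: power_int_def if_True if_False Kx_power Kx_inverse)

lemma Kx_minus: "t \<in> Kx \<Longrightarrow> - t \<in> Kx"
  using ext_field_closed(4)[of t m] by auto

lemma R_zero: "0 \<in> R" using R_add[OF R_one R_minus[OF R_one]] by simp

lemma phi_zero: "\<phi> 0 = 0" using phi_add[OF R_zero R_zero] by (metis add.right_neutral add_left_cancel)

lemma phi_minus: "x \<in> R \<Longrightarrow> \<phi> (- x) = - \<phi> x"
  using phi_add[of x "-x"] R_minus[of x] by (simp add: phi_zero eq_neg_iff_add_eq_0 add.commute)

lemma R_sum: "(\<And>x. x \<in> A \<Longrightarrow> f x \<in> R) \<Longrightarrow> sum f A \<in> R"
  by (induction A rule: infinite_finite_induct) (auto intro: R_add R_zero)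

lemma R_prod: "(\<And>x. x \<in> A \<Longrightarrow> f x \<in> R) \<Longrightarrow> prod f A \<in> R"
  by (induction A rule: infinite_finite_induct) (auto intro: R_mult R_one)

lemma R_power: "x \<in> R \<Longrightarrow> x ^ k \<in> R"
  by (induction k) (auto intro: R_mult R_one)

lemma phi_power: "x \<in> R \<Longrightarrow> \<phi> (x ^ k) = \<phi> x ^ k"
  by (induction k) (auto simp: phi_one phi_mult R_power)

lemma phi_sum: "(\<And>x. x \<in> A \<Longrightarrow> f x \<in> R) \<Longrightarrow> \<phi> (sum f A) = (\<Sum>x\<in>A. \<phi> (f x))"
  by (induction A rule: infinite_finite_induct) (auto simp: phi_zero phi_add R_sum)

lemma phi_prod: "(\<And>x. x \<in> A \<Longrightarrow> f x \<in> R) \<Longrightarrow> \<phi> (prod f A) = (\<Prod>x\<in>A. \<phi> (f x))"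
  by (induction A rule: infinite_finite_induct) (auto simp: phi_one phi_mult R_prod)

lemma omega_n: "t \<in> Kx \<Longrightarrow> \<omega> t ^ n = 1"
  unfolding n_def by (rule omega_power)

lemma omega_nonzero: "t \<in> Kx \<Longrightarrow> \<omega> t \<noteq> 0"
  using omega_n[of t] n_ge_3 by (auto simp: power_0_left)

lemma omega_one: "\<omega> 1 = 1"
proof -
  have "\<omega> (1 * 1) = \<omega> 1 * \<omega> 1" by (rule omega_mult) (rule one_Kx)+
  moreover have "\<omega> 1 \<noteq> 0" by (rule omega_nonzero[OF one_Kx])
  ultimately show ?thesis by simp
qed

lemma omega_of_power: "t \<in> Kx \<Longrightarrow> \<omega> (t ^ k) = \<omega> t ^ k"
  by (induction k) (simp_all add: omega_one omega_mult Kx_power del: Diff_iff)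

lemma omega_inverse: "t \<in> Kx \<Longrightarrow> \<omega> (inverse t) = inverse (\<omega> t)"
  using omega_mult[of t "inverse t"] Kx_inverse[of t] omega_nonzero[of t]
  by (simp add: omega_one field_simps)

lemma omega_powi: "t \<in> Kx \<Longrightarrow> \<omega> (t powi k) = \<omega> t powi k"
  by (cases k rule: int_cases2) (simp_all add: power_int_minus omega_of_power omega_inverse Kx_power del: Diff_iff)

lemma inj_omega: "inj_on \<omega> Kx"
  by (rule inj_onI) (metis phi_omega)

lemma omega_image: "\<omega> ` Kx = {z. z ^ n = 1}"
proof (rule card_subset_eq)
  show "finite {z :: complex. z ^ n = 1}" using n_ge_3 by (intro finite_roots_unity) simp
  show "\<omega> ` Kx \<subseteq> {z. z ^ n = 1}" using omega_power by (auto simp: n_def)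
  have "card (\<omega> ` Kx) = n" using card_image[OF inj_omega] card_Kx by simp
  thus "card (\<omega> ` Kx) = card {z :: complex. z ^ n = 1}"
    using card_roots_unity_eq[of n] n_ge_3 by simp
qed

text \<open>With the exponent negated, Stickelberger's formula involves the digits of
  \<open>k\<close> itself rather than those of \<open>n - k\<close>.\<close>

definition chi :: "int \<Rightarrow> 'a alg_closure \<Rightarrow> complex" where
  "chi k t = (if t \<in> Kx then \<omega> t powi (- k) else 0)"

lemma chi_eq: "t \<in> Kx \<Longrightarrow> chi k t = \<omega> (t powi (- k))"
  unfolding chi_def by (simp add: omega_powi)

lemma chi_R: "chi k t \<in> R"
proof (cases "t \<in> Kx")
  case True
  show ?thesis unfolding chi_eq[OF True] by (rule R_omega[OF Kx_powi[OF True]])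
next
  case False
  show ?thesis unfolding chi_def if_not_P[OF False] by (rule R_zero)
qed

lemma phi_chi: "t \<in> Kx \<Longrightarrow> \<phi> (chi k t) = t powi (- k)"
  using phi_omega[OF Kx_powi] by (simp only: chi_eq)

lemma chi_mult: "s \<in> Kx \<Longrightarrow> t \<in> Kx \<Longrightarrow> chi k (s * t) = chi k s * chi k t"
  using Kx_mult[of s t] by (simp add: chi_def omega_mult power_int_mult_distrib)

lemma chi_nonzero: "t \<in> Kx \<Longrightarrow> chi k t \<noteq> 0"
  using omega_nonzero[of t] by (simp add: chi_def)

lemma chi_add: "t \<in> Kx \<Longrightarrow> chi (k + l) t = chi k t * chi l t"
  using omega_nonzero[of t] power_int_add[of "\<omega> t" "- k" "- l"] by (simp add: chi_def)

lemma chi_mult_n: "t \<in> Kx \<Longrightarrow> chi (int n * k) t = 1"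
proof -
  assume t: "t \<in> Kx"
  have "\<omega> t powi (int n * (- k)) = 1"
    unfolding power_int_mult using omega_n[OF t] by simp
  thus ?thesis using t by (simp add: chi_def)
qed

lemma chi_cong: "[k = l] (mod int n) \<Longrightarrow> chi k = chi l"
proof
  fix t
  assume "[k = l] (mod int n)"
  then obtain j where j: "k = l + int n * j" by (metis cong_iff_lin cong_sym)
  show "chi k t = chi l t"
  proof (cases "t \<in> Kx")
    case True thus ?thesis by (simp only: j chi_add chi_mult_n mult_1_right)
  next
    case False thus ?thesis by (auto simp: chi_def)
  qed
qed

text \<open>Cyclicity of the group of k_m is inherited through \<open>\<omega>\<close> from the
  complex roots of unity.\<close>

lemma generator: obtains c where "c \<in> Kx" "\<omega> c = cis (2 * pi / n)"
proof -
  have "cis (2 * pi / n) ^ n = 1" using n_ge_3 by (simp add: Complex.DeMoivre)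
  hence "cis (2 * pi / n) \<in> \<omega> ` Kx" unfolding omega_image by simp
  then obtain c where "cis (2 * pi / n) = \<omega> c" "c \<in> Kx" by (rule imageE)
  thus ?thesis using that[of c] by (simp only: simp_thms)
qed

lemma cis_powi_eq_1: "(cis (2 * pi / n)) powi k = 1 \<longleftrightarrow> int n dvd k"
proof -
  have "cis (2 * pi / n) powi k = cis (2 * pi * (k / n))" by (simp add: cis_power_int mult_ac)
  also have "\<dots> = 1 \<longleftrightarrow> int n dvd k"
    using n_ge_3 by (simp only: cis_2pi_mult_eq_1_iff divide_Ints_iff)
  finally show ?thesis .
qed

lemma chi_eq_iff: "chi k = chi l \<longleftrightarrow> [k = l] (mod int n)"
proof
  assume eq: "chi k = chi l"
  obtain c where c: "c \<in> Kx" "\<omega> c = cis (2 * pi / n)" by (rule generator)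
  have "chi (k + (- l)) c = chi l c * chi (- l) c" using eq by (simp only: chi_add[OF c(1)])
  also have "\<dots> = chi (l + (- l)) c" by (simp only: chi_add[OF c(1)])
  also have "\<dots> = 1" using c by (simp add: chi_def)
  finally have "cis (2 * pi / n) powi (- (k - l)) = 1" using c by (simp add: chi_def)
  thus "[k = l] (mod int n)" unfolding cis_powi_eq_1 by (simp add: cong_iff_dvd_diff dvd_diff_commute)
qed (rule chi_cong)

lemma chi_in_mult_chars: "chi k \<in> mult_chars K"
  unfolding mult_chars_def using chi_nonzero chi_mult by (auto simp: chi_def)

text \<open>A character is determined by its value at the generator \<open>c\<close>. That value is
  an \<open>n\<close>-th root of unity \<open>cis (2 * pi * j / n)\<close>, which is also the value
  of \<open>chi (- j)\<close> there.\<close>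

lemma mult_chars_eq: "mult_chars K = chi ` {0..<int n}"
proof safe
  fix f assume f: "f \<in> mult_chars K"
  obtain c where c: "c \<in> Kx" "\<omega> c = cis (2 * pi / n)" by (rule generator)
  have "f (1 * 1) = f 1 * f 1" "f 1 \<noteq> 0"
    using f one_Kx unfolding mult_chars_def by blast+
  hence f1: "f 1 = 1" by simp
  have fp: "f (c ^ j) = f c ^ j" for j
  proof (induction j)
    case (Suc j)
    have "f (c * c ^ j) = f c * f (c ^ j)"
      using f c(1) Kx_power[OF c(1), of j] unfolding mult_chars_def by blast
    thus ?case using Suc by simp
  qed (simp add: f1)
  have "f c ^ n = 1" using fp[of n] c(1) f1 by (simp only: Kx_iff)
  have surj: "\<exists>j<n. t = c ^ j" if t: "t \<in> Kx" for t
  proof -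
    have "(\<omega> t) ^ n = 1" using t omega_power by (simp add: n_def)
    then obtain j where j: "j < n" "\<omega> t = cis (2 * pi * j / n)"
      by (rule root_of_unity_cis) (use n_ge_3 in auto)
    hence "\<omega> t = \<omega> (c ^ j)" using c by (simp add: omega_of_power Complex.DeMoivre mult_ac)
    hence "t = c ^ j" using inj_omega t Kx_power[OF c(1)] by (meson inj_onD)
    thus ?thesis using j by blast
  qed
  from \<open>f c ^ n = 1\<close> obtain j where j: "j < n" "f c = cis (2 * pi * j / n)"
    by (rule root_of_unity_cis) (use n_ge_3 in auto)
  have "f = chi (- int j)"
  proof
    fix t
    show "f t = chi (- int j) t"
    proof (cases "t \<in> Kx")
      case True
      then obtain i where i: "t = c ^ i" using surj by blast
      have "f t = (cis (2 * pi / n) ^ j) ^ i" by (simp add: i fp j Complex.DeMoivre mult_ac)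
      also have "\<dots> = (cis (2 * pi / n) ^ i) ^ j" by (simp add: mult.commute flip: power_mult)
      also have "\<dots> = chi (- int j) t" using True c unfolding chi_def by (simp add: i omega_of_power)
      finally show ?thesis .
    next
      case False
      thus ?thesis using f unfolding mult_chars_def chi_def by auto
    qed
  qed
  also have "\<dots> = chi ((- int j) mod int n)" by (rule chi_cong) (simp add: cong_def)
  finally show "f \<in> chi ` {0..<int n}" using n_ge_3 by auto
qed (rule chi_in_mult_chars)

section \<open>The additive character and orthogonality sums\<close>

abbreviation "\<psi> \<equiv> add_char m :: 'a alg_closure \<Rightarrow> complex"

lemma psi_eq: "\<psi> x = cis (2 * pi / CHAR('a)) ^ prime_field_rep (abs_trace m x)"
  unfolding add_char_def Complex.DeMoivre unfolding cis_conv_exp by (simp add: mult_ac)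

lemma psi_R: "\<psi> x \<in> R" and phi_psi: "\<phi> (\<psi> x) = 1"
  unfolding psi_eq using R_zeta by (simp_all add: R_power phi_power phi_zeta)

lemma zeta_power_eq_1_iff: "cis (2 * pi / CHAR('a)) ^ j = 1 \<longleftrightarrow> CHAR('a) dvd j"
proof -
  have "cis (2 * pi / CHAR('a)) ^ j = cis (2 * pi * (real_of_int (int j) / real CHAR('a)))"
    by (simp add: Complex.DeMoivre mult_ac)
  also have "\<dots> = 1 \<longleftrightarrow> int CHAR('a) dvd int j"
    using p_gt_1 by (simp only: cis_2pi_mult_eq_1_iff divide_Ints_iff)
  finally show ?thesis by simp
qed

lemma psi_add:
  assumes "x \<in> K" "y \<in> K"
  shows "\<psi> (x + y) = \<psi> x * \<psi> y"
proof -
  let ?r = "\<lambda>x. prime_field_rep (abs_trace m x)"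
  have tr: "abs_trace m (x + y) = abs_trace m x + abs_trace m y"
    unfolding abs_trace_def sum.distrib[symmetric]
    by (intro sum.cong refl freshmans_dream') (simp_all add: prime_p)
  have "of_nat (?r (x + y)) = (of_nat (?r x + ?r y) :: 'a alg_closure)"
    using of_nat_prime_field_rep(2)[OF assms(1)] of_nat_prime_field_rep(2)[OF assms(2)]
      of_nat_prime_field_rep(2)[OF ext_field_closed(2)[OF assms]] by (simp add: tr)
  hence cong: "[?r (x + y) = ?r x + ?r y] (mod CHAR('a))"
    by (simp only: of_nat_eq_iff_cong_CHAR CHAR_alg_closure)
  have zp: "cis (2 * pi / CHAR('a)) ^ CHAR('a) = 1" by (simp add: zeta_power_eq_1_iff)
  have mod: "cis (2 * pi / CHAR('a)) ^ j = cis (2 * pi / CHAR('a)) ^ (j mod CHAR('a))" for j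
  proof -
    have "cis (2 * pi / CHAR('a)) ^ j = cis (2 * pi / CHAR('a)) ^ (CHAR('a) * (j div CHAR('a)) + j mod CHAR('a))"
      by simp
    thus ?thesis by (simp only: power_add power_mult zp power_one mult_1)
  qed
  show ?thesis unfolding psi_eq power_add[symmetric]
    using mod[of "?r (x + y)"] mod[of "?r x + ?r y"] cong by (simp add: cong_def)
qed

lemma CHAR_power_mult: "\<exists>L>0. multiplicity CHAR('a) (CARD('a) ^ m) = L \<and> CHAR('a) ^ L = CARD('a) ^ m"
proof -
  let ?L = "multiplicity CHAR('a) (CARD('a) ^ m)"
  have L: "CHAR('a) ^ ?L = CARD('a) ^ m" by (rule CHAR_power_multiplicity)
  have "?L \<noteq> 0"
  proof
    assume "?L = 0"
    hence "Suc n = 1" using L unfolding Suc_n by (metis power_0)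
    thus False using n_ge_3 by simp
  qed
  thus ?thesis using L by blast
qed

lemma psi_frob:
  assumes "x \<in> K"
  shows "\<psi> (x ^ CHAR('a)) = \<psi> x"
proof -
  let ?L = "multiplicity CHAR('a) (CARD('a) ^ m)" and ?p = "CHAR('a)"
  have "abs_trace m (x ^ ?p) + x = (\<Sum>i<Suc ?L. x ^ (?p ^ i))"
    unfolding abs_trace_def by (subst sum.lessThan_Suc_shift) (simp flip: power_mult)
  also have "\<dots> = abs_trace m x + x"
    using assms by (simp add: abs_trace_def CHAR_power_multiplicity ext_field_def)
  finally have "abs_trace m (x ^ ?p) = abs_trace m x" by simp
  thus ?thesis unfolding psi_eq by simp
qed

text \<open>The trace is a nonzero polynomial of degree at most p^(L - 1), less than the number p^L
  of elements of \<open>K\<close>, so it does not vanish everywhere on \<open>K\<close>.\<close>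

lemma psi_nontrivial: "\<exists>x\<in>K. \<psi> x \<noteq> 1"
proof -
  let ?p = "CHAR('a)"
  obtain L where L: "L > 0" "multiplicity CHAR('a) (CARD('a) ^ m) = L" "CHAR('a) ^ L = CARD('a) ^ m"
    using CHAR_power_mult by blast
  define P :: "'a alg_closure poly" where "P = (\<Sum>i<L. Polynomial.monom 1 (?p ^ i))"
  have P: "poly P x = abs_trace m x" for x
    unfolding P_def abs_trace_def L(2) by (simp add: poly_sum poly_monom)
  have "Polynomial.coeff P 1 = (\<Sum>i<L. if i = 0 then 1 else 0)"
    unfolding P_def coeff_sum using p_gt_1 by (intro sum.cong) (auto simp: power_0)
  also have "\<dots> = 1" using L(1) by simp
  finally have P0: "P \<noteq> 0" by auto
  have "Polynomial.degree P \<le> ?p ^ (L - 1)"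
    unfolding P_def
  proof (rule degree_sum_le)
    fix i assume "i \<in> {..<L}"
    hence "?p ^ i \<le> ?p ^ (L - 1)" using p_gt_1 by (intro power_increasing) auto
    thus "Polynomial.degree (Polynomial.monom 1 (?p ^ i) :: 'a alg_closure poly) \<le> ?p ^ (L - 1)"
      by (simp add: degree_monom_eq)
  qed simp
  also have "\<dots> < ?p ^ L" using p_gt_1 L(1) by (intro power_strict_increasing) auto
  also have "\<dots> = card K" using card_ext_field[of m, where ?'a = 'a] m L(3) by simp
  finally have "card {x. poly P x = 0} < card K"
    using card_poly_roots_bound[OF P0] by simp
  hence "\<not> K \<subseteq> {x. poly P x = 0}"
    using card_mono[OF poly_roots_finite[OF P0], of K] by (metis not_le)
  then obtain x where x: "x \<in> K" "abs_trace m x \<noteq> 0" by (auto simp: P)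
  have "\<not> ?p dvd prime_field_rep (abs_trace m x)"
    using of_nat_prime_field_rep(2)[OF x(1)] x(2)
    by (metis CHAR_alg_closure of_nat_eq_0_iff_char_dvd)
  thus ?thesis using x(1) by (auto simp: psi_eq zeta_power_eq_1_iff)
qed

lemma sum_psi: "(\<Sum>t\<in>Kx. \<psi> t) = -1"
proof -
  obtain a where a: "a \<in> K" "\<psi> a \<noteq> 1" using psi_nontrivial by blast
  have bij: "bij_betw (\<lambda>t. a + t) K K"
    by (rule bij_betwI[where g = "\<lambda>t. - a + t"]) (use a ext_field_closed(2)[where x = a] ext_field_closed(2)[where x = "- a"] ext_field_closed(4)[of a m] in auto)
  have "(\<Sum>t\<in>K. \<psi> t) = (\<Sum>t\<in>K. \<psi> (a + t))"
    by (rule sum.reindex_bij_betw[OF bij, symmetric])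
  also have "\<dots> = \<psi> a * (\<Sum>t\<in>K. \<psi> t)" using a by (simp add: psi_add sum_distrib_left)
  finally have 0: "(\<Sum>t\<in>K. \<psi> t) = 0" using a(2) by (metis mult_cancel_right1)
  have "\<psi> 0 = \<psi> 0 * \<psi> 0" using psi_add[of 0 0] by simp
  moreover have "\<psi> 0 \<noteq> 0" by (simp add: psi_eq)
  ultimately have "\<psi> 0 = 1" by simp
  thus ?thesis using 0 sum.remove[OF fin_K zero_K, of \<psi>] by (simp add: eq_neg_iff_add_eq_0 add.commute)
qed

lemma bij_mult: "c \<in> Kx \<Longrightarrow> bij_betw (\<lambda>t. c * t) Kx Kx"
proof (rule bij_betwI[where g = "\<lambda>t. inverse c * t"])
  assume c: "c \<in> Kx"
  show "(\<lambda>t. c * t) \<in> Kx \<rightarrow> Kx" using Kx_mult[OF c] by (rule Pi_I)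
  show "(\<lambda>t. inverse c * t) \<in> Kx \<rightarrow> Kx" using Kx_mult[OF Kx_inverse[OF c]] by (rule Pi_I)
qed simp_all

lemma sum_mult_shift: "c \<in> Kx \<Longrightarrow> (\<Sum>t\<in>Kx. f (c * t)) = (\<Sum>t\<in>Kx. f t)"
  by (rule sum.reindex_bij_betw[OF bij_mult])

lemma sum_chi: "\<not> int n dvd k \<Longrightarrow> (\<Sum>t\<in>Kx. chi k t) = 0"
proof -
  assume k: "\<not> int n dvd k"
  obtain c where c: "c \<in> Kx" "\<omega> c = cis (2 * pi / n)" by (rule generator)
  have c1: "chi k c \<noteq> 1" using c k by (simp add: chi_def cis_powi_eq_1)
  have "(\<Sum>t\<in>Kx. chi k t) = (\<Sum>t\<in>Kx. chi k (c * t))"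
    by (rule sum_mult_shift[OF c(1), of "chi k", symmetric])
  also have "\<dots> = chi k c * (\<Sum>t\<in>Kx. chi k t)"
    using c(1) by (simp add: chi_mult sum_distrib_left del: Diff_iff)
  finally show ?thesis using c1 by (metis mult_cancel_right1)
qed

lemma sum_Kx_power: "(\<Sum>t\<in>Kx. t ^ e) = (if n dvd e then -1 else 0)"
proof (cases "n dvd e")
  case True
  then obtain j where "e = n * j" by blast
  hence "t ^ e = 1" if "t \<in> Kx" for t
    using that unfolding Kx_iff by (simp add: power_mult)
  hence "(\<Sum>t\<in>Kx. t ^ e) = (\<Sum>t\<in>Kx. 1)" by (intro sum.cong) auto
  also have "\<dots> = of_nat (card Kx)" by simp
  finally show ?thesis using True by (simp only: card_Kx of_nat_n if_True)
next
  case False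
  obtain c where c: "c \<in> Kx" "\<omega> c = cis (2 * pi / n)" by (rule generator)
  have "\<omega> (c ^ e) \<noteq> 1"
    using c False cis_powi_eq_1[of "int e"] by (simp add: omega_of_power)
  hence c1: "c ^ e \<noteq> 1" using omega_one by metis
  have "(\<Sum>t\<in>Kx. t ^ e) = (\<Sum>t\<in>Kx. (c * t) ^ e)"
    by (rule sum_mult_shift[OF c(1), of "\<lambda>t. t ^ e", symmetric])
  also have "\<dots> = c ^ e * (\<Sum>t\<in>Kx. t ^ e)" by (simp add: power_mult_distrib sum_distrib_left)
  finally show ?thesis using c1 False by (metis mult_cancel_right1)
qed

section \<open>Gauss sums and Jacobi sums\<close>

definition "gs k = gauss_sum m (chi k)"

lemma gs_eq: "gs k = - (\<Sum>t\<in>Kx. chi k t * \<psi> t)"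
  by (simp add: gs_def gauss_sum_def)

lemma gs_R: "gs k \<in> R"
  unfolding gs_eq by (intro R_minus R_sum R_mult chi_R psi_R)

lemma phi_gs: "\<phi> (gs k) = - (\<Sum>t\<in>Kx. t powi (- k))"
proof -
  have "\<phi> (gs k) = - (\<Sum>t\<in>Kx. \<phi> (chi k t * \<psi> t))"
    unfolding gs_eq by (simp add: phi_minus phi_sum R_sum R_mult chi_R psi_R)
  also have "\<dots> = - (\<Sum>t\<in>Kx. t powi (- k))"
    by (intro arg_cong[where f = uminus] sum.cong refl)
       (simp add: phi_mult chi_R psi_R phi_psi phi_chi del: Diff_iff)
  finally show ?thesis .
qed

text \<open>After reduction the additive character becomes 1 and a power sum with exponent n - 1
  remains, which is not a multiple of n. Thus \<open>gs 1\<close> has positive valuation, as a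
  reference element for \<open>val\<close> must.\<close>

lemma phi_gs_1: "\<phi> (gs 1) = 0"
proof -
  have "t powi (- 1) = t ^ (n - 1)" if "t \<in> Kx" for t
  proof -
    have "t * t ^ (n - 1) = t ^ n" using n_ge_3 by (simp flip: power_Suc)
    also have "\<dots> = 1" using that by (simp only: Kx_iff)
    finally show ?thesis using that by (simp add: power_int_minus inverse_unique)
  qed
  hence "\<phi> (gs 1) = - (\<Sum>t\<in>Kx. t ^ (n - 1))" unfolding phi_gs by (simp del: Diff_iff)
  also have "\<not> n dvd n - 1" using n_ge_3 by (auto dest: dvd_imp_le)
  hence "- (\<Sum>t\<in>Kx. t ^ (n - 1)) = 0" by (simp only: sum_Kx_power if_False minus_zero)
  finally show ?thesis .
qed

lemma gs_0: "gs 0 = 1"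
proof -
  have "gs 0 = - (\<Sum>t\<in>Kx. \<psi> t)"
    unfolding gs_eq by (intro arg_cong[where f = uminus] sum.cong) (auto simp: chi_def)
  thus ?thesis by (simp only: sum_psi minus_minus)
qed

text \<open>Substitute t^p for t: this permutes the group and leaves the additive character
  unchanged, the trace being Frobenius invariant.\<close>

lemma gs_frobenius: "gs (int CHAR('a) * k) = gs k"
proof -
  let ?p = "CHAR('a)"
  obtain L where L: "L > 0" "multiplicity CHAR('a) (CARD('a) ^ m) = L" "CHAR('a) ^ L = CARD('a) ^ m"
    using CHAR_power_mult by blast
  have inj: "inj_on (\<lambda>t. t ^ ?p) Kx"
  proof (rule inj_on_inverseI[where g = "\<lambda>t. t ^ ?p ^ (L - 1)"])
    fix t assume t: "t \<in> Kx"
    have "(t ^ ?p) ^ ?p ^ (L - 1) = t ^ ?p ^ L"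
      using L(1) by (simp flip: power_mult power_Suc)
    thus "(t ^ ?p) ^ ?p ^ (L - 1) = t" using t L(3) by (simp add: ext_field_def)
  qed
  have "(\<lambda>t. t ^ ?p) ` Kx = Kx"
    using inj image_subsetI[of Kx "\<lambda>t. t ^ ?p" Kx, OF Kx_power] by (intro endo_inj_surj) auto
  hence bij: "bij_betw (\<lambda>t. t ^ ?p) Kx Kx" using inj by (simp add: bij_betw_def)
  have "gs k = - (\<Sum>t\<in>Kx. chi k (t ^ ?p) * \<psi> (t ^ ?p))"
    unfolding gs_eq using sum.reindex_bij_betw[OF bij, of "\<lambda>t. chi k t * \<psi> t"] by simp
  also have "\<dots> = gs (int ?p * k)" unfolding gs_eq
  proof (intro arg_cong[where f = uminus] sum.cong refl arg_cong2[where f = "(*)"])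
    fix t assume t: "t \<in> Kx"
    show "\<psi> (t ^ ?p) = \<psi> t" using t by (intro psi_frob) auto
    have "\<omega> t powi (- (int ?p * k)) = (\<omega> t powi (int ?p)) powi (- k)"
      by (subst power_int_mult[symmetric]) simp
    thus "chi k (t ^ ?p) = chi (int ?p * k) t"
      using t Kx_power[OF t, of ?p] by (simp add: chi_def omega_of_power)
  qed
  finally show ?thesis by simp
qed

lemma chi_inverse: "u \<in> Kx \<Longrightarrow> chi k (inverse u) = chi (- k) u"
  using Kx_inverse[of u] by (simp only: chi_eq power_int_inverse power_int_minus inverse_inverse_eq)

text \<open>The Jacobi sum in the quotient variable v = s / t, instead of a sum over pairs adding up
  to 1. At v = -1 the sum s + t vanishes, and this value is treated separately in
  \<open>gs_mult\<close>.\<close>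

definition "jac a b = - (\<Sum>v\<in>Kx - {-1}. chi a v * chi (- (a + b)) (v + 1))"

lemma jac_R: "jac a b \<in> R"
  unfolding jac_def by (intro R_minus R_sum R_mult chi_R)

text \<open>Write s = t v in the double sum. For v different from -1, rescaling t by v + 1 produces
  \<open>gs (a + b)\<close>; for v = -1 the additive character disappears and a plain character sum
  remains. Keeping that term lets one formula cover a + b = 0 as well.\<close>

lemma gs_mult:
  "gs a * gs b = chi a (-1) * (\<Sum>t\<in>Kx. chi (a + b) t) + jac a b * gs (a + b)"
proof -
  have m1: "-1 \<in> Kx" by (rule Kx_minus[OF one_Kx])
  define T where "T = (\<lambda>v. \<Sum>t\<in>Kx. chi a v * chi (a + b) t * \<psi> (t * (v + 1)))"
  have "gs a * gs b = (\<Sum>t\<in>Kx. \<Sum>s\<in>Kx. chi a s * \<psi> s * (chi b t * \<psi> t))"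
    unfolding gs_eq by (simp add: sum_product) (rule sum.swap)
  also have "\<dots> = (\<Sum>t\<in>Kx. \<Sum>v\<in>Kx. chi a v * chi (a + b) t * \<psi> (t * (v + 1)))"
  proof (rule sum.cong[OF refl])
    fix t assume t: "t \<in> Kx"
    have "(\<Sum>s\<in>Kx. chi a s * \<psi> s * (chi b t * \<psi> t)) =
      (\<Sum>v\<in>Kx. chi a (t * v) * \<psi> (t * v) * (chi b t * \<psi> t))"
      by (rule sum_mult_shift[OF t, of "\<lambda>s. chi a s * \<psi> s * (chi b t * \<psi> t)", symmetric])
    also have "\<dots> = (\<Sum>v\<in>Kx. chi a v * chi (a + b) t * \<psi> (t * (v + 1)))"
    proof (rule sum.cong[OF refl])
      fix v assume v: "v \<in> Kx"
      have "\<psi> (t * (v + 1)) = \<psi> (t * v) * \<psi> t"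
        using psi_add[of "t * v" t] Kx_mult[OF t v] t by (simp add: algebra_simps)
      thus "chi a (t * v) * \<psi> (t * v) * (chi b t * \<psi> t) = chi a v * chi (a + b) t * \<psi> (t * (v + 1))"
        using chi_mult[OF t v] chi_add[OF t] by simp
    qed
    finally show "(\<Sum>s\<in>Kx. chi a s * \<psi> s * (chi b t * \<psi> t)) =
      (\<Sum>v\<in>Kx. chi a v * chi (a + b) t * \<psi> (t * (v + 1)))" .
  qed
  also have "\<dots> = (\<Sum>v\<in>Kx. T v)" unfolding T_def by (rule sum.swap)
  also have "\<dots> = T (-1) + (\<Sum>v\<in>Kx - {-1}. T v)"
    using m1 by (intro sum.remove) auto
  also have "T (-1) = chi a (-1) * (\<Sum>t\<in>Kx. chi (a + b) t)"
  proof -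
    have "\<psi> 0 = \<psi> 0 * \<psi> 0" using psi_add[of 0 0] by simp
    moreover have "\<psi> 0 \<noteq> 0" by (simp add: psi_eq)
    ultimately have "\<psi> 0 = 1" by simp
    thus ?thesis by (simp add: T_def sum_distrib_left)
  qed
  also have "(\<Sum>v\<in>Kx - {-1}. T v) = (\<Sum>v\<in>Kx - {-1}. - (chi a v * chi (- (a + b)) (v + 1)) * gs (a + b))"
  proof (rule sum.cong[OF refl])
    fix v assume v: "v \<in> Kx - {-1}"
    have "v + 1 \<noteq> 0" using v by (auto simp: eq_neg_iff_add_eq_0)
    hence v1: "v + 1 \<in> Kx" using v one_Kx by (auto intro: ext_field_closed)
    have inv: "chi (a + b) (inverse (v + 1)) = chi (- (a + b)) (v + 1)"
      by (rule chi_inverse[OF v1])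
    have "T v = chi a v * (\<Sum>t\<in>Kx. chi (a + b) t * \<psi> ((v + 1) * t))"
      unfolding T_def by (simp add: sum_distrib_left mult_ac)
    also have "(\<Sum>t\<in>Kx. chi (a + b) t * \<psi> ((v + 1) * t)) =
      (\<Sum>t\<in>Kx. chi (a + b) (inverse (v + 1) * t) * \<psi> ((v + 1) * (inverse (v + 1) * t)))"
      by (rule sum_mult_shift[OF Kx_inverse[OF v1], of "\<lambda>t. chi (a + b) t * \<psi> ((v + 1) * t)", symmetric])
    also have "\<dots> = (\<Sum>t\<in>Kx. chi (- (a + b)) (v + 1) * (chi (a + b) t * \<psi> t))"
    proof (rule sum.cong[OF refl])
      fix t assume t: "t \<in> Kx"
      have e: "(v + 1) * (inverse (v + 1) * t) = t"
        using \<open>v + 1 \<noteq> 0\<close> by (simp flip: mult.assoc)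
      thus "chi (a + b) (inverse (v + 1) * t) * \<psi> ((v + 1) * (inverse (v + 1) * t)) =
        chi (- (a + b)) (v + 1) * (chi (a + b) t * \<psi> t)"
        unfolding e chi_mult[OF Kx_inverse[OF v1] t] inv by simp
    qed
    also have "\<dots> = - chi (- (a + b)) (v + 1) * gs (a + b)"
      by (simp add: gs_eq flip: sum_distrib_left)
    finally show "T v = - (chi a v * chi (- (a + b)) (v + 1)) * gs (a + b)" by simp
  qed
  also have "\<dots> = jac a b * gs (a + b)"
    by (simp add: jac_def sum_negf flip: sum_distrib_right)
  finally show ?thesis .
qed

text \<open>For the exponents 1 and -1, \<open>gs_mult\<close> gives the classical product
  \<open>gs 1 * gs (- 1) = chi 1 (- 1) * (n + 1)\<close>: the character sum contributes n, the
  Jacobi sum the remaining 1.\<close>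

lemma gs_1_nonzero: "gs 1 \<noteq> 0"
proof
  assume 0: "gs 1 = 0"
  have m1: "-1 \<in> Kx" by (rule Kx_minus[OF one_Kx])
  have chi0: "chi 0 v = 1" if "v \<in> Kx" for v using that by (simp add: chi_def)
  have "jac 1 (-1) = - (\<Sum>v\<in>Kx - {-1}. chi 1 v)"
  proof -
    have "chi 1 v * chi 0 (v + 1) = chi 1 v" if v: "v \<in> Kx - {-1}" for v
    proof -
      have "v + 1 \<noteq> 0" using v by (auto simp: eq_neg_iff_add_eq_0)
      hence "v + 1 \<in> Kx" using v one_Kx by (auto intro: ext_field_closed)
      thus ?thesis by (simp only: chi0 mult_1_right)
    qed
    hence "(\<Sum>v\<in>Kx - {-1}. chi 1 v * chi 0 (v + 1)) = (\<Sum>v\<in>Kx - {-1}. chi 1 v)"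
      by (intro sum.cong refl)
    thus ?thesis by (simp add: jac_def)
  qed
  also have "\<dots> = chi 1 (-1) - (\<Sum>v\<in>Kx. chi 1 v)"
    using sum.remove[of Kx "-1" "chi 1"] m1 by simp
  also have "\<not> int n dvd 1" using n_ge_3 by simp
  hence "(\<Sum>v\<in>Kx. chi 1 v) = 0" by (rule sum_chi)
  finally have j: "jac 1 (-1) = chi 1 (-1)" by simp
  have "(\<Sum>t\<in>Kx. chi 0 t) = (\<Sum>t\<in>Kx. 1)" by (rule sum.cong[OF refl]) (rule chi0)
  also have "\<dots> = of_nat n" using card_Kx by simp
  finally have "0 = chi 1 (-1) * (of_nat n + 1)"
    using gs_mult[of 1 "-1"] by (simp add: 0 j gs_0 algebra_simps)
  moreover have "(of_nat n + 1 :: complex) \<noteq> 0"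
    by (metis of_nat_Suc of_nat_eq_0_iff nat.simps(3) add.commute)
  ultimately show False using chi_nonzero[OF m1] by simp
qed

text \<open>Reduction turns the summand into the polynomial v^(n - 1) (v + 1)^k. In the binomial
  expansion, the power sum with exponent n - 1 + j vanishes unless n divides it; for j at most k < n
  this leaves j = 1 alone, with binomial coefficient k.\<close>

lemma phi_jac:
  assumes k: "0 < k" "k < n"
  shows "\<phi> (jac 1 (int k - 1)) = of_nat k"
proof -
  have m1: "-1 \<in> Kx" by (rule Kx_minus[OF one_Kx])
  have "\<phi> (jac 1 (int k - 1)) = - (\<Sum>v\<in>Kx - {-1}. \<phi> (chi 1 v * chi (- int k) (v + 1)))"
    unfolding jac_def by (simp add: phi_minus phi_sum R_sum R_mult chi_R)
  also have "(\<Sum>v\<in>Kx - {-1}. \<phi> (chi 1 v * chi (- int k) (v + 1))) = (\<Sum>v\<in>Kx - {-1}. v ^ (n - 1) * (v + 1) ^ k)"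
  proof (rule sum.cong[OF refl])
    fix v assume v: "v \<in> Kx - {-1}"
    hence v': "v \<in> Kx" by blast
    have "v + 1 \<noteq> 0" using v by (auto simp: eq_neg_iff_add_eq_0)
    hence v1: "v + 1 \<in> Kx" using v one_Kx by (auto intro: ext_field_closed)
    have "v * v ^ (n - 1) = v ^ n" using n_ge_3 by (simp flip: power_Suc)
    also have "\<dots> = 1" using v' by (simp only: Kx_iff)
    finally have "v powi (- 1) = v ^ (n - 1)" by (simp add: power_int_minus inverse_unique)
    thus "\<phi> (chi 1 v * chi (- int k) (v + 1)) = v ^ (n - 1) * (v + 1) ^ k"
      using phi_chi[OF v', of 1] phi_chi[OF v1, of "- int k"] by (simp add: phi_mult chi_R)
  qed
  also have "\<dots> = (\<Sum>v\<in>Kx. v ^ (n - 1) * (v + 1) ^ k)"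
    \<comment> \<open>The term at v = -1 is 0 because k > 0, so the sum may run over the whole
      group.\<close>
    using sum.remove[of Kx "-1" "\<lambda>v. v ^ (n - 1) * (v + 1) ^ k"] m1 k by (simp add: power_0_left)
  also have "\<dots> = (\<Sum>v\<in>Kx. \<Sum>j\<le>k. of_nat (k choose j) * v ^ (n - 1 + j))"
    by (intro sum.cong refl) (simp add: binomial_ring sum_distrib_left power_add mult_ac)
  also have "\<dots> = (\<Sum>j\<le>k. of_nat (k choose j) * (\<Sum>v\<in>Kx. v ^ (n - 1 + j)))"
    by (subst sum.swap) (simp add: sum_distrib_left)
  also have "\<dots> = (\<Sum>j\<le>k. if j = 1 then - of_nat k else 0)"
  proof (rule sum.cong[OF refl])
    fix j assume j: "j \<in> {..k}"
    have "n dvd n - 1 + j \<longleftrightarrow> j = 1"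
    proof
      assume d: "n dvd n - 1 + j"
      show "j = 1"
      proof (rule ccontr)
        assume "j \<noteq> 1"
        then consider "j = 0" | "j > 1" by linarith
        thus False
        proof cases
          case 1
          thus False using d n_ge_3 by (auto dest: dvd_imp_le)
        next
          case 2
          hence "n - 1 + j = n + (j - 1)" using n_ge_3 by simp
          hence "n dvd j - 1" using d by simp
          thus False using 2 j k by (auto dest!: dvd_imp_le)
        qed
      qed
    qed (use n_ge_3 in simp)
    thus "of_nat (k choose j) * (\<Sum>v\<in>Kx. v ^ (n - 1 + j)) = (if j = 1 then - of_nat k else 0 :: 'a alg_closure)"
      by (simp only: sum_Kx_power) simp
  qed
  also have "\<dots> = - of_nat k" using k by simp
  finally show ?thesis by simp
qed

text \<open>The value \<open>v\<close> plays the role of the valuation of \<open>z\<close>, normalised by the Gauss sum of the inverse of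
  the Teichmueller character.\<close>

definition val :: "complex \<Rightarrow> int \<Rightarrow> bool" where
  "val z v \<longleftrightarrow> (\<exists>A\<in>R. \<exists>B\<in>R. \<phi> A \<noteq> 0 \<and> \<phi> B \<noteq> 0 \<and> z * A = gs 1 powi v * B)"

lemma phi_nonzero: "\<phi> x \<noteq> 0 \<Longrightarrow> x \<noteq> 0"
  using phi_zero by auto

lemma val_unit: "x \<in> R \<Longrightarrow> \<phi> x \<noteq> 0 \<Longrightarrow> val x 0"
  unfolding val_def by (intro bexI[of _ 1] bexI[of _ x]) (auto simp: phi_one R_one)

lemma val_mult: "val y v \<Longrightarrow> val z w \<Longrightarrow> val (y * z) (v + w)"
  unfolding val_def
proof (elim bexE conjE)
  fix A B C D
  assume *: "A \<in> R" "B \<in> R" "\<phi> A \<noteq> 0" "\<phi> B \<noteq> 0" "y * A = gs 1 powi v * B"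
    "C \<in> R" "D \<in> R" "\<phi> C \<noteq> 0" "\<phi> D \<noteq> 0" "z * C = gs 1 powi w * D"
  have "y * z * (A * C) = (y * A) * (z * C)" by simp
  also have "\<dots> = gs 1 powi (v + w) * (B * D)"
    using gs_1_nonzero by (simp add: * power_int_add)
  finally show "\<exists>A\<in>R. \<exists>B\<in>R. \<phi> A \<noteq> 0 \<and> \<phi> B \<noteq> 0 \<and> y * z * A = gs 1 powi (v + w) * B"
    using * by (intro bexI[of _ "A * C"] bexI[of _ "B * D"]) (auto simp: phi_mult R_mult)
qed

lemma val_inverse: "val z v \<Longrightarrow> val (inverse z) (- v)"
  unfolding val_def
proof (elim bexE conjE)
  fix A B
  assume *: "A \<in> R" "B \<in> R" "\<phi> A \<noteq> 0" "\<phi> B \<noteq> 0" "z * A = gs 1 powi v * B"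
  have nz: "A \<noteq> 0" "B \<noteq> 0" "gs 1 powi v \<noteq> 0" using * phi_nonzero gs_1_nonzero by auto
  hence "z \<noteq> 0" using * by auto
  hence "inverse z * B = gs 1 powi (- v) * A"
    using nz *(5) by (simp add: power_int_minus field_simps)
  thus "\<exists>A\<in>R. \<exists>B\<in>R. \<phi> A \<noteq> 0 \<and> \<phi> B \<noteq> 0 \<and> inverse z * A = gs 1 powi (- v) * B"
    using * by (intro bexI[of _ B] bexI[of _ A]) auto
qed

lemma val_1: "val 1 0"
  by (rule val_unit) (simp_all add: R_one phi_one)

lemma val_power: "val z v \<Longrightarrow> val (z ^ k) (int k * v)"
proof (induction k)
  case (Suc k)
  thus ?case using val_mult[OF Suc.prems Suc.IH[OF Suc.prems]] by (simp add: algebra_simps)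
qed (simp add: val_1)

lemma val_powi: "val z v \<Longrightarrow> val (z powi k) (k * v)"
proof (cases "k \<ge> 0")
  case True
  thus "val z v \<Longrightarrow> val (z powi k) (k * v)" using val_power[of z v "nat k"] by (simp add: power_int_def)
next
  case False
  thus "val z v \<Longrightarrow> val (z powi k) (k * v)"
    using val_power[OF val_inverse[of z v], of "nat (- k)"] by (simp add: power_int_def)
qed

lemma val_prod: "(\<And>i. i \<in> A \<Longrightarrow> val (f i) (g i)) \<Longrightarrow> val (prod f A) (sum g A)"
  by (induction A rule: infinite_finite_induct) (auto simp: val_1 val_mult)

text \<open>If v > w, then 1 times an element with nonzero reduction would equal a positive power of
  \<open>gs 1\<close> times an element of \<open>R\<close>, which reduces to 0.\<close>

lemma val_unique:
  assumes "val z v" "val z w"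
  shows "v = w"
proof -
  have aux: "v \<le> w" if vz: "val z v" and wz: "val z w" for v w
  proof (rule ccontr)
    assume "\<not> v \<le> w"
    have "val 1 (v - w)"
    proof -
      have "z \<noteq> 0"
      proof
        assume z: "z = 0"
        obtain A B where "B \<in> R" "\<phi> B \<noteq> 0" "z * A = gs 1 powi v * B"
          using vz unfolding val_def by blast
        thus False using z gs_1_nonzero phi_nonzero by auto
      qed
      thus ?thesis using val_mult[OF vz val_inverse[OF wz]] by simp
    qed
    then obtain A B where AB: "A \<in> R" "B \<in> R" "\<phi> A \<noteq> 0" "A = gs 1 powi (v - w) * B"
      unfolding val_def by auto
    have "gs 1 powi (v - w) = gs 1 ^ nat (v - w)"
      using \<open>\<not> v \<le> w\<close> by (simp add: power_int_def)
    hence "\<phi> A = \<phi> (gs 1) ^ nat (v - w) * \<phi> B"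
      using AB by (simp add: phi_mult phi_power R_power gs_R)
    thus False using AB(3) \<open>\<not> v \<le> w\<close> by (simp add: phi_gs_1 power_0_left)
  qed
  show ?thesis using aux[OF assms] aux[OF assms(2,1)] by simp
qed

text \<open>
  Frobenius invariance removes a last digit \<open>0\<close>; a nonzero last digit is lowered by one by multiplying with
  \<open>gs 1\<close>, at the cost of a Jacobi sum that is nonzero after reduction.
\<close>

lemma val_gs_nat: "k < n \<Longrightarrow> val (gs (int k)) (digsum CHAR('a) k)"
proof (induction k rule: less_induct)
  case (less k)
  let ?p = "CHAR('a)"
  consider "k = 0" | "k = 1" | "k > 0" "?p dvd k" | "k \<ge> 2" "\<not> ?p dvd k" by linarith
  thus ?case
  proof cases
    case 1
    thus ?thesis by (simp add: gs_0 val_1)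
  next
    case 2
    have "multiplicity ?p (Suc 0) = 0" using p_gt_1 by (intro not_dvd_imp_multiplicity_0) simp
    hence d: "digsum ?p k = 1" using 2 digsum_Suc[of ?p 0] by simp
    have "val (gs 1) 1" unfolding val_def by (intro bexI[of _ 1]) (auto simp: R_one phi_one)
    thus ?thesis using 2 d by simp
  next
    case 3
    then obtain k' where k': "k = ?p * k'" by blast
    hence "k' < k" using 3 p_gt_1 by simp
    hence "val (gs (int k')) (digsum ?p k')" using less by simp
    thus ?thesis using k' gs_frobenius[of "int k'"] by (simp add: digsum_mult[OF prime_p])
  next
    case 4
    \<comment> \<open>Since 0 < k < n, the character sum in \<open>gs_mult\<close> vanishes and the
      product relation has no correction term.\<close>
    have nd: "\<not> int n dvd int k" using 4(1) less.prems by (auto dest: dvd_imp_le)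
    have "1 + (int k - 1) = int k" by simp
    hence eq: "gs 1 * gs (int k - 1) = jac 1 (int k - 1) * gs (int k)"
      using gs_mult[of 1 "int k - 1"] sum_chi[OF nd] by (simp only: mult_zero_right add_0)
    have ph: "\<phi> (jac 1 (int k - 1)) \<noteq> 0"
      using phi_jac[of k] 4 less.prems by (simp add: of_nat_eq_0_iff_char_dvd)
    hence j0: "jac 1 (int k - 1) \<noteq> 0" by (rule phi_nonzero)
    have vj: "val (jac 1 (int k - 1)) 0" by (rule val_unit[OF jac_R ph])
    have v1: "val (gs 1) 1" unfolding val_def by (intro bexI[of _ 1]) (auto simp: R_one phi_one)
    have "int k - 1 = int (k - 1)" using 4 by simp
    hence v2: "val (gs (int k - 1)) (digsum ?p (k - 1))" using less.IH[of "k - 1"] less.prems 4 by simp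
    have "gs (int k) = gs 1 * gs (int k - 1) * inverse (jac 1 (int k - 1))"
      using eq j0 by (simp add: field_simps)
    hence "val (gs (int k)) (1 + digsum ?p (k - 1) + - 0)"
      using val_mult[OF val_mult[OF v1 v2] val_inverse[OF vj]] by simp
    moreover have "digsum ?p k = digsum ?p (k - 1) + 1"
      using digsum_Suc[of ?p "k - 1"] 4 by (simp add: not_dvd_imp_multiplicity_0)
    ultimately show ?thesis by (simp add: add.commute)
  qed
qed

lemma val_gs: "0 \<le> k \<Longrightarrow> k < int n \<Longrightarrow> val (gs k) (digsum CHAR('a) (nat k))"
  using val_gs_nat[of "nat k"] by simp

section \<open>Characters of the ground field, tuples, and the valuation of
  \<open>ev\<close>\<close>

definition "Q = CARD('a) - 1"

lemma Q_pos: "Q > 0" using CARD_ge_2[where ?'a = 'a] by (simp add: Q_def)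

lemma Q_dvd_n: "n = Q * (\<Sum>i<m. CARD('a) ^ i)"
  unfolding n_def Q_def by (rule geometric_sum_nat[symmetric]) (use CARD_ge_2[where ?'a = 'a] in simp)

definition "nQ = (\<Sum>i<m. CARD('a) ^ i)"

lemma n_eq: "n = Q * nQ" unfolding nQ_def by (rule Q_dvd_n)

lemma nQ_pos: "nQ > 0" using n_eq n_ge_3 by (cases nQ) auto

lemma to_ac_Kx: "to_ac c \<in> Kx \<longleftrightarrow> c \<noteq> 0"
  using ext_field_closed(1)[of c m] by simp

lemma ext_norm_eq: "t \<in> Kx \<Longrightarrow> to_ac (ext_norm m t) = t ^ nQ"
  using to_ac_ext_norm[of t m] by (simp add: nQ_def power_sum)

text \<open>Take the norm of a generator of the group of k_m: it is the power with exponent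
  \<open>nQ\<close>, and n / nQ = Q.\<close>

lemma ground_generator: "\<exists>\<gamma>. \<gamma> \<noteq> 0 \<and> \<omega> (to_ac \<gamma>) = cis (2 * pi / Q)"
proof -
  obtain c where c: "c \<in> Kx" "\<omega> c = cis (2 * pi / n)" by (rule generator)
  have N: "to_ac (ext_norm m c) = c ^ nQ" by (rule ext_norm_eq[OF c(1)])
  have "\<omega> (c ^ nQ) = cis (2 * pi / Q)"
    using c nQ_pos Q_pos unfolding omega_of_power[OF c(1)] c(2) Complex.DeMoivre by (simp add: n_eq field_simps)
  moreover have "ext_norm m c \<noteq> 0"
    using N Kx_power[OF c(1), of nQ] to_ac_Kx[of "ext_norm m c"] by simp
  ultimately show ?thesis using N by metis
qed

definition tup :: "int ^ 'r \<Rightarrow> ('a alg_closure \<Rightarrow> complex) ^ 'r" where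
  "tup u = (\<chi> j. chi (u $ j))"

lemma chi_sum: "t \<in> Kx \<Longrightarrow> chi (sum f A) t = (\<Prod>i\<in>A. chi (f i) t)"
proof (induction A rule: infinite_finite_induct)
  case (insert i A)
  thus ?case by (simp add: chi_add del: Diff_iff)
qed (simp_all add: chi_def)

lemma chi_powi: "t \<in> Kx \<Longrightarrow> chi (k * l) t = chi k t powi l"
  by (simp add: chi_def flip: power_int_mult)

text \<open>On k_m the norm is the power with exponent \<open>nQ\<close> = (q^m - 1) / (q - 1), so
  twisting by a character of k shifts the exponent by a multiple of \<open>nQ\<close>.\<close>

lemma eta_norm:
  assumes \<eta>: "\<eta> \<in> mult_chars (UNIV :: 'a set)"
    and \<gamma>: "\<gamma> \<noteq> 0" "\<omega> (to_ac \<gamma>) = cis (2 * pi / Q)" "\<eta> \<gamma> = cis (2 * pi / Q) powi (- e)"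
    and t: "t \<in> Kx"
  shows "\<eta> (ext_norm m t) = chi (e * int nQ) t"
proof -
  have N: "to_ac (ext_norm m t) = t ^ nQ" by (rule ext_norm_eq[OF t])
  have "(\<omega> t ^ nQ) ^ Q = 1"
    using omega_n[OF t] by (simp add: n_eq mult.commute flip: power_mult)
  then obtain i where i: "i < Q" "\<omega> t ^ nQ = cis (2 * pi * real i / real Q)"
    using Q_pos by (elim root_of_unity_cis)
  have i': "\<omega> t ^ nQ = cis (2 * pi / Q) ^ i" using i by (simp add: Complex.DeMoivre mult_ac)
  have gK: "to_ac \<gamma> \<in> Kx" using \<gamma>(1) to_ac_Kx by blast
  have "\<omega> (t ^ nQ) = \<omega> (to_ac \<gamma> ^ i)"
    unfolding omega_of_power[OF t] omega_of_power[OF gK] \<gamma>(2) i' ..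
  hence "t ^ nQ = to_ac \<gamma> ^ i" using inj_omega Kx_power[OF t] Kx_power[OF gK] by (meson inj_onD)
  hence "ext_norm m t = \<gamma> ^ i" using N by (simp flip: to_ac_power)
  moreover have "\<eta> (\<gamma> ^ j) = \<eta> \<gamma> ^ j" for j
  proof (induction j)
    case 0
    have "(1 :: 'a) \<in> UNIV - {0}" by simp
    hence "\<eta> (1 * 1) = \<eta> 1 * \<eta> 1" "\<eta> 1 \<noteq> 0" using \<eta> unfolding mult_chars_def by blast+
    thus ?case by simp
  next
    case (Suc j)
    have "\<eta> (\<gamma> * \<gamma> ^ j) = \<eta> \<gamma> * \<eta> (\<gamma> ^ j)" using \<eta> \<gamma>(1) unfolding mult_chars_def by simp
    thus ?case using Suc by simp
  qed
  ultimately have "\<eta> (ext_norm m t) = (cis (2 * pi / Q) powi (- e)) powi (int i)" by (simp add: \<gamma>)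
  also have "\<dots> = (cis (2 * pi / Q) powi (int i)) powi (- e)"
    by (simp only: power_int_mult[symmetric] mult.commute)
  also have "cis (2 * pi / Q) powi (int i) = \<omega> t powi (int nQ)" using i' by simp
  also have "(\<omega> t powi (int nQ)) powi (- e) = \<omega> t powi (int nQ * (- e))"
    by (rule power_int_mult[symmetric])
  also have "int nQ * (- e) = - (e * int nQ)" by simp
  also have "\<omega> t powi (- (e * int nQ)) = chi (e * int nQ) t" using t by (simp only: chi_def if_True)
  finally show ?thesis .
qed

lemma gauss_sum_twisted:
  assumes "\<eta> \<in> mult_chars (UNIV :: 'a set)"
    and "\<gamma> \<noteq> 0" "\<omega> (to_ac \<gamma>) = cis (2 * pi / Q)" "\<eta> \<gamma> = cis (2 * pi / Q) powi (- e)"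
  shows "gauss_sum m (twisted_char m \<eta> (tup u) a) = gs (dot u a + e * int nQ)"
proof -
  have "twisted_char m \<eta> (tup u) a t = chi (dot u a + e * int nQ) t" if t: "t \<in> Kx" for t
  proof -
    have "(\<Prod>j\<in>UNIV. (tup u $ j) t powi (a $ j)) = chi (dot u a) t"
      unfolding dot_def chi_sum[OF t] by (simp add: tup_def chi_powi[OF t])
    thus ?thesis by (simp only: twisted_char_def eta_norm[OF assms t] chi_add[OF t] mult.commute)
  qed
  hence "(\<Sum>t\<in>Kx. twisted_char m \<eta> (tup u) a t * \<psi> t) = (\<Sum>t\<in>Kx. chi (dot u a + e * int nQ) t * \<psi> t)"
    by (intro sum.cong refl) (simp only:)
  thus ?thesis by (simp add: gs_def gauss_sum_def)
qed

text \<open>The values are roots of unity, whose reductions are nonzero; the factor coming from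
  \<open>t\<close> is therefore invisible to the valuation.\<close>

lemma val_tuple_eval:
  fixes t :: "'a ^ 'r::finite"
  assumes "\<forall>j. t $ j \<noteq> 0"
  shows "val (tuple_eval (tup u) t) 0"
proof (rule val_unit)
  have t: "to_ac (t $ j) \<in> Kx" for j using assms to_ac_Kx by blast
  show "tuple_eval (tup u) t \<in> R"
    unfolding tuple_eval_def tup_def by (intro R_prod) (simp add: chi_R)
  have "\<phi> (tuple_eval (tup u) t) = (\<Prod>j\<in>UNIV. to_ac (t $ j) powi (- u $ j))"
    unfolding tuple_eval_def tup_def by (simp add: phi_prod chi_R phi_chi[OF t])
  moreover have "to_ac (t $ j) \<noteq> 0" for j using t[of j] by blast
  ultimately show "\<phi> (tuple_eval (tup u) t) \<noteq> 0" by simp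
qed

lemma val_ev:
  fixes e :: "('a, 'r::finite) symb \<Rightarrow> int" and t :: "'a ^ 'r"
  assumes "Poly_Mapping.keys x \<subseteq> symbols" "\<forall>j. t $ j \<noteq> 0"
    and "\<gamma> \<noteq> 0" "\<omega> (to_ac \<gamma>) = cis (2 * pi / Q)"
    and e: "\<And>b. b \<in> Poly_Mapping.keys x \<Longrightarrow> fst b \<gamma> = cis (2 * pi / Q) powi (- e b)"
    and range: "\<And>b. b \<in> Poly_Mapping.keys x \<Longrightarrow> 0 \<le> dot u (snd b) + e b * int nQ"
      "\<And>b. b \<in> Poly_Mapping.keys x \<Longrightarrow> dot u (snd b) + e b * int nQ < int n"
  shows "val ((tuple_eval (tup u) t * ev m (tup u) x) powi N)
    (N * (\<Sum>b\<in>Poly_Mapping.keys x. Poly_Mapping.lookup x b * digsum CHAR('a) (nat (dot u (snd b) + e b * int nQ))))"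
proof -
  have "val (ev m (tup u) x)
    (\<Sum>b\<in>Poly_Mapping.keys x. Poly_Mapping.lookup x b * digsum CHAR('a) (nat (dot u (snd b) + e b * int nQ)))"
    unfolding ev_def
  proof (intro val_prod val_powi)
    fix b assume b: "b \<in> Poly_Mapping.keys x"
    hence "fst b \<in> mult_chars UNIV" using assms(1) by (auto simp: symbols_def)
    from gauss_sum_twisted[OF this assms(3,4) e[OF b], of u "snd b"]
    show "val (gauss_sum m (twisted_char m (fst b) (tup u) (snd b)))
      (digsum CHAR('a) (nat (dot u (snd b) + e b * int nQ)))"
      using val_gs[OF range[OF b]] by simp
  qed
  from val_powi[OF val_mult[OF val_tuple_eval[OF assms(2), of u] this], of N] show ?thesis by simp
qed

lemma tup_eq_iff: "tup u = tup v \<longleftrightarrow> (\<forall>j. [u $ j = v $ j] (mod int n))"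
proof -
  have "tup u = tup v \<longleftrightarrow> (\<forall>j. tup u $ j = tup v $ j)" by (rule Finite_Cartesian_Product.vec_eq_iff)
  also have "\<dots> \<longleftrightarrow> (\<forall>j. chi (u $ j) = chi (v $ j))" by (simp add: tup_def)
  also have "\<dots> \<longleftrightarrow> (\<forall>j. [u $ j = v $ j] (mod int n))" by (simp only: chi_eq_iff)
  finally show ?thesis .
qed

lemma tup_in: "tup u \<in> char_tuples m"
  by (simp add: tup_def char_tuples_def chi_in_mult_chars)

lemma char_tuples_bound:
  "finite (char_tuples m :: (('a alg_closure \<Rightarrow> complex) ^ 'r::finite) set)"
  "card (char_tuples m :: (('a alg_closure \<Rightarrow> complex) ^ 'r) set) \<le> n ^ CARD('r)"
proof -
  let ?f = "\<lambda>g :: 'r \<Rightarrow> ('a alg_closure \<Rightarrow> complex). (\<chi> j. g j)"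
  have sub: "char_tuples m \<subseteq> ?f ` (UNIV \<rightarrow>\<^sub>E mult_chars K)"
  proof
    fix w :: "('a alg_closure \<Rightarrow> complex) ^ 'r" assume "w \<in> char_tuples m"
    thus "w \<in> ?f ` (UNIV \<rightarrow>\<^sub>E mult_chars K)"
      by (intro image_eqI[of _ _ "\<lambda>j. w $ j"]) (auto simp: char_tuples_def)
  qed
  have fin: "finite (mult_chars K)" unfolding mult_chars_eq by simp
  have c: "card (mult_chars K) \<le> n" unfolding mult_chars_eq using card_image_le[of "{0..<int n}" chi] by simp
  have fin2: "finite ((UNIV :: 'r set) \<rightarrow>\<^sub>E mult_chars K)" using fin by (intro finite_PiE) auto
  show "finite (char_tuples m :: (('a alg_closure \<Rightarrow> complex) ^ 'r) set)"
    using sub fin2 by (meson finite_imageI finite_subset)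
  have "card (char_tuples m :: (('a alg_closure \<Rightarrow> complex) ^ 'r) set) \<le> card (?f ` (UNIV \<rightarrow>\<^sub>E mult_chars K))"
    using sub fin2 by (intro card_mono) auto
  also have "\<dots> \<le> card ((UNIV :: 'r set) \<rightarrow>\<^sub>E mult_chars K)" using fin2 by (rule card_image_le)
  also have "\<dots> = card (mult_chars K) ^ CARD('r)" by (simp add: card_PiE)
  also have "\<dots> \<le> n ^ CARD('r)" using c by (rule power_mono) simp
  finally show "card (char_tuples m :: (('a alg_closure \<Rightarrow> complex) ^ 'r) set) \<le> n ^ CARD('r)" .
qed

end

text \<open>Take R = Z[z] with z of order p n, which contains the p-th roots of unity for the
  additive character and the n-th ones for the Teichmueller character. Evaluation at the point
  \<open>y\<close> of \<open>root_of_unity_reduction\<close> is well defined on R. It is injective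
  on the n-th roots of unity, and its inverse there is \<open>\<omega>\<close>.\<close>

lemma teichmuller_exists:
  assumes m: "m \<ge> 2"
  shows "\<exists>R \<phi> \<omega>. teichmuller m R (\<phi> :: complex \<Rightarrow> 'a :: finite_field alg_closure) \<omega>"
proof -
  define p where "p = CHAR('a)"
  define n where "n = CARD('a) ^ m - 1"
  have p: "Factorial_Ring.prime p" unfolding p_def by (rule CHAR_prime)
  have p1: "p > 1" using p prime_gt_1_nat by blast
  have charK: "CHAR('a alg_closure) = p" by (simp add: p_def)
  have "CARD('a) ^ m > 1" using CARD_ge_2[where ?'a = 'a] m by (intro one_less_power) auto
  hence n: "n > 0" by (simp add: n_def)
  define z where "z = cis (2 * pi / (p * n))"
  have zk: "z ^ k = cis (2 * pi * (real k / (p * n)))" for k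
    by (simp add: z_def Complex.DeMoivre mult_ac)
  have z1: "z ^ (p * n) = 1" using p1 n unfolding zk by simp
  obtain y :: "'a alg_closure" where
    y: "\<And>f. poly (of_int_poly f) z = 0 \<Longrightarrow> poly (of_int_poly f) y = 0"
    using root_of_unity_reduction[of m z, where ?'a = 'a] z1 m unfolding p_def n_def by auto
  define R where "R = range (\<lambda>f :: int poly. poly (of_int_poly f) z)"
  define \<phi> :: "complex \<Rightarrow> 'a alg_closure" where
    "\<phi> x = poly (of_int_poly (SOME f. poly (of_int_poly f) z = x)) y" for x
  have \<phi>: "\<phi> (poly (of_int_poly f) z) = poly (of_int_poly f) y" for f
  proof -
    define g where "g = (SOME g. poly (of_int_poly g) z = poly (of_int_poly f) z)"
    have "poly (of_int_poly g) z = poly (of_int_poly f) z"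
      unfolding g_def by (rule someI[of _ f]) simp
    hence "poly (of_int_poly (g - f)) z = 0" by (simp add: of_int_poly_hom.hom_minus)
    hence "poly (of_int_poly (g - f)) y = 0" by (rule y)
    thus ?thesis by (simp add: \<phi>_def g_def of_int_poly_hom.hom_minus)
  qed
  have zR: "z ^ k \<in> R" and \<phi>z: "\<phi> (z ^ k) = y ^ k" for k
  proof -
    have *: "poly (of_int_poly (Polynomial.monom 1 k)) x = x ^ k" for x :: "'c :: comm_ring_1"
      by (simp add: poly_monom)
    show "z ^ k \<in> R" unfolding R_def by (rule image_eqI[of _ _ "Polynomial.monom 1 k"]) (simp_all only: * UNIV_I)
    show "\<phi> (z ^ k) = y ^ k" using \<phi>[of "Polynomial.monom 1 k"] by (simp only: *)
  qed
  have R1: "1 \<in> R" and \<phi>1: "\<phi> 1 = 1" using zR[of 0] \<phi>z[of 0] by simp_all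
  have Radd: "a + b \<in> R" "\<phi> (a + b) = \<phi> a + \<phi> b" and Rmult: "a * b \<in> R" "\<phi> (a * b) = \<phi> a * \<phi> b"
    and Rmin: "- a \<in> R" if ab: "a \<in> R" "b \<in> R" for a b
  proof -
    obtain f g where fg: "a = poly (of_int_poly f) z" "b = poly (of_int_poly g) z"
      using ab unfolding R_def by blast
    have 1: "a + b = poly (of_int_poly (f + g)) z" "a * b = poly (of_int_poly (f * g)) z"
      "- a = poly (of_int_poly (- f)) z"
      by (simp_all add: fg of_int_poly_hom.hom_add of_int_poly_hom.hom_mult of_int_poly_hom.hom_uminus)
    show "a + b \<in> R" "a * b \<in> R" "- a \<in> R" unfolding 1 R_def by blast+
    show "\<phi> (a + b) = \<phi> a + \<phi> b" "\<phi> (a * b) = \<phi> a * \<phi> b"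
      unfolding 1 \<phi> by (simp_all add: fg \<phi> of_int_poly_hom.hom_add of_int_poly_hom.hom_mult)
  qed
  have "cis (2 * pi / p) = z ^ n" using n p1 unfolding zk by (simp add: field_simps)
  moreover have "y ^ n = 1"
  proof -
    have "(y ^ n) ^ p = 1" using \<phi>z[of "p * n"] z1 \<phi>1 by (simp add: mult.commute flip: power_mult)
    \<comment> \<open>In characteristic p the only p-th root of unity is 1.\<close>
    have "(y ^ n - 1 + 1) ^ p = (y ^ n - 1) ^ p + 1 ^ p"
      by (rule freshmans_dream) (use p charK in simp_all)
    hence "(y ^ n - 1) ^ p = 0" using \<open>(y ^ n) ^ p = 1\<close> by simp
    thus ?thesis by simp
  qed
  ultimately have zeta: "cis (2 * pi / p) \<in> R" "\<phi> (cis (2 * pi / p)) = 1" using zR[of n] \<phi>z[of n] by simp_all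
  define Mu where "Mu = {x :: complex. x ^ n = 1}"
  have MuR: "x \<in> R" if "x \<in> Mu" for x
  proof -
    from that have "x ^ n = 1" by (simp add: Mu_def)
    then obtain j :: nat where "x = cis (2 * pi * real j / n)" using n by (elim root_of_unity_cis)
    hence "x = z ^ (p * j)" using n p1 unfolding zk by (simp add: field_simps)
    thus ?thesis using zR by simp
  qed
  have \<phi>_power: "x ^ k \<in> R \<and> \<phi> (x ^ k) = \<phi> x ^ k" if "x \<in> R" for x k
    using that by (induction k) (auto simp: R1 \<phi>1 Rmult)
  have R0: "0 \<in> R" using Radd(1)[OF R1 Rmin[OF R1 R1]] by simp
  have \<phi>0: "\<phi> 0 = 0" using Radd(2)[OF R0 R0] by (metis add.right_neutral add_left_cancel)
  have \<phi>_sum: "sum f A \<in> R \<and> \<phi> (sum f A) = (\<Sum>i\<in>A. \<phi> (f i))" if "\<And>i. i \<in> A \<Longrightarrow> f i \<in> R" for f and A :: "nat set"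
    using that by (induction A rule: infinite_finite_induct) (auto simp: R0 \<phi>0 Radd)
  \<comment> \<open>For x different from 1 the geometric sum is 0, but if x reduced to 1 the sum
    would reduce to n, which is -1 in characteristic p.\<close>
  have \<phi>_eq_1: "x = 1" if x: "x \<in> Mu" "\<phi> x = 1" for x
  proof (rule ccontr)
    assume "x \<noteq> 1"
    hence "(\<Sum>i<n. x ^ i) = 0" using x by (simp add: geometric_sum Mu_def)
    hence "0 = \<phi> (\<Sum>i<n. x ^ i)" by (simp add: \<phi>0)
    also have "\<dots> = (\<Sum>i<n. \<phi> (x ^ i))" using \<phi>_sum[of "{..<n}" "\<lambda>i. x ^ i"] \<phi>_power[OF MuR[OF x(1)]] by blast
    also have "\<dots> = (\<Sum>i<n. 1)"
      by (intro sum.cong refl) (use \<phi>_power[OF MuR[OF x(1)]] x(2) in simp)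
    also have "\<dots> = of_nat n" by simp
    also have "\<dots> = -1" unfolding n_def using m by (intro of_nat_card_minus_1) simp
    finally show False by simp
  qed
  have inj: "inj_on \<phi> Mu"
  proof (rule inj_onI)
    fix x x' assume x: "x \<in> Mu" "x' \<in> Mu" "\<phi> x = \<phi> x'"
    have s: "x' * x' ^ (n - 1) = 1" using x(2) n by (simp add: Mu_def flip: power_Suc)
    have "x * x' ^ (n - 1) \<in> Mu"
      using x by (simp add: Mu_def power_mult_distrib mult.commute[of "n - 1"] power_mult flip: power_mult)
         (simp add: mult.commute[of _ n] power_mult)
    moreover have "\<phi> (x * x' ^ (n - 1)) = 1"
    proof -
      have "\<phi> (x * x' ^ (n - 1)) = \<phi> (x' * x' ^ (n - 1))"
        using MuR[OF x(1)] MuR[OF x(2)] \<phi>_power[OF MuR[OF x(2)]] x(3) by (simp add: Rmult)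
      thus ?thesis unfolding s \<phi>1 .
    qed
    ultimately have "x * x' ^ (n - 1) = 1" by (rule \<phi>_eq_1)
    hence "x * x' ^ (n - 1) = x' * x' ^ (n - 1)" using s by simp
    moreover have "x' ^ (n - 1) \<noteq> 0" using s by (metis mult_zero_right zero_neq_one)
    ultimately show "x = x'" by (simp only: mult_cancel_right simp_thms)
  qed
  have img: "\<phi> ` Mu = ext_field m - {0}"
  proof (rule card_subset_eq)
    show "finite (ext_field m - {0 :: 'a alg_closure})" using m by simp
    show "\<phi> ` Mu \<subseteq> ext_field m - {0}"
    proof
      fix t assume "t \<in> \<phi> ` Mu"
      then obtain x where x: "x \<in> Mu" "t = \<phi> x" by blast
      hence "t ^ n = \<phi> (x ^ n)" using \<phi>_power[OF MuR[OF x(1)]] by simp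
      also have "\<dots> = 1" using x(1) \<phi>1 by (simp add: Mu_def)
      finally show "t \<in> ext_field m - {0}"
        using m ext_field_diff_0_iff[of m t] unfolding n_def by auto
    qed
    have "card (\<phi> ` Mu) = card Mu" by (rule card_image[OF inj])
    also have "\<dots> = n" unfolding Mu_def using n by (rule card_roots_unity_eq)
    also have "\<dots> = card (ext_field m - {0 :: 'a alg_closure})"
      unfolding n_def using m by (intro card_ext_field_diff_0[symmetric]) simp
    finally show "card (\<phi> ` Mu) = card (ext_field m - {0 :: 'a alg_closure})" .
  qed
  define \<omega> where "\<omega> = inv_into Mu \<phi>"
  have \<omega>: "\<omega> t \<in> Mu" "\<phi> (\<omega> t) = t" if "t \<in> ext_field m - {0}" for t
    using that unfolding \<omega>_def img[symmetric] by (auto intro: inv_into_into f_inv_into_f)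
  have "teichmuller m R \<phi> \<omega>"
  proof
    fix s t :: "'a alg_closure" assume st: "s \<in> ext_field m - {0}" "t \<in> ext_field m - {0}"
    have "\<phi> (\<omega> s * \<omega> t) = s * t" using Rmult(2)[OF MuR[OF \<omega>(1)[OF st(1)]] MuR[OF \<omega>(1)[OF st(2)]]] st \<omega>(2) by simp
    moreover have "\<omega> s * \<omega> t \<in> Mu" using \<omega>(1)[OF st(1)] \<omega>(1)[OF st(2)] by (simp add: Mu_def power_mult_distrib)
    ultimately show "\<omega> (s * t) = \<omega> s * \<omega> t" unfolding \<omega>_def using inj by (metis inv_into_f_f)
  next
    fix t :: "'a alg_closure" assume t: "t \<in> ext_field m - {0}"
    show "\<omega> t ^ (CARD('a) ^ m - 1) = 1" using \<omega>(1)[OF t] by (simp add: Mu_def n_def)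
    show "\<omega> t \<in> R" by (rule MuR[OF \<omega>(1)[OF t]])
    show "\<phi> (\<omega> t) = t" by (rule \<omega>(2)[OF t])
  qed (use m R1 \<phi>1 Radd Rmult Rmin zeta in \<open>auto simp: p_def\<close>)
  thus ?thesis by blast
qed

subsection \<open>Jumps of digit sums\<close>

lemma multiplicity_cong_power:
  fixes p x y :: int
  assumes "p ^ B dvd x - y" "multiplicity p y < B" "y \<noteq> 0" "\<not> is_unit p"
  shows "multiplicity p x = multiplicity p y"
proof (rule multiplicity_eqI)
  let ?v = "multiplicity p y"
  have d1: "p ^ ?v dvd x - y" using assms(1,2) by (meson dvd_trans le_imp_power_dvd less_imp_le)
  have d2: "p ^ Suc ?v dvd x - y" using assms(1,2) by (meson dvd_trans le_imp_power_dvd Suc_leI)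
  have "p ^ ?v dvd x - y + y" by (intro dvd_add d1 multiplicity_dvd)
  thus "p ^ ?v dvd x" by simp
  show "\<not> p ^ Suc ?v dvd x"
  proof
    assume "p ^ Suc ?v dvd x"
    hence "p ^ Suc ?v dvd x - (x - y)" using d2 by (rule dvd_diff)
    hence "p ^ Suc ?v dvd y" by simp
    thus False using power_dvd_iff_le_multiplicity[OF assms(3,4)] by (metis Suc_n_not_le_n)
  qed
qed

lemma multiplicity_less_power:
  fixes p y :: int
  assumes "y \<noteq> 0" "\<bar>y\<bar> < p ^ l" "p > 1"
  shows "multiplicity p y < l"
proof (rule ccontr)
  assume "\<not> multiplicity p y < l"
  hence "p ^ l dvd y" by (intro multiplicity_dvd') simp
  hence "\<bar>p ^ l\<bar> \<le> \<bar>y\<bar>" using assms(1) by (intro dvd_imp_le_int)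
  thus False using assms by simp
qed

lemma multiplicity_int: "multiplicity (int p) (int k) = multiplicity p k"
  unfolding multiplicity_def by (simp flip: of_nat_power)

lemma digsum_int_Suc:
  "k \<ge> 0 \<Longrightarrow> digsum p (nat (k + 1)) = digsum p (nat k) + 1 - (int p - 1) * int (multiplicity (int p) (k + 1))"
proof -
  assume k: "k \<ge> 0"
  have "multiplicity (int p) (int (Suc (nat k))) = multiplicity p (Suc (nat k))"
    by (rule multiplicity_int)
  thus ?thesis using k digsum_Suc[of p "nat k"] by (simp add: nat_add_distrib add.commute)
qed

lemma digsum_add_nat:
  "k \<ge> 0 \<Longrightarrow> digsum p (nat (k + int b)) =
     digsum p (nat k) + int b - (int p - 1) * (\<Sum>j=1..int b. int (multiplicity (int p) (k + j)))"
proof (induction b)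
  case (Suc b)
  have "{1..int (Suc b)} = insert (int b + 1) {1..int b}" by auto
  hence s: "(\<Sum>j=1..int (Suc b). int (multiplicity (int p) (k + j))) =
     int (multiplicity (int p) (k + int b + 1)) + (\<Sum>j=1..int b. int (multiplicity (int p) (k + j)))"
    by (simp add: add.assoc)
  have e: "k + int (Suc b) = k + int b + 1" by simp
  have "digsum p (nat (k + int (Suc b))) = digsum p (nat (k + int b)) + 1 -
    (int p - 1) * int (multiplicity (int p) (k + int b + 1))"
    unfolding e using Suc.prems by (intro digsum_int_Suc) simp
  thus ?case using Suc unfolding s by (simp add: algebra_simps)
qed simp

text \<open>At most one of the two sums is nonempty, depending on the sign of \<open>b\<close>;
  keeping both gives a formula uniform in the sign of \<open>dot w a\<close>.\<close>

lemma digsum_diff: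
  assumes "k \<ge> 0" "k + b \<ge> 0"
  shows "digsum p (nat (k + b)) - digsum p (nat k) = b - (int p - 1) *
    ((\<Sum>j=1..b. int (multiplicity (int p) (k + j))) - (\<Sum>j=b+1..0. int (multiplicity (int p) (k + j))))"
proof (cases "b \<ge> 0")
  case True
  thus ?thesis using digsum_add_nat[of k p "nat b"] assms by simp
next
  case False
  have "(\<Sum>j=1..-b. int (multiplicity (int p) (k + b + j))) = (\<Sum>j=b+1..0. int (multiplicity (int p) (k + j)))"
    by (rule sum.reindex_bij_witness[of _ "\<lambda>j. j - b" "\<lambda>j. j + b"]) (auto simp: algebra_simps)
  thus ?thesis using digsum_add_nat[of "k + b" p "nat (- b)"] assms False by (simp add: algebra_simps)
qed

text \<open>
  Think of \<open>k\<close> as a function of \<open>u\<close>, where \<open>u\<close> is close to \<open>A / M\<close> of order \<open>l\<close>, and of order \<open>Suc l\<close> for \<open>k'\<close>.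
\<close>

lemma digsum_jump:
  fixes M Q k k' \<alpha> e b :: int
  assumes p: "Factorial_Ring.prime p" and cop: "\<not> int p dvd M * Q"
    and b: "b \<noteq> 0" "\<bar>b\<bar> < int p ^ l"
    and Z: "\<And>j. \<bar>j\<bar> \<le> \<bar>b\<bar> \<Longrightarrow> \<bar>Q * \<alpha> - M * e + M * Q * j\<bar> < int p ^ l"
    and k: "[M * Q * k = Q * \<alpha> + Q * int p ^ l * b - M * e] (mod int p ^ (2 * l + 2))"
    and k': "[M * Q * k' = Q * \<alpha> + Q * int p ^ Suc l * b - M * e] (mod int p ^ (2 * l + 2))"
    and pos: "k \<ge> 0" "k + b \<ge> 0" "k' \<ge> 0" "k' + b \<ge> 0"
  shows "(digsum p (nat (k + b)) - digsum p (nat k)) - (digsum p (nat (k' + b)) - digsum p (nat k')) =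
    (int p - 1) * (int (card {j \<in> {1..b}. Q * \<alpha> - M * e + M * Q * j = 0})
                   - int (card {j \<in> {b+1..0}. Q * \<alpha> - M * e + M * Q * j = 0}))"
proof -
  let ?p = "int p" and ?Z = "\<lambda>j. Q * \<alpha> - M * e + M * Q * j"
  let ?v = "\<lambda>k. int (multiplicity (int p) k)"
  have p1: "?p > 1" using p prime_gt_1_nat by force
  have pp: "Factorial_Ring.prime ?p" using p by simp
  have nu: "\<not> is_unit ?p" using p1 by simp
  have MQ: "M * Q \<noteq> 0" using cop by auto
  have Q: "\<not> ?p dvd Q" using cop by auto
  have vMQ: "multiplicity ?p (M * Q * x) = multiplicity ?p x" for x
    using pp cop by (simp add: multiplicity_prime_elem_times_other)
  \<comment> \<open>Modulo p^(2 l + 2), M Q (k + j) is Z j + Q p^l' b. A nonzero Z j has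
    multiplicity below l and decides; if Z j = 0, the multiplicity is l' plus that of b, at most 2 l
    and so still visible at this precision.\<close>
  have key: "multiplicity ?p (k + j) = (if ?Z j = 0 then l' + multiplicity ?p b else multiplicity ?p (?Z j))"
    if j: "\<bar>j\<bar> \<le> \<bar>b\<bar>" and l': "l \<le> l'" "l' \<le> Suc l"
    and kk: "[M * Q * k = Q * \<alpha> + Q * ?p ^ l' * b - M * e] (mod ?p ^ (2 * l + 2))" for j l' k
  proof -
    have "[M * Q * k + M * Q * j = Q * \<alpha> + Q * ?p ^ l' * b - M * e + M * Q * j] (mod ?p ^ (2 * l + 2))"
      by (intro cong_add kk cong_refl)
    hence d: "?p ^ (2 * l + 2) dvd M * Q * (k + j) - (?Z j + Q * ?p ^ l' * b)"
      by (simp add: cong_iff_dvd_diff algebra_simps)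
    show ?thesis
    proof (cases "?Z j = 0")
      case True
      have mb: "multiplicity ?p b < l" by (rule multiplicity_less_power[OF b p1])
      have "multiplicity ?p (Q * (?p ^ l' * b)) = multiplicity ?p (?p ^ l' * b)"
        using pp Q by (simp add: multiplicity_prime_elem_times_other)
      also have "\<dots> = l' + multiplicity ?p b"
        using pp b p1 by (subst prime_elem_multiplicity_mult_distrib) auto
      finally have m: "multiplicity ?p (Q * ?p ^ l' * b) = l' + multiplicity ?p b" by (simp add: mult.assoc)
      have "Q \<noteq> 0" using Q by auto
      have "multiplicity ?p (M * Q * (k + j)) = multiplicity ?p (Q * ?p ^ l' * b)"
      proof (rule multiplicity_cong_power)
        show "?p ^ (2 * l + 2) dvd M * Q * (k + j) - Q * ?p ^ l' * b" using d unfolding True by simp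
      qed (use m mb l' b p1 nu \<open>Q \<noteq> 0\<close> in auto)
      thus ?thesis unfolding m vMQ if_P[OF True] .
    next
      case False
      have "?p ^ l dvd ?p ^ (2 * l + 2)" by (intro le_imp_power_dvd) simp
      hence "?p ^ l dvd M * Q * (k + j) - (?Z j + Q * ?p ^ l' * b)" using d dvd_trans by blast
      moreover have "?p ^ l dvd Q * ?p ^ l' * b" using l' by (intro dvd_mult2 dvd_mult le_imp_power_dvd)
      ultimately have "?p ^ l dvd M * Q * (k + j) - (?Z j + Q * ?p ^ l' * b) + Q * ?p ^ l' * b" by (rule dvd_add)
      hence d': "?p ^ l dvd M * Q * (k + j) - ?Z j" by (simp add: algebra_simps)
      have "multiplicity ?p (M * Q * (k + j)) = multiplicity ?p (?Z j)"
        by (rule multiplicity_cong_power[OF d' multiplicity_less_power[OF False Z[OF j] p1] False nu])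
      thus ?thesis unfolding vMQ if_not_P[OF False] .
    qed
  qed
  \<comment> \<open>Only the integers on a hyperplane notice the passage from order l to l + 1, and
    each of them gains exactly one.\<close>
  have diff: "?v (k' + j) - ?v (k + j) = (if ?Z j = 0 then 1 else 0)" if "\<bar>j\<bar> \<le> \<bar>b\<bar>" for j
    using key[OF that _ _ k] key[OF that _ _ k'] by simp
  have sums: "(\<Sum>j\<in>J. ?v (k' + j)) - (\<Sum>j\<in>J. ?v (k + j)) = int (card {j \<in> J. ?Z j = 0})"
    if "finite J" "\<And>j. j \<in> J \<Longrightarrow> \<bar>j\<bar> \<le> \<bar>b\<bar>" for J
  proof -
    have "(\<Sum>j\<in>J. ?v (k' + j)) - (\<Sum>j\<in>J. ?v (k + j)) = (\<Sum>j\<in>J. if ?Z j = 0 then 1 else 0)"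
      unfolding sum_subtractf[symmetric] using that by (intro sum.cong refl diff) auto
    also have "\<dots> = int (card {j \<in> J. ?Z j = 0})"
      using that(1) by (simp add: sum.If_cases Int_def)
    finally show ?thesis .
  qed
  have 1: "(\<Sum>j=1..b. ?v (k' + j)) - (\<Sum>j=1..b. ?v (k + j)) = int (card {j \<in> {1..b}. ?Z j = 0})"
    by (rule sums) auto
  have 2: "(\<Sum>j=b+1..0. ?v (k' + j)) - (\<Sum>j=b+1..0. ?v (k + j)) = int (card {j \<in> {b+1..0}. ?Z j = 0})"
    by (rule sums) auto
  show ?thesis unfolding digsum_diff[OF pos(1,2)] digsum_diff[OF pos(3,4)] 1[symmetric] 2[symmetric]
    by (simp add: algebra_simps)
qed

text \<open>At most one j is a solution, j = - c with c the exact quotient. As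
  \<open>Q * \<alpha> = M * (Q * c + e)\<close>, the bounds on j become bounds on
  \<open>\<alpha>\<close>. The half-open range of \<open>e\<close> depends on the sign of
  \<open>b\<close> precisely so that the endpoints come out alike: 0 excluded, the far end
  included.\<close>

lemma window_card:
  fixes M Q \<alpha> e b :: int
  assumes "M > 0" "Q > 0" "b > 0 \<Longrightarrow> 0 \<le> e \<and> e < Q" "b < 0 \<Longrightarrow> 0 < e \<and> e \<le> Q"
  shows "int (card {j \<in> {1..b}. Q * \<alpha> - M * e + M * Q * j = 0})
           - int (card {j \<in> {b+1..0}. Q * \<alpha> - M * e + M * Q * j = 0}) =
    (if M * Q dvd Q * \<alpha> - M * e \<and> sgn b * \<alpha> < 0 \<and> - (M * \<bar>b\<bar>) \<le> sgn b * \<alpha> then sgn b else 0)"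
proof (cases "M * Q dvd Q * \<alpha> - M * e")
  case False
  have "Q * \<alpha> - M * e + M * Q * j \<noteq> 0" for j
  proof
    assume "Q * \<alpha> - M * e + M * Q * j = 0"
    hence "Q * \<alpha> - M * e = M * Q * (- j)" by simp
    thus False using False by (metis dvd_triv_left)
  qed
  thus ?thesis using False by simp
next
  case True
  then obtain c where c: "Q * \<alpha> - M * e = M * Q * c" by blast
  have MQ: "M * Q > 0" using assms by simp
  have iff: "Q * \<alpha> - M * e + M * Q * j = 0 \<longleftrightarrow> j = - c" for j
  proof -
    have "Q * \<alpha> - M * e + M * Q * j = M * Q * (c + j)" unfolding c by (simp add: algebra_simps)
    thus ?thesis using assms MQ by auto
  qed
  have set: "{j \<in> J. Q * \<alpha> - M * e + M * Q * j = 0} = (if - c \<in> J then {- c} else {})" for J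
    unfolding iff by auto
  have Qa: "Q * \<alpha> = M * (Q * c + e)" using c by (simp add: algebra_simps)
  have mono: "Q * x < Q * y \<longleftrightarrow> x < y" "M * x < M * y \<longleftrightarrow> x < y" "Q * x \<le> Q * y \<longleftrightarrow> x \<le> y" "M * x \<le> M * y \<longleftrightarrow> x \<le> y" for x y
    using assms(1,2) by auto
  have neg: "\<alpha> < 0 \<longleftrightarrow> Q * c + e < 0" using mono(1)[of \<alpha> 0] mono(2)[of "Q * c + e" 0] Qa by simp
  have pos: "\<alpha> > 0 \<longleftrightarrow> Q * c + e > 0" using mono(1)[of 0 \<alpha>] mono(2)[of 0 "Q * c + e"] Qa by simp
  have lb: "- (M * x) \<le> \<alpha> \<longleftrightarrow> - (Q * x) \<le> Q * c + e" for x
    using mono(3)[of "- (M * x)" \<alpha>] mono(4)[of "- (Q * x)" "Q * c + e"] unfolding Qa by (simp add: algebra_simps)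
  have ub: "\<alpha> \<le> M * x \<longleftrightarrow> Q * c + e \<le> Q * x" for x
    using mono(3)[of \<alpha> "M * x"] mono(4)[of "Q * c + e" "Q * x"] unfolding Qa by (simp add: algebra_simps)
  have lt: "Q * x + e < 0 \<longleftrightarrow> x < 0" if "0 \<le> e" "e < Q" for x
  proof
    assume "Q * x + e < 0" hence "Q * x < Q * 0" using that by simp
    thus "x < 0" unfolding mono .
  next
    assume "x < 0" hence "Q * x \<le> Q * (-1)" unfolding mono by simp
    thus "Q * x + e < 0" using that by simp
  qed
  have gt: "Q * x + e > 0 \<longleftrightarrow> x \<ge> 0" if "0 < e" "e \<le> Q" for x
  proof
    assume "x \<ge> 0" hence "Q * 0 \<le> Q * x" unfolding mono .
    thus "Q * x + e > 0" using that by simp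
  next
    assume *: "Q * x + e > 0"
    show "x \<ge> 0"
    proof (rule ccontr)
      assume "\<not> x \<ge> 0" hence "Q * x \<le> Q * (-1)" unfolding mono by simp
      thus False using that * by simp
    qed
  qed
  consider "b > 0" | "b < 0" | "b = 0" by linarith
  thus ?thesis
  proof cases
    case 1
    have e: "0 \<le> e" "e < Q" using assms(3) 1 by auto
    have "- (Q * b) \<le> Q * c + e \<longleftrightarrow> \<not> Q * (c + b) + e < 0" unfolding distrib_left by linarith
    also have "\<dots> \<longleftrightarrow> - b \<le> c" unfolding lt[OF e] by auto
    finally have "- (M * b) \<le> \<alpha> \<longleftrightarrow> - b \<le> c" unfolding lb .
    moreover have "\<alpha> < 0 \<longleftrightarrow> c < 0" unfolding neg lt[OF e] ..
    ultimately show ?thesis using 1 True unfolding set by auto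
  next
    case 2
    have e: "0 < e" "e \<le> Q" using assms(4) 2 by auto
    have "Q * c + e \<le> Q * (- b) \<longleftrightarrow> \<not> Q * (c + b) + e > 0" unfolding distrib_left mult_minus_right by linarith
    also have "\<dots> \<longleftrightarrow> c < - b" unfolding gt[OF e] by auto
    finally have "\<alpha> \<le> M * (- b) \<longleftrightarrow> c < - b" unfolding ub .
    moreover have "\<alpha> > 0 \<longleftrightarrow> c \<ge> 0" unfolding pos gt[OF e] ..
    ultimately show ?thesis using 2 True unfolding set by auto
  qed simp
qed

text \<open>Union bound: by injectivity each \<open>f s\<close> sends at most
  \<open>card T - card U\<close> points of the box outside \<open>U\<close>.\<close>

lemma exists_common_good:
  assumes "finite Box" "finite S" "finite T" "U \<subseteq> T"
    and "\<And>s. s \<in> S \<Longrightarrow> inj_on (f s) Box" "\<And>s v. s \<in> S \<Longrightarrow> v \<in> Box \<Longrightarrow> f s v \<in> T"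
    and "card S * (card T - card U) < card Box"
  shows "\<exists>v\<in>Box. \<forall>s\<in>S. f s v \<in> U"
proof (rule ccontr)
  assume "\<not> ?thesis"
  hence "Box \<subseteq> (\<Union>s\<in>S. {v \<in> Box. f s v \<in> T - U})" using assms(6) by blast
  hence "card Box \<le> card (\<Union>s\<in>S. {v \<in> Box. f s v \<in> T - U})"
    using assms(1,2) by (intro card_mono) auto
  also have "\<dots> \<le> (\<Sum>s\<in>S. card {v \<in> Box. f s v \<in> T - U})" by (rule card_UN_le[OF assms(2)])
  also have "\<dots> \<le> (\<Sum>s\<in>S. card (T - U))"
  proof (rule sum_mono)
    fix s assume s: "s \<in> S"
    show "card {v \<in> Box. f s v \<in> T - U} \<le> card (T - U)"
      by (rule card_inj_on_le[of "f s"]) (use s assms in \<open>auto intro: inj_on_subset\<close>)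
  qed
  also have "\<dots> = card S * (card T - card U)"
    using assms(3,4) by (simp add: card_Diff_subset finite_subset)
  finally show False using assms(7) by simp
qed

lemma box_card:
  "finite {v :: int ^ 'r::finite. \<forall>j. 0 \<le> v $ j \<and> v $ j < int L}"
  "card {v :: int ^ 'r. \<forall>j. 0 \<le> v $ j \<and> v $ j < int L} = L ^ CARD('r)"
proof -
  let ?f = "\<lambda>g :: 'r \<Rightarrow> int. (\<chi> j. g j)"
  have eq: "{v :: int ^ 'r. \<forall>j. 0 \<le> v $ j \<and> v $ j < int L} = ?f ` (UNIV \<rightarrow>\<^sub>E {0..<int L})"
  proof safe
    fix v :: "int ^ 'r" assume "\<forall>j. 0 \<le> v $ j \<and> v $ j < int L"
    thus "v \<in> ?f ` (UNIV \<rightarrow>\<^sub>E {0..<int L})"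
      by (intro image_eqI[of _ _ "\<lambda>j. v $ j"]) auto
  qed auto
  have inj: "inj_on ?f (UNIV \<rightarrow>\<^sub>E {0..<int L})"
    by (rule inj_onI) (metis vec_lambda_inverse UNIV_I)
  show "finite {v :: int ^ 'r. \<forall>j. 0 \<le> v $ j \<and> v $ j < int L}"
    unfolding eq by (intro finite_imageI finite_PiE) auto
  show "card {v :: int ^ 'r. \<forall>j. 0 \<le> v $ j \<and> v $ j < int L} = L ^ CARD('r)"
    unfolding eq card_image[OF inj] by (simp add: card_PiE)
qed

lemma dot_add: "dot (u + v) a = dot u a + dot v a"
  by (simp add: dot_def algebra_simps sum.distrib)

lemma dot_scale: "dot (c *s u) a = c * dot u a"
  by (simp add: dot_def sum_distrib_left mult.assoc)

lemma dot_scale_right: "dot u (c *s a) = c * dot u a"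
  by (simp add: dot_def sum_distrib_left mult_ac)

lemma dot_minus_right: "dot u (- a) = - dot u a"
  by (simp add: dot_def sum_negf)

lemma dot_bound:
  fixes v a :: "int ^ 'r::finite"
  assumes "\<forall>j. 0 \<le> v $ j \<and> v $ j < int L"
  shows "\<bar>dot v a\<bar> \<le> int L * (\<Sum>j\<in>UNIV. \<bar>a $ j\<bar>)"
proof -
  have "\<bar>dot v a\<bar> \<le> (\<Sum>j\<in>UNIV. \<bar>v $ j * a $ j\<bar>)" unfolding dot_def by (rule sum_abs)
  also have "\<dots> \<le> (\<Sum>j\<in>UNIV. int L * \<bar>a $ j\<bar>)"
  proof (rule sum_mono)
    fix j
    have "0 \<le> v $ j" "v $ j \<le> int L" using assms less_imp_le by blast+
    thus "\<bar>v $ j * a $ j\<bar> \<le> int L * \<bar>a $ j\<bar>" by (simp add: abs_mult mult_right_mono)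
  qed
  finally show ?thesis by (simp add: sum_distrib_left)
qed

text \<open>Moving by multiples of \<open>P\<close> preserves residues modulo \<open>P\<close>,
  hence the approximation to A / M. As \<open>P\<close> is invertible modulo n and the box has side
  at most n, distinct \<open>v\<close> give distinct tuples.\<close>

lemma (in teichmuller) good_point:
  fixes U :: "(('a alg_closure \<Rightarrow> complex) ^ 'r::finite) set" and S :: "(int ^ 'r) set"
  assumes "U \<subseteq> char_tuples m" "coprime P (int n)" "L \<le> n" "finite S"
    and "card S * (card (char_tuples m :: (('a alg_closure \<Rightarrow> complex) ^ 'r) set) - card U) < L ^ CARD('r)"
  shows "\<exists>v. (\<forall>j. 0 \<le> v $ j \<and> v $ j < int L) \<and> (\<forall>s\<in>S. tup (s + P *s v) \<in> U)"
proof -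
  let ?Box = "{v :: int ^ 'r. \<forall>j. 0 \<le> v $ j \<and> v $ j < int L}"
  have "\<exists>v\<in>?Box. \<forall>s\<in>S. tup (s + P *s v) \<in> U"
  proof (rule exists_common_good[OF box_card(1) assms(4) char_tuples_bound(1) assms(1)])
    fix s
    show "inj_on (\<lambda>v. tup (s + P *s v)) ?Box"
    proof (rule inj_onI)
      fix v v' assume v: "v \<in> ?Box" "v' \<in> ?Box" "tup (s + P *s v) = tup (s + P *s v')"
      show "v = v'"
      proof (subst Finite_Cartesian_Product.vec_eq_iff, rule allI)
        fix j
        have "[s $ j + P * v $ j = s $ j + P * v' $ j] (mod int n)"
          using v(3) unfolding tup_eq_iff by simp
        hence "[P * v $ j = P * v' $ j] (mod int n)" by (simp only: cong_add_lcancel)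
        hence "[v $ j = v' $ j] (mod int n)" using assms(2) by (simp add: cong_mult_lcancel)
        moreover have "0 \<le> v $ j" "v $ j < int n" "0 \<le> v' $ j" "v' $ j < int n"
          using v(1,2) assms(3) by (auto intro: less_le_trans)
        ultimately show "v $ j = v' $ j" by (simp add: cong_def)
      qed
    qed
    show "tup (s + P *s v) \<in> char_tuples m" for v by (rule tup_in)
  qed (use assms(5) in \<open>simp add: box_card(2)\<close>)
  thus ?thesis by blast
qed

text \<open>
  The exponents \<open>u\<close> stay in a box around a small multiple of \<open>(q\<^sup>m - 1) w\<close>, so that no reduction modulo
  \<open>q\<^sup>m - 1\<close> is needed: the sign of \<open>dot w a\<close> decides which range of \<open>e\<close> keeps the integers in \<open>{0..<q\<^sup>m - 1}\<close>.
  The density of \<open>U m\<close> gives such a \<open>u\<close> for which \<open>u\<close>, \<open>u + w\<close>, \<open>u + h\<close> and \<open>u + h + w\<close> are all good, where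
  adding \<open>h\<close> improves the approximation to \<open>A / M\<close> by one order.
\<close>

lemma jump_relation:
  fixes x :: "('a :: finite_field, 'r :: finite) symb \<Rightarrow>\<^sub>0 int"
    and t :: "'a ^ 'r" and N :: int and w A :: "int ^ 'r" and M :: int
    and U :: "nat \<Rightarrow> (('a alg_closure \<Rightarrow> complex) ^ 'r) set"
    and D :: "nat \<Rightarrow> complex" and \<gamma> :: 'a and e :: "('a, 'r) symb \<Rightarrow> int"
  defines "Q \<equiv> int (CARD('a) - 1)"
  assumes x: "Poly_Mapping.keys x \<subseteq> symbols" and t: "\<forall>j. t $ j \<noteq> 0" and N: "N \<noteq> 0"
    and U: "\<forall>m\<ge>1. U m \<subseteq> char_tuples m"
    and lim: "(\<lambda>m. real (card (U m)) /
           real (card (char_tuples m :: (('a alg_closure \<Rightarrow> complex) ^ 'r) set))) \<longlonglongrightarrow> 1"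
    and D: "\<forall>m\<ge>1. \<forall>\<omega>\<in>U m. (tuple_eval \<omega> t * ev m \<omega> x) powi N = D m"
    and inf: "\<exists>\<^sub>\<infinity>m. \<exists>R (\<phi> :: complex \<Rightarrow> 'a alg_closure) \<omega>. teichmuller m R \<phi> \<omega> \<and>
       \<omega> (to_ac \<gamma>) = cis (2 * pi / (CARD('a) - 1))"
    and \<gamma>: "\<gamma> \<noteq> 0"
    and e: "\<And>b. b \<in> Poly_Mapping.keys x \<Longrightarrow> fst b \<gamma> = cis (2 * pi / (CARD('a) - 1)) powi (- e b)"
    and epos: "\<And>b. b \<in> Poly_Mapping.keys x \<Longrightarrow> dot w (snd b) > 0 \<Longrightarrow> 0 \<le> e b \<and> e b < Q"
    and eneg: "\<And>b. b \<in> Poly_Mapping.keys x \<Longrightarrow> dot w (snd b) < 0 \<Longrightarrow> 0 < e b \<and> e b \<le> Q"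
    and w: "\<And>b. b \<in> Poly_Mapping.keys x \<Longrightarrow> dot w (snd b) \<noteq> 0"
    and M: "M > 0" "\<not> int CHAR('a) dvd M"
  shows "(\<Sum>b\<in>Poly_Mapping.keys x. Poly_Mapping.lookup x b *
      (int (card {j \<in> {1..dot w (snd b)}. Q * dot A (snd b) - M * e b + M * Q * j = 0}) -
       int (card {j \<in> {dot w (snd b) + 1..0}. Q * dot A (snd b) - M * e b + M * Q * j = 0}))) = 0"
proof -
  define F where "F = Poly_Mapping.keys x"
  have fF: "finite F" by (simp add: F_def)
  define p where "p = CHAR('a)"
  have p: "Factorial_Ring.prime p" unfolding p_def by (rule CHAR_prime)
  have p1: "p > 1" using p prime_gt_1_nat by blast
  have pp: "Factorial_Ring.prime (int p)" using p by simp
  obtain f where f: "f > 0" "CARD('a) = p ^ f" using CARD_eq_CHAR_power[where ?'a = 'a] unfolding p_def by blast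
  have Q: "Q > 0" using CARD_ge_2[where ?'a = 'a] by (simp add: Q_def)
  have QC: "Q + 1 = int CARD('a)" using CARD_ge_2[where ?'a = 'a] by (simp add: Q_def)
  have pQ: "\<not> int p dvd Q"
  proof
    assume "int p dvd Q"
    moreover have "int p dvd int CARD('a)" using f by (simp only: of_nat_dvd_iff) (simp add: dvd_power)
    ultimately have "int p dvd int CARD('a) - Q" by (intro dvd_diff)
    thus False using p1 unfolding QC[symmetric] by simp
  qed
  have pMQ: "\<not> int p dvd M * Q" using pQ M(2) pp by (simp add: prime_dvd_mult_iff p_def)
  define \<beta> where "\<beta> b = dot w (snd b)" for b :: "('a, 'r) symb"
  define W where "W = (\<Sum>b\<in>F. \<bar>\<beta> b\<bar>)"
  define Zb where "Zb = (\<Sum>b\<in>F. \<bar>Q * dot A (snd b) - M * e b\<bar> + M * Q * \<bar>\<beta> b\<bar>)"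
  have W: "\<bar>\<beta> b\<bar> \<le> W" if "b \<in> F" for b
    unfolding W_def by (rule member_le_sum[OF that _ fF]) simp
  have Zb: "\<bar>Q * dot A (snd b) - M * e b\<bar> + M * Q * \<bar>\<beta> b\<bar> \<le> Zb" if "b \<in> F" for b
    unfolding Zb_def using M Q by (intro member_le_sum[OF that _ fF]) simp
  have W0: "W \<ge> 0" unfolding W_def by (intro sum_nonneg) simp
  have Zb0: "Zb \<ge> 0" unfolding Zb_def using M Q by (intro sum_nonneg) simp
  \<comment> \<open>This makes p^l exceed every step \<open>\<beta> b\<close> and every value of a
    hyperplane form that matters, so that such values are divisible by p^l only when they are
    0.\<close>
  define l where "l = nat (W + Zb)"
  have l: "W + Zb < int p ^ l"
  proof -
    have "W + Zb = int l" using W0 Zb0 by (simp add: l_def)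
    also have "\<dots> < 2 ^ l" by (rule of_nat_less_two_power)
    also have "\<dots> \<le> int p ^ l" using p1 by (intro power_mono) auto
    finally show ?thesis .
  qed
  define P where "P = int p ^ (2 * l + 2)"
  have P: "P > 0" using p1 by (simp add: P_def)
  have "coprime M P"
    using M(2) pp unfolding P_def p_def by (metis coprime_commute coprime_power_right_iff prime_imp_coprime)
  then obtain Mi where Mi: "[M * Mi = 1] (mod P)" using cong_solve_coprime_int by blast
  \<comment> \<open>Modulo \<open>P\<close>, M u0 is A + p^l w and M (u0 + h) is A + p^(l + 1) w:
    the factor p - 1 in \<open>h\<close> raises the order of approximation by one.\<close>
  define u0 where "u0 = Mi *s (A + (int p ^ l) *s w)"
  define h where "h = (Mi * (int p ^ l * (int p - 1))) *s w"
  define S where "S = (\<Sum>b\<in>F. \<Sum>j\<in>UNIV. \<bar>snd b $ j\<bar>)"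
  have S: "(\<Sum>j\<in>UNIV. \<bar>snd b $ j\<bar>) \<le> S" if "b \<in> F" for b :: "('a, 'r) symb"
    unfolding S_def by (rule member_le_sum[OF that _ fF]) (simp add: sum_nonneg)
  have S0: "S \<ge> 0" unfolding S_def by (intro sum_nonneg) simp
  \<comment> \<open>The pairing of a box vector with any occurring vector is at most
    \<open>L * S\<close>, so a drift of \<open>E * L\<close> along \<open>w\<close> leaves at least
    \<open>L\<close> with the sign of \<open>\<beta> b\<close>.\<close>
  define E where "E = S + 1"
  define c0 where "c0 = (\<Sum>b\<in>F. \<bar>dot u0 (snd b)\<bar> + \<bar>\<beta> b\<bar> + \<bar>dot h (snd b)\<bar>)"
  have c0: "\<bar>dot u0 (snd b)\<bar> + \<bar>\<beta> b\<bar> + \<bar>dot h (snd b)\<bar> \<le> c0" if "b \<in> F" for b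
    unfolding c0_def by (rule member_le_sum[OF that _ fF]) simp
  have c00: "c0 \<ge> 0" unfolding c0_def by (intro sum_nonneg) simp
  \<comment> \<open>With L = nQ div C, the displacement
    \<open>P * (E * L * \<beta> b + dot v (snd b))\<close> is at most g / 2 in absolute
    value.\<close>
  define C where "C = nat (2 * (P * (E * W + S)) + 2)"
  have C: "int C = 2 * (P * (E * W + S)) + 2" unfolding C_def E_def using P W0 S0 by simp
  \<comment> \<open>The 4 bounds the number of translates in \<open>Sh\<close>; the rest comes from
    L \<ge> n / (2 C Q), so that the bad tuples cannot fill the box.\<close>
  define \<delta> where "\<delta> = 1 / (4 * (2 * real C * real_of_int Q) ^ CARD('r))"
  have "P * (E * W + S) \<ge> 0" using P W0 S0 by (simp add: E_def)
  hence C2: "C \<ge> 2" using C by linarith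
  have \<delta>: "\<delta> > 0" using C2 Q unfolding \<delta>_def by (intro divide_pos_pos mult_pos_pos zero_less_power) auto
  have "\<forall>\<^sub>F m in sequentially. real (card (U m)) /
           real (card (char_tuples m :: (('a alg_closure \<Rightarrow> complex) ^ 'r) set)) > 1 - \<delta>"
    using lim \<delta> by (intro order_tendstoD(1)) auto
  then obtain m1 where m1: "\<And>m. m \<ge> m1 \<Longrightarrow> real (card (U m)) /
           real (card (char_tuples m :: (('a alg_closure \<Rightarrow> complex) ^ 'r) set)) > 1 - \<delta>"
    unfolding eventually_sequentially by blast
  \<comment> \<open>A large \<open>m\<close> serves three ends: the density of \<open>U m\<close>,
    divisibility of q^m by \<open>P\<close>, and, through nQ \<ge> m, a box side beyond the fixed
    offsets collected in \<open>c0\<close>.\<close>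
  obtain m R and \<phi> :: "complex \<Rightarrow> 'a alg_closure" and \<omega> where
    m: "m \<ge> max m1 (2 * l + 2 + nat (int C * (c0 + 2)))" and T: "teichmuller m R \<phi> \<omega>"
    and \<omega>: "\<omega> (to_ac \<gamma>) = cis (2 * pi / (CARD('a) - 1))"
    using inf unfolding INFM_nat_le by blast
  interpret T: teichmuller m R \<phi> \<omega> by (rule T)
  have TQ: "T.Q = CARD('a) - 1" by (rule T.Q_def)
  have TQ': "int T.Q = Q" by (simp add: TQ Q_def)
  define g where "g = int T.nQ"
  have ng: "int T.n = Q * g" unfolding g_def TQ'[symmetric] by (metis T.n_eq of_nat_mult)
  have "m = (\<Sum>i<m. 1)" by simp
  also have "\<dots> \<le> T.nQ" unfolding T.nQ_def using CARD_ge_2[where ?'a = 'a] by (intro sum_mono) simp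
  finally have gm: "g \<ge> int m" by (simp add: g_def)
  have gC: "g \<ge> int C * (c0 + 2)"
  proof -
    have "nat (int C * (c0 + 2)) \<le> m" using m by simp
    hence "int C * (c0 + 2) \<le> int m" by linarith
    thus ?thesis using gm by simp
  qed
  define L where "L = T.nQ div C"
  have CL: "int C * int L \<le> g" unfolding g_def L_def by (metis of_nat_mult of_nat_le_iff times_div_less_eq_dividend)
  have Lc0: "c0 + 2 \<le> int L"
  proof -
    have "int (nat (c0 + 2) * C) = int C * (c0 + 2)" using c00 by simp
    also have "\<dots> \<le> int T.nQ" using gC by (simp add: g_def)
    finally have "nat (c0 + 2) * C \<le> T.nQ" by (simp only: of_nat_le_iff)
    hence "nat (c0 + 2) \<le> L"
      unfolding L_def using C2 by (subst less_eq_div_iff_mult_less_eq) auto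
    thus ?thesis by simp
  qed
  have gc0: "2 * c0 < g"
  proof -
    have "2 * (c0 + 2) \<le> int C * (c0 + 2)" using C2 c00 by (intro mult_right_mono) auto
    thus ?thesis using gC by simp
  qed
  have Pn: "P dvd int T.n + 1"
  proof -
    have "int T.n + 1 = int (CARD('a) ^ m)" using T.Suc_n by (metis of_nat_Suc add.commute)
    also have "\<dots> = int p ^ (f * m)" unfolding f(2) by (simp add: power_mult)
    finally have eq: "int T.n + 1 = int p ^ (f * m)" .
    have "2 * l + 2 \<le> 1 * m" using m by simp
    also have "\<dots> \<le> f * m" using f(1) by (intro mult_right_mono) auto
    finally show ?thesis unfolding eq P_def by (rule le_imp_power_dvd)
  qed
  have cop: "coprime P (int T.n)"
  proof (rule coprimeI)
    fix c assume c: "c dvd P" "c dvd int T.n"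
    hence "c dvd int T.n + 1" using Pn dvd_trans by blast
    hence "c dvd int T.n + 1 - int T.n" using c by (intro dvd_diff)
    thus "is_unit c" by simp
  qed
  define s0 where "s0 = u0 + (P * E * int L) *s w"
  define Sh where "Sh = {s0, s0 + w, s0 + h, s0 + h + w}"
  have fSh: "finite Sh" "card Sh \<le> 4" unfolding Sh_def by (auto simp: card_insert_if)
  have Um: "U m \<subseteq> char_tuples m" using U m by simp
  have "\<exists>v. (\<forall>j. 0 \<le> v $ j \<and> v $ j < int L) \<and> (\<forall>s\<in>Sh. T.tup (s + P *s v) \<in> U m)"
  proof (rule T.good_point[OF Um cop _ fSh(1)])
    have "L \<le> T.nQ" unfolding L_def by simp
    also have "\<dots> \<le> T.n" using T.Q_pos by (subst T.n_eq) simp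
    finally show "L \<le> T.n" .
    let ?T = "char_tuples m :: (('a alg_closure \<Rightarrow> complex) ^ 'r) set"
    have le: "card (U m) \<le> card ?T" by (intro card_mono T.char_tuples_bound Um)
    have d: "real (card ?T - card (U m)) < \<delta> * real (T.n ^ CARD('r))"
    proof (cases "card ?T = 0")
      case True
      have "T.n > 0" using T.n_ge_3 by simp
      thus ?thesis using True \<delta> by simp
    next
      case False
      have "m \<ge> m1" using m by simp
      hence "1 - \<delta> < real (card (U m)) / real (card ?T)" by (rule m1)
      hence "(1 - \<delta>) * real (card ?T) < real (card (U m))"
        using False by (subst (asm) pos_less_divide_eq) simp_all
      moreover have "(1 - \<delta>) * real (card ?T) = real (card ?T) - \<delta> * real (card ?T)"
        by (simp only: left_diff_distrib mult_1)
      moreover have "real (card ?T - card (U m)) = real (card ?T) - real (card (U m))"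
        by (rule of_nat_diff[OF le])
      ultimately have "real (card ?T - card (U m)) < \<delta> * real (card ?T)" by linarith
      also have "\<dots> \<le> \<delta> * real (T.n ^ CARD('r))"
        using \<delta> T.char_tuples_bound(2)[where ?'r = 'r] by (intro mult_left_mono of_nat_mono) auto
      finally show ?thesis .
    qed
    have "real (card Sh * (card ?T - card (U m))) \<le> 4 * real (card ?T - card (U m))"
      using fSh(2) by (simp add: mult_right_mono)
    also have "\<dots> < 4 * (\<delta> * real (T.n ^ CARD('r)))" using d by simp
    also have "\<dots> = (real T.n / (2 * real C * real_of_int Q)) ^ CARD('r)"
      by (simp add: \<delta>_def power_divide)
    also have "\<dots> \<le> real L ^ CARD('r)"
    proof (rule power_mono)
      have "T.nQ = C * L + T.nQ mod C" by (simp add: L_def)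
      moreover have "T.nQ mod C < C" using C2 by simp
      ultimately have "T.nQ < C * L + C" by linarith
      moreover have "1 \<le> L" using Lc0 c00 by simp
      hence "C * 1 \<le> C * L" by (rule mult_le_mono2)
      ultimately have "T.nQ \<le> 2 * C * L" by linarith
      hence "real T.nQ \<le> real (2 * C * L)" by (simp only: of_nat_le_iff)
      hence "real T.nQ \<le> 2 * real C * real L" by simp
      moreover have "real T.n = real_of_int Q * real T.nQ"
        using ng unfolding g_def by (metis of_int_mult of_int_of_nat_eq)
      ultimately show "real T.n / (2 * real C * real_of_int Q) \<le> real L"
        using Q C2 by (simp add: field_simps)
    qed (use Q in simp)
    finally show "card Sh * (card ?T - card (U m)) < L ^ CARD('r)"
      by (simp flip: of_nat_power add: of_nat_less_iff del: of_nat_mult)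
  qed
  then obtain v :: "int ^ 'r" where v: "\<forall>j. 0 \<le> v $ j \<and> v $ j < int L" "\<And>s. s \<in> Sh \<Longrightarrow> T.tup (s + P *s v) \<in> U m"
    by blast
  define u where "u = s0 + P *s v"
  \<comment> \<open>If \<open>\<beta> b > 0\<close> the displacement is positive and below g while
    \<open>e b \<le> Q - 1\<close>; if \<open>\<beta> b < 0\<close> it is negative and above - g
    while \<open>e b \<ge> 1\<close>. Since n = Q g, the integer stays in the range either way;
    \<open>c0\<close> absorbs the offset.\<close>
  have range: "0 \<le> y + dot u (snd b) + e b * g \<and> y + dot u (snd b) + e b * g < int T.n"
    if b: "b \<in> F" and y: "\<bar>y\<bar> \<le> \<bar>\<beta> b\<bar> + \<bar>dot h (snd b)\<bar>" for b y
  proof -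
    define a where "a = dot v (snd b)"
    define y' where "y' = y + dot u0 (snd b)"
    have eq: "y + dot u (snd b) + e b * g = y' + P * (E * int L * \<beta> b + a) + e b * g"
      by (simp add: y'_def u_def s0_def dot_add dot_scale \<beta>_def a_def algebra_simps)
    have y': "\<bar>y'\<bar> \<le> c0" using c0[OF b] y unfolding y'_def by linarith
    have a: "\<bar>a\<bar> \<le> int L * S"
    proof -
      have "\<bar>a\<bar> \<le> int L * (\<Sum>j\<in>UNIV. \<bar>snd b $ j\<bar>)" unfolding a_def by (rule dot_bound[OF v(1)])
      also have "\<dots> \<le> int L * S" using S[OF b] by (intro mult_left_mono) auto
      finally show ?thesis .
    qed
    have absb: "\<bar>P * (E * int L * \<beta> b + a)\<bar> \<le> P * (int L * (E * W + S))"
    proof -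
      have "\<bar>E * int L * \<beta> b\<bar> = E * int L * \<bar>\<beta> b\<bar>" using S0 by (simp add: abs_mult E_def)
      also have "\<dots> \<le> E * int L * W" using S0 W[OF b] by (intro mult_left_mono) (auto simp: E_def)
      finally have "\<bar>E * int L * \<beta> b + a\<bar> \<le> int L * (E * W + S)"
        using a by (simp add: algebra_simps)
      thus ?thesis using P by (simp add: abs_mult)
    qed
    have big: "2 * (P * (int L * (E * W + S))) \<le> g"
    proof -
      have "2 * (P * (int L * (E * W + S))) \<le> int C * int L" unfolding C by (simp add: algebra_simps)
      thus ?thesis using CL by simp
    qed
    have PL: "int L \<le> P * int L" using mult_right_mono[of 1 P "int L"] P by simp
    consider "\<beta> b > 0" | "\<beta> b < 0" using w[of b] b unfolding F_def \<beta>_def by linarith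
    thus ?thesis
    proof cases
      case 1
      have eb: "0 \<le> e b" "e b \<le> Q - 1" using epos[of b] b 1 unfolding F_def \<beta>_def by auto
      have "E * int L * 1 \<le> E * int L * \<beta> b" using 1 S0 by (intro mult_left_mono) (auto simp: E_def)
      hence "int L \<le> E * int L * \<beta> b + a" using a by (simp add: E_def algebra_simps)
      hence "P * int L \<le> P * (E * int L * \<beta> b + a)" using P by (intro mult_left_mono) auto
      hence low: "c0 + 2 \<le> P * (E * int L * \<beta> b + a)" using PL Lc0 by linarith
      have eg: "0 \<le> e b * g" using eb by (simp add: g_def)
      have "e b * g \<le> (Q - 1) * g" using eb by (intro mult_right_mono) (auto simp: g_def)
      hence "e b * g \<le> int T.n - g" unfolding ng by (simp add: algebra_simps)
      thus ?thesis unfolding eq using low eg y' absb big gc0 by linarith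
    next
      case 2
      have eb: "1 \<le> e b" "e b \<le> Q" using eneg[of b] b 2 unfolding F_def \<beta>_def by auto
      have "E * int L * \<beta> b \<le> E * int L * (-1)" using 2 S0 by (intro mult_left_mono) (auto simp: E_def)
      hence "E * int L * \<beta> b + a \<le> - int L" using a by (simp add: E_def algebra_simps)
      hence "P * (E * int L * \<beta> b + a) \<le> P * (- int L)" using P by (intro mult_left_mono) auto
      hence low: "P * (E * int L * \<beta> b + a) \<le> - (c0 + 2)" using PL Lc0 by simp
      have eg: "1 * g \<le> e b * g" using eb by (intro mult_right_mono) (auto simp: g_def)
      have "e b * g \<le> Q * g" using eb by (intro mult_right_mono) (auto simp: g_def)
      hence "e b * g \<le> int T.n" unfolding ng .
      thus ?thesis unfolding eq using low eg y' absb big gc0 by linarith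
    qed
  qed
  define V where "V \<sigma> = (\<Sum>b\<in>F. Poly_Mapping.lookup x b * digsum p (nat (dot \<sigma> (snd b) + dot u (snd b) + e b * g)))" for \<sigma>
  have val: "T.val (D m) (N * V \<sigma>)" if \<sigma>: "\<sigma> \<in> {0, w, h, h + w}" for \<sigma>
  proof -
    have "\<bar>dot \<sigma> (snd b)\<bar> \<le> \<bar>\<beta> b\<bar> + \<bar>dot h (snd b)\<bar>" for b
      using \<sigma> by (auto simp: dot_add \<beta>_def) (simp add: dot_def)
    note r = range[OF _ this]
    have dot: "dot (\<sigma> + u) a = dot \<sigma> a + dot u a" for a by (rule dot_add)
    have "T.val ((tuple_eval (T.tup (\<sigma> + u)) t * ev m (T.tup (\<sigma> + u)) x) powi N) (N * V \<sigma>)"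
      unfolding V_def F_def p_def g_def dot[symmetric]
    proof (rule T.val_ev[OF x t \<gamma>])
      show "\<omega> (to_ac \<gamma>) = cis (2 * pi / real T.Q)" using \<omega> by (simp add: TQ)
      fix b assume b: "b \<in> Poly_Mapping.keys x"
      show "fst b \<gamma> = cis (2 * pi / real T.Q) powi - e b" using e[OF b] by (simp add: TQ)
      show "0 \<le> dot (\<sigma> + u) (snd b) + e b * int T.nQ" "dot (\<sigma> + u) (snd b) + e b * int T.nQ < int T.n"
        using r[of b] b unfolding dot F_def g_def by blast+
    qed
    moreover have "\<sigma> + u \<in> (\<lambda>s. s + P *s v) ` Sh"
      using \<sigma> unfolding u_def Sh_def by (auto simp: algebra_simps)
    hence "T.tup (\<sigma> + u) \<in> U m" using v(2) by auto
    hence "(tuple_eval (T.tup (\<sigma> + u)) t * ev m (T.tup (\<sigma> + u)) x) powi N = D m"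
      using D m by simp
    ultimately show ?thesis by simp
  qed
  have v0: "T.val (D m) (N * V 0)" by (rule val) blast
  have eq: "V \<sigma> = V 0" if "\<sigma> \<in> {0, w, h, h + w}" for \<sigma>
  proof -
    have "N * V \<sigma> = N * V 0" by (rule T.val_unique[OF val[OF that] v0])
    thus ?thesis using N by (simp only: mult_cancel_left simp_thms)
  qed
  have "V w = V 0" "V h = V 0" "V (h + w) = V 0" by (rule eq, blast)+
  \<comment> \<open>The second difference: the step by \<open>w\<close> taken at order l minus the
    same step at order l + 1.\<close>
  hence eqV: "(V w - V 0) - (V (h + w) - V h) = 0" by linarith
  define cc where "cc b = int (card {j \<in> {1..\<beta> b}. Q * dot A (snd b) - M * e b + M * Q * j = 0}) -
       int (card {j \<in> {\<beta> b + 1..0}. Q * dot A (snd b) - M * e b + M * Q * j = 0})" for b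
  have "(V w - V 0) - (V (h + w) - V h) = (\<Sum>b\<in>F. Poly_Mapping.lookup x b * ((int p - 1) * cc b))"
    unfolding V_def sum_subtractf[symmetric]
  proof (rule sum.cong[OF refl])
    fix b assume b: "b \<in> F"
    define k where "k = dot u (snd b) + e b * g"
    define k' where "k' = dot h (snd b) + dot u (snd b) + e b * g"
    have pos: "k \<ge> 0" "k + \<beta> b \<ge> 0" "k' \<ge> 0" "k' + \<beta> b \<ge> 0"
      using range[OF b, of 0] range[OF b, of "\<beta> b"] range[OF b, of "dot h (snd b)"] range[OF b, of "dot h (snd b) + \<beta> b"]
      by (auto simp: k_def k'_def algebra_simps)
    have du: "[M * dot u (snd b) = dot A (snd b) + int p ^ l * \<beta> b] (mod P)"
    proof -
      have "M * dot u (snd b) = (M * Mi) * (dot A (snd b) + int p ^ l * \<beta> b) + P * (M * (E * int L * \<beta> b + dot v (snd b)))"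
        by (simp add: u_def s0_def u0_def dot_add dot_scale \<beta>_def algebra_simps)
      also have "[\<dots> = 1 * (dot A (snd b) + int p ^ l * \<beta> b) + 0] (mod P)"
        by (intro cong_add cong_mult Mi cong_refl) (simp add: cong_0_iff)
      finally show ?thesis by simp
    qed
    have dh: "[M * dot h (snd b) = int p ^ l * (int p - 1) * \<beta> b] (mod P)"
    proof -
      have "M * dot h (snd b) = (M * Mi) * (int p ^ l * (int p - 1) * \<beta> b)"
        unfolding h_def dot_scale \<beta>_def by (simp only: mult_ac)
      also have "[\<dots> = 1 * (int p ^ l * (int p - 1) * \<beta> b)] (mod P)" by (intro cong_mult Mi cong_refl)
      finally show ?thesis by simp
    qed
    \<comment> \<open>As Q g = n, the twist \<open>e b * g\<close> acts p-adically like - e / Q, the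
      source of the term \<open>- M * e b\<close>.\<close>
    have n1: "[int T.n = -1] (mod P)" using Pn by (simp add: cong_iff_dvd_diff)
    have ck: "[M * Q * k = Q * dot A (snd b) + Q * int p ^ l * \<beta> b - M * e b] (mod P)"
    proof -
      have "M * Q * k = Q * (M * dot u (snd b)) + M * e b * int T.n"
        unfolding k_def ng by (simp add: algebra_simps)
      also have "[\<dots> = Q * (dot A (snd b) + int p ^ l * \<beta> b) + M * e b * (-1)] (mod P)"
        by (intro cong_add cong_mult du n1 cong_refl)
      finally show ?thesis by (simp add: algebra_simps)
    qed
    have ck': "[M * Q * k' = Q * dot A (snd b) + Q * int p ^ Suc l * \<beta> b - M * e b] (mod P)"
    proof -
      have "M * Q * k' = M * Q * k + Q * (M * dot h (snd b))"
        unfolding k_def k'_def by (simp add: algebra_simps)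
      also have "[\<dots> = (Q * dot A (snd b) + Q * int p ^ l * \<beta> b - M * e b) + Q * (int p ^ l * (int p - 1) * \<beta> b)] (mod P)"
        by (intro cong_add cong_mult ck dh cong_refl)
      finally show ?thesis by (simp add: algebra_simps)
    qed
    have "(digsum p (nat (k + \<beta> b)) - digsum p (nat k)) - (digsum p (nat (k' + \<beta> b)) - digsum p (nat k')) =
      (int p - 1) * cc b"
      unfolding cc_def
    proof (rule digsum_jump[OF p pMQ _ _ _ ck[unfolded P_def] ck'[unfolded P_def] pos])
      show "\<beta> b \<noteq> 0" using w b by (simp add: F_def \<beta>_def)
      show "\<bar>\<beta> b\<bar> < int p ^ l" using W[OF b] Zb0 l by linarith
      fix j assume j: "\<bar>j\<bar> \<le> \<bar>\<beta> b\<bar>"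
      have "\<bar>M * Q * j\<bar> = M * Q * \<bar>j\<bar>" using M Q by (simp add: abs_mult)
      also have "\<dots> \<le> M * Q * \<bar>\<beta> b\<bar>" using M Q j by (intro mult_left_mono) auto
      finally show "\<bar>Q * dot A (snd b) - M * e b + M * Q * j\<bar> < int p ^ l"
        using Zb[OF b] W0 l by linarith
    qed
    moreover have "dot w (snd b) + dot u (snd b) + e b * g = k + \<beta> b"
      "dot 0 (snd b) + dot u (snd b) + e b * g = k"
      "dot (h + w) (snd b) + dot u (snd b) + e b * g = k' + \<beta> b"
      "dot h (snd b) + dot u (snd b) + e b * g = k'"
      by (simp_all add: k_def k'_def \<beta>_def dot_add) (simp add: dot_def)
    ultimately show "Poly_Mapping.lookup x b * digsum p (nat (dot w (snd b) + dot u (snd b) + e b * g)) -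
      Poly_Mapping.lookup x b * digsum p (nat (dot 0 (snd b) + dot u (snd b) + e b * g)) -
      (Poly_Mapping.lookup x b * digsum p (nat (dot (h + w) (snd b) + dot u (snd b) + e b * g)) -
       Poly_Mapping.lookup x b * digsum p (nat (dot h (snd b) + dot u (snd b) + e b * g))) =
      Poly_Mapping.lookup x b * ((int p - 1) * cc b)"
      by (simp only: right_diff_distrib[symmetric])
  qed
  also have "\<dots> = (int p - 1) * (\<Sum>b\<in>F. Poly_Mapping.lookup x b * cc b)"
    by (simp add: sum_distrib_left mult_ac)
  finally have "(\<Sum>b\<in>F. Poly_Mapping.lookup x b * cc b) = 0" using eqV p1 by simp
  thus ?thesis by (simp add: F_def cc_def \<beta>_def)
qed

subsection \<open>Functionals that vanish on the relations\<close>

lemma frag_sum_extend: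
  assumes "finite S" "Poly_Mapping.keys y \<subseteq> S"
  shows "(\<Sum>b\<in>Poly_Mapping.keys y. Poly_Mapping.lookup y b * f b) = (\<Sum>b\<in>S. Poly_Mapping.lookup y b * (f b :: int))"
  using assms by (intro sum.mono_neutral_left) (auto simp: in_keys_iff)

definition frag_sum :: "('b \<Rightarrow> int) \<Rightarrow> ('b \<Rightarrow>\<^sub>0 int) \<Rightarrow> int" where
  "frag_sum f y = (\<Sum>b\<in>Poly_Mapping.keys y. Poly_Mapping.lookup y b * f b)"

lemma frag_sum_add: "frag_sum f (y + z) = frag_sum f y + frag_sum f z"
proof -
  let ?S = "Poly_Mapping.keys y \<union> Poly_Mapping.keys z"
  have "finite ?S" "Poly_Mapping.keys (y + z) \<subseteq> ?S" using Poly_Mapping.keys_add[of y z] by auto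
  hence "frag_sum f (y + z) = (\<Sum>b\<in>?S. Poly_Mapping.lookup (y + z) b * f b)"
    unfolding frag_sum_def by (rule frag_sum_extend)
  also have "\<dots> = (\<Sum>b\<in>?S. Poly_Mapping.lookup y b * f b) + (\<Sum>b\<in>?S. Poly_Mapping.lookup z b * f b)"
    by (simp add: lookup_add algebra_simps sum.distrib)
  also have "\<dots> = frag_sum f y + frag_sum f z"
    unfolding frag_sum_def by (simp add: frag_sum_extend[of ?S])
  finally show ?thesis .
qed

lemma frag_sum_minus: "frag_sum f (- y) = - frag_sum f y"
  by (simp add: frag_sum_def sum_negf)

lemma frag_sum_diff: "frag_sum f (y - z) = frag_sum f y - frag_sum f z"
  using frag_sum_add[of f y "- z"] by (simp add: frag_sum_minus)

lemma frag_sum_of: "frag_sum f (frag_of b) = f b"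
  by (simp add: frag_sum_def)

lemma frag_sum_zero: "frag_sum f 0 = 0"
  by (simp add: frag_sum_def)

lemma frag_sum_sum: "frag_sum f (sum g I) = (\<Sum>i\<in>I. frag_sum f (g i))"
  by (induction I rule: infinite_finite_induct) (simp_all add: frag_sum_add frag_sum_zero)

section \<open>Characters of k read through their value at a generator, and the functionals\<close>

locale ground_generator =
  fixes \<gamma> :: "'a :: finite_field"
  assumes gen_nonzero: "\<gamma> \<noteq> 0"
    and gen_order: "\<gamma> ^ i = 1 \<Longrightarrow> CARD('a) - 1 dvd i"
begin

definition "Q = CARD('a) - 1"

abbreviation "chars \<equiv> mult_chars (UNIV :: 'a set)"

lemma Q_pos: "Q > 0" using CARD_ge_2[where ?'a = 'a] by (simp add: Q_def)

lemma not_CHAR_dvd_Q: "\<not> CHAR('a) dvd Q"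
proof
  assume "CHAR('a) dvd Q"
  moreover have "CHAR('a) dvd CARD('a)" by (rule CHAR_dvd_CARD)
  ultimately have "CHAR('a) dvd CARD('a) - Q" by (rule dvd_diff_nat[rotated])
  also have "CARD('a) - Q = 1" using CARD_ge_2[where ?'a = 'a] by (simp add: Q_def)
  finally show False using CHAR_prime[where ?'a = 'a] by auto
qed

lemma power_Q: "c \<noteq> 0 \<Longrightarrow> c ^ Q = (1 :: 'a)"
proof -
  assume c: "c \<noteq> 0"
  have "c * c ^ Q = c"
    using finite_field_power_card_eq_same[of c] CARD_ge_2[where ?'a = 'a] by (simp add: Q_def flip: power_Suc)
  thus ?thesis using c by simp
qed

lemma gen_power_eq_iff: "\<gamma> ^ i = \<gamma> ^ j \<longleftrightarrow> [i = j] (mod Q)"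
proof -
  have *: "\<gamma> ^ i = \<gamma> ^ j \<longleftrightarrow> [i = j] (mod Q)" if "i \<le> j" for i j
  proof
    assume "\<gamma> ^ i = \<gamma> ^ j"
    moreover have "\<gamma> ^ i * \<gamma> ^ (j - i) = \<gamma> ^ j" using power_add[of \<gamma> i "j - i"] that by simp
    ultimately have "\<gamma> ^ i * \<gamma> ^ (j - i) = \<gamma> ^ i * 1" by simp
    hence "\<gamma> ^ (j - i) = 1" using gen_nonzero by simp
    hence "Q dvd j - i" unfolding Q_def by (rule gen_order)
    thus "[i = j] (mod Q)" using that by (metis cong_altdef_nat cong_sym)
  next
    assume "[i = j] (mod Q)"
    hence "Q dvd j - i" using that by (metis cong_altdef_nat cong_sym)
    then obtain k where "j - i = Q * k" by blast
    hence "j = i + Q * k" using that by simp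
    thus "\<gamma> ^ i = \<gamma> ^ j" by (simp add: power_add power_mult power_Q[OF gen_nonzero])
  qed
  show ?thesis
  proof (cases "i \<le> j")
    case False
    thus ?thesis using *[of j i] by (metis cong_sym nat_le_linear)
  qed (rule *)
qed

lemma gen_surj: "c \<noteq> 0 \<Longrightarrow> \<exists>i. c = \<gamma> ^ i"
proof -
  have inj: "inj_on (\<lambda>i. \<gamma> ^ i) {..<Q}"
    by (rule inj_onI) (simp add: gen_power_eq_iff cong_def)
  have "(\<lambda>i. \<gamma> ^ i) ` {..<Q} = UNIV - {0}"
  proof (rule card_subset_eq)
    show "(\<lambda>i. \<gamma> ^ i) ` {..<Q} \<subseteq> UNIV - {0}" using gen_nonzero by auto
    show "card ((\<lambda>i. \<gamma> ^ i) ` {..<Q}) = card (UNIV - {0 :: 'a})"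
      unfolding card_image[OF inj] by (simp add: Q_def)
  qed simp
  moreover assume "c \<noteq> 0"
  ultimately have "c \<in> (\<lambda>i. \<gamma> ^ i) ` {..<Q}" by simp
  thus ?thesis by blast
qed

lemma char_one: "\<eta> \<in> chars \<Longrightarrow> \<eta> 1 = 1"
proof -
  assume \<eta>: "\<eta> \<in> chars"
  have "(1 :: 'a) \<in> UNIV - {0}" by simp
  hence "\<eta> (1 * 1) = \<eta> 1 * \<eta> 1" "\<eta> 1 \<noteq> 0" using \<eta> unfolding mult_chars_def by blast+
  thus ?thesis by simp
qed

lemma char_zero: "\<eta> \<in> chars \<Longrightarrow> \<eta> 0 = 0"
  by (simp add: mult_chars_def)

lemma char_mult: "\<eta> \<in> chars \<Longrightarrow> \<eta> (s * t) = \<eta> s * \<eta> t"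
  by (cases "s = 0 \<or> t = 0") (auto simp: mult_chars_def)

lemma char_power: "\<eta> \<in> chars \<Longrightarrow> \<eta> (t ^ k) = \<eta> t ^ k"
  by (induction k) (simp_all add: char_one char_mult)

lemma char_root: "\<eta> \<in> chars \<Longrightarrow> \<eta> \<gamma> ^ Q = 1"
  using char_power[of \<eta> \<gamma> Q] by (simp add: power_Q[OF gen_nonzero] char_one)

lemma char_nonzero: "\<eta> \<in> chars \<Longrightarrow> \<eta> \<gamma> \<noteq> 0"
  using gen_nonzero by (simp add: mult_chars_def)

lemma char_eqI: "\<eta> \<in> chars \<Longrightarrow> \<xi> \<in> chars \<Longrightarrow> \<eta> \<gamma> = \<xi> \<gamma> \<Longrightarrow> \<eta> = \<xi>"
proof
  fix t assume "\<eta> \<in> chars" "\<xi> \<in> chars" "\<eta> \<gamma> = \<xi> \<gamma>"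
  thus "\<eta> t = \<xi> t" using gen_surj[of t] by (cases "t = 0") (auto simp: char_zero char_power)
qed

lemma char_ex:
  assumes z: "z ^ Q = 1"
  shows "\<exists>\<eta>\<in>chars. \<eta> \<gamma> = z"
proof -
  define ind where "ind c = (SOME i. c = \<gamma> ^ i)" for c
  have ind: "c = \<gamma> ^ ind c" if "c \<noteq> 0" for c
    unfolding ind_def by (rule someI_ex[OF gen_surj[OF that]])
  have zc: "z ^ i = z ^ j" if "[i = j] (mod Q)" for i j
  proof -
    have *: "z ^ i = z ^ (i mod Q)" for i
    proof -
      have "z ^ i = z ^ (Q * (i div Q) + i mod Q)" by simp
      thus ?thesis by (simp only: power_add power_mult z power_one mult_1)
    qed
    show ?thesis using *[of i] *[of j] that by (simp add: cong_def)
  qed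
  have zi: "z ^ ind (\<gamma> ^ i) = z ^ i" for i
    using ind[of "\<gamma> ^ i"] gen_nonzero gen_power_eq_iff[of "ind (\<gamma> ^ i)" i] by (intro zc) simp
  have z0: "z \<noteq> 0" using z Q_pos by (auto simp: power_0_left)
  define \<eta> where "\<eta> c = (if c = 0 then 0 else z ^ ind c)" for c
  have "\<eta> \<in> chars"
    unfolding mult_chars_def
  proof (intro CollectI conjI ballI allI impI)
    fix x y :: 'a assume "x \<in> UNIV - {0}" "y \<in> UNIV - {0}"
    hence xy: "x \<noteq> 0" "y \<noteq> 0" by auto
    obtain i j where ij: "x = \<gamma> ^ i" "y = \<gamma> ^ j" using gen_surj xy by meson
    have "\<eta> (\<gamma> ^ k) = z ^ k" for k using zi[of k] gen_nonzero by (simp add: \<eta>_def)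
    from this[of "i + j"] this[of i] this[of j] show "\<eta> (x * y) = \<eta> x * \<eta> y"
      by (simp add: ij power_add)
  qed (auto simp: \<eta>_def z0)
  moreover have "\<eta> \<gamma> = z" using zi[of 1] gen_nonzero by (simp add: \<eta>_def)
  ultimately show ?thesis by blast
qed

lemma chars_closed:
  assumes "\<eta> \<in> chars"
  shows "\<xi> \<in> chars \<Longrightarrow> (\<lambda>t. \<eta> t * \<xi> t) \<in> chars"
    and "k > 0 \<Longrightarrow> (\<lambda>t. \<eta> t ^ k) \<in> chars"
    and "(\<lambda>t. cnj (\<eta> t)) \<in> chars"
  using assms unfolding mult_chars_def by (auto simp: power_mult_distrib)

lemma triv_char_in: "triv_char \<in> chars"
  by (auto simp: mult_chars_def triv_char_def)

lemma finite_chars: "finite chars"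
  by (rule finite_mult_chars_UNIV)

text \<open>
  A symbol is hit if one of its hyperplanes in the window between \<open>u\<close> and \<open>u + w\<close> passes through
  \<open>A / M\<close>; see \<open>window_card\<close> and \<open>cis_powi_eq_iff\<close> for the form used by \<open>jump_relation\<close>.
\<close>

definition hit :: "int ^ 'r \<Rightarrow> int ^ 'r \<Rightarrow> nat \<Rightarrow> ('a, 'r) symb \<Rightarrow> bool" where
  "hit w A M b \<longleftrightarrow> fst b \<gamma> = cis (2 * pi / M) powi (- dot A (snd b)) \<and>
     sgn (dot w (snd b)) * dot A (snd b) < 0 \<and>
     - (int M * \<bar>dot w (snd b)\<bar>) \<le> sgn (dot w (snd b)) * dot A (snd b)"

definition lam :: "int ^ 'r \<Rightarrow> int ^ 'r \<Rightarrow> nat \<Rightarrow> ('a, 'r) symb \<Rightarrow> int" where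
  "lam w A M b = (if hit w A M b then sgn (dot w (snd b)) else 0)"

lemma cis_powi_eq_iff:
  assumes "M > 0"
  shows "cis (2 * pi / Q) powi (- e) = cis (2 * pi / M) powi (- a) \<longleftrightarrow> int M * int Q dvd int Q * a - int M * e"
proof -
  have "cis (2 * pi / Q) powi (- e) = cis (2 * pi / M) powi (- a) \<longleftrightarrow>
    cis (2 * pi / Q) powi (- e) * cis (2 * pi / M) powi a = 1"
    by (simp add: power_int_minus field_simps) (rule eq_commute)
  also have "cis (2 * pi / Q) powi (- e) * cis (2 * pi / M) powi a = cis (2 * pi * (real_of_int (int Q * a - int M * e) / real (M * Q)))"
    using assms Q_pos by (simp add: cis_power_int cis_mult field_simps)
  also have "\<dots> = 1 \<longleftrightarrow> int (M * Q) dvd int Q * a - int M * e"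
    using assms Q_pos by (simp only: cis_2pi_mult_eq_1_iff divide_Ints_iff nat_0_less_mult_iff)
  finally show ?thesis by simp
qed

text \<open>Being hit is invariant under conjugation with negation, because the window is oriented
  by the sign of \<open>dot w a\<close>; the value of \<open>lam\<close> is that sign and
  changes.\<close>

lemma lam_P: "frag_sum (lam w A M) (rel_P \<eta> a) = 0"
proof -
  let ?z = "cis (2 * pi / M) powi (- dot A a)"
  have "cnj ?z = cis (2 * pi / M) powi (- dot A (- a))"
    by (simp add: cis_cnj dot_minus_right cis_power_int)
  hence "cnj (\<eta> \<gamma>) = cis (2 * pi / M) powi (- dot A (- a)) \<longleftrightarrow> \<eta> \<gamma> = ?z"
    by (metis complex_cnj_cancel_iff)
  hence "hit w A M (\<lambda>t. cnj (\<eta> t), - a) \<longleftrightarrow> hit w A M (\<eta>, a)"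
    unfolding hit_def by (simp add: dot_minus_right)
  thus ?thesis unfolding rel_P_def frag_sum_add frag_sum_of lam_def by (simp add: dot_minus_right)
qed

lemma roots_coprime_power:
  fixes y z :: complex
  assumes "y ^ p = z ^ p" "y ^ k = 1" "z ^ k = 1" "coprime p k" "k > 0"
  shows "y = z"
proof -
  obtain i where i: "[p * i = 1] (mod k)" using cong_solve_coprime_nat[OF assms(4)] by auto
  have "x ^ (p * i) = x" if x: "x ^ k = 1" for x :: complex
  proof -
    have *: "x ^ j = x ^ (j mod k)" for j
    proof -
      have "x ^ j = x ^ (k * (j div k) + j mod k)" by simp
      thus ?thesis by (simp only: power_add power_mult x power_one mult_1)
    qed
    show ?thesis using *[of "p * i"] *[of 1] i by (simp add: cong_def)
  qed
  thus ?thesis using assms by (metis power_mult)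
qed

text \<open>Raising to the power p is injective on roots of unity of order dividing M Q, which is
  prime to p, and the window inequalities are homogeneous in the vector.\<close>

lemma lam_Q:
  assumes "\<eta> \<in> chars" "M > 0" "\<not> CHAR('a) dvd M"
  shows "frag_sum (lam w A M) (rel_Q \<eta> a) = 0"
proof -
  let ?p = "CHAR('a)"
  let ?z = "cis (2 * pi / M) powi (- dot A a)"
  have p: "?p > 0" using CHAR_prime[where ?'a = 'a] prime_gt_0_nat by blast
  have "cis (2 * pi / M) powi (- dot A (of_nat ?p *s a)) = ?z powi (int ?p)"
    unfolding power_int_mult[symmetric] by (simp add: dot_scale_right mult.commute)
  hence e: "cis (2 * pi / M) powi (- dot A (of_nat ?p *s a)) = ?z ^ ?p" by simp
  have zM: "?z ^ M = 1"
  proof -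
    have "cis (2 * pi / M) ^ M = 1" using assms(2) by (simp add: Complex.DeMoivre)
    thus ?thesis by (metis power_int_mult power_int_1_left mult.commute power_int_of_nat)
  qed
  have cop: "coprime ?p (M * Q)"
    using assms(3) not_CHAR_dvd_Q CHAR_prime[where ?'a = 'a]
    by (metis prime_imp_coprime prime_dvd_mult_iff)
  have r1: "\<eta> \<gamma> ^ (M * Q) = 1"
    unfolding mult.commute[of M] power_mult char_root[OF assms(1)] by (rule power_one)
  have r2: "?z ^ (M * Q) = 1" unfolding power_mult zM by (rule power_one)
  have MQ: "M * Q > 0" using assms(2) Q_pos by simp
  have iff: "\<eta> \<gamma> ^ ?p = ?z ^ ?p \<longleftrightarrow> \<eta> \<gamma> = ?z"
  proof
    assume "\<eta> \<gamma> ^ ?p = ?z ^ ?p"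
    thus "\<eta> \<gamma> = ?z" by (rule roots_coprime_power[OF _ r1 r2 cop MQ])
  qed (rule arg_cong)
  from iff have "hit w A M (\<lambda>t. \<eta> t ^ ?p, of_nat ?p *s a) \<longleftrightarrow> hit w A M (\<eta>, a)"
    unfolding hit_def fst_conv snd_conv e using p
    by (simp add: dot_scale_right sgn_mult abs_mult mult.left_commute[of _ "int ?p"]
        mult_less_0_iff flip: mult_minus_right)
  thus ?thesis unfolding rel_Q_def frag_sum_add frag_sum_minus frag_sum_of lam_def using p
    by (simp add: dot_scale_right sgn_mult)
qed

lemma char_power_triv_iff: "d > 0 \<Longrightarrow> \<xi> \<in> chars \<Longrightarrow> (\<lambda>t. \<xi> t ^ d) = triv_char \<longleftrightarrow> \<xi> \<gamma> ^ d = 1"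
proof
  assume "(\<lambda>t. \<xi> t ^ d) = triv_char"
  from fun_cong[OF this, of \<gamma>] show "\<xi> \<gamma> ^ d = 1" using gen_nonzero by (simp add: triv_char_def)
next
  assume "d > 0" "\<xi> \<in> chars" "\<xi> \<gamma> ^ d = 1"
  thus "(\<lambda>t. \<xi> t ^ d) = triv_char"
    by (intro char_eqI chars_closed triv_char_in) (simp_all add: triv_char_def gen_nonzero)
qed

text \<open>With y the quotient of the required value at \<open>\<gamma>\<close> by
  \<open>\<eta> \<gamma>\<close>, the symbol of \<open>\<eta> * \<xi>\<close> can be hit only if
  \<open>\<xi> \<gamma> = y\<close>. Exactly one \<open>\<xi>\<close> in the sum has this value if
  y^d = 1 and none otherwise, and y^d = 1 is the condition for the symbol with
  \<open>\<eta>^d\<close>.\<close>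

lemma lam_R:
  assumes "\<eta> \<in> chars" "d > 0" "d dvd Q"
  shows "frag_sum (lam w A M) (rel_R \<eta> a d) = 0"
proof -
  let ?z = "cis (2 * pi / M) powi (- dot A a)"
  define y where "y = ?z / \<eta> \<gamma>"
  define X0 where "X0 = {\<xi> \<in> chars. (\<lambda>t. \<xi> t ^ d) = triv_char}"
  define C where "C \<longleftrightarrow> sgn (dot w a) * dot A a < 0 \<and> - (int M * \<bar>dot w a\<bar>) \<le> sgn (dot w a) * dot A a"
  have n0: "\<eta> \<gamma> \<noteq> 0" by (rule char_nonzero[OF assms(1)])
  have "cis (2 * pi / M) powi (- dot A (of_nat d *s a)) = ?z powi (int d)"
    unfolding power_int_mult[symmetric] by (simp add: dot_scale_right mult.commute)
  hence e: "cis (2 * pi / M) powi (- dot A (of_nat d *s a)) = ?z ^ d" by simp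
  have 1: "hit w A M (\<lambda>t. \<eta> t ^ d, of_nat d *s a) \<longleftrightarrow> y ^ d = 1 \<and> C"
  proof -
    have "\<eta> \<gamma> ^ d = ?z ^ d \<longleftrightarrow> y ^ d = 1" using n0 by (auto simp: y_def power_divide)
    thus ?thesis unfolding hit_def fst_conv snd_conv e C_def using assms(2)
      by (simp add: dot_scale_right sgn_mult abs_mult mult.left_commute[of _ "int d"]
        mult_less_0_iff flip: mult_minus_right)
  qed
  have 2: "hit w A M (\<lambda>t. \<eta> t * \<xi> t, a) \<longleftrightarrow> \<xi> \<gamma> = y \<and> C" for \<xi>
    unfolding hit_def C_def y_def using n0 by (auto simp: field_simps)
  have fin: "finite X0" unfolding X0_def using finite_chars by simp
  have "(\<Sum>\<xi>\<in>X0. lam w A M (\<lambda>t. \<eta> t * \<xi> t, a)) = (if y ^ d = 1 \<and> C then sgn (dot w a) else 0)"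
  proof (cases "y ^ d = 1")
    case True
    then obtain k where "Q = d * k" using assms(3) by blast
    hence "y ^ Q = 1" using True by (simp add: power_mult)
    then obtain \<xi>0 where \<xi>0: "\<xi>0 \<in> chars" "\<xi>0 \<gamma> = y" using char_ex by blast
    have mem: "\<xi>0 \<in> X0" unfolding X0_def using \<xi>0 True char_power_triv_iff[OF assms(2) \<xi>0(1)] by simp
    have "lam w A M (\<lambda>t. \<eta> t * \<xi> t, a) = (if \<xi> = \<xi>0 then (if C then sgn (dot w a) else 0) else 0)" if "\<xi> \<in> X0" for \<xi>
    proof -
      have "\<xi> \<gamma> = y \<longleftrightarrow> \<xi> = \<xi>0" using that \<xi>0 char_eqI unfolding X0_def by blast
      thus ?thesis unfolding lam_def 2 by simp
    qed
    hence "(\<Sum>\<xi>\<in>X0. lam w A M (\<lambda>t. \<eta> t * \<xi> t, a)) =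
      (\<Sum>\<xi>\<in>X0. if \<xi> = \<xi>0 then (if C then sgn (dot w a) else 0) else 0)" by (intro sum.cong refl)
    also have "\<dots> = (if C then sgn (dot w a) else 0)" using fin mem by simp
    finally show ?thesis using True by simp
  next
    case False
    have "\<xi> \<gamma> \<noteq> y" if "\<xi> \<in> X0" for \<xi>
      using that False char_power_triv_iff[OF assms(2), of \<xi>] unfolding X0_def by auto
    thus ?thesis using False by (simp add: lam_def 2)
  qed
  moreover have "lam w A M (\<lambda>t. \<eta> t ^ d, of_nat d *s a) = (if y ^ d = 1 \<and> C then sgn (dot w a) else 0)"
    unfolding lam_def 1 using assms(2) by (simp add: dot_scale_right sgn_mult)
  ultimately show ?thesis
    unfolding rel_R_def frag_sum_add frag_sum_minus frag_sum_of frag_sum_sum X0_def by simp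
qed

lemma rel_generators_keys:
  fixes a :: "int ^ 'r::finite"
  shows "\<eta> \<in> chars \<Longrightarrow> a \<noteq> 0 \<Longrightarrow> Poly_Mapping.keys (rel_P \<eta> a) \<subseteq> symbols"
    and "\<eta> \<in> chars \<Longrightarrow> a \<noteq> 0 \<Longrightarrow> Poly_Mapping.keys (rel_Q \<eta> a) \<subseteq> symbols"
    and "\<eta> \<in> chars \<Longrightarrow> a \<noteq> 0 \<Longrightarrow> d > 0 \<Longrightarrow> Poly_Mapping.keys (rel_R \<eta> a d) \<subseteq> symbols"
proof -
  assume \<eta>: "\<eta> \<in> chars" and a: "a \<noteq> 0"
  have p: "CHAR('a) > 0" using CHAR_prime[where ?'a = 'a] prime_gt_0_nat by blast
  have ka: "int k *s a \<noteq> 0" if "k > 0" for k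
    using that a by (simp add: Finite_Cartesian_Product.vec_eq_iff)
  have sub: "Poly_Mapping.keys (y + z) \<subseteq> symbols"
    if "Poly_Mapping.keys y \<subseteq> symbols" "Poly_Mapping.keys z \<subseteq> symbols" for y z :: "('a, 'r) symb \<Rightarrow>\<^sub>0 int"
    using that Poly_Mapping.keys_add[of y z] by auto
  show "Poly_Mapping.keys (rel_P \<eta> a) \<subseteq> symbols"
    unfolding rel_P_def by (rule sub) (use \<eta> a chars_closed(3)[OF \<eta>] in \<open>auto simp: symbols_def\<close>)
  show "Poly_Mapping.keys (rel_Q \<eta> a) \<subseteq> symbols"
    unfolding rel_Q_def by (intro sub) (use \<eta> a p ka chars_closed(2)[OF \<eta>] in \<open>auto simp: symbols_def\<close>)
  assume d: "d > 0"
  have sums: "Poly_Mapping.keys (sum g I) \<subseteq> symbols" if "\<And>i. i \<in> I \<Longrightarrow> Poly_Mapping.keys (g i) \<subseteq> symbols"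
    for g :: "_ \<Rightarrow> ('a, 'r) symb \<Rightarrow>\<^sub>0 int" and I :: "('a \<Rightarrow> complex) set"
    using that
  proof (induction I rule: infinite_finite_induct)
    case (insert i I)
    have "Poly_Mapping.keys (g i + sum g I) \<subseteq> symbols" by (rule sub) (use insert in auto)
    thus ?case using insert(1,2) by simp
  qed simp_all
  show "Poly_Mapping.keys (rel_R \<eta> a d) \<subseteq> symbols"
    unfolding rel_R_def
    by (intro sub sums) (use \<eta> a d ka chars_closed[OF \<eta>] in \<open>auto simp: symbols_def\<close>)
qed

lemma rel_subgroup_closed:
  shows "0 \<in> (rel_subgroup :: (('a, 'r::finite) symb \<Rightarrow>\<^sub>0 int) set)"
    and "y \<in> rel_subgroup \<Longrightarrow> z \<in> rel_subgroup \<Longrightarrow> y + z \<in> (rel_subgroup :: (('a, 'r) symb \<Rightarrow>\<^sub>0 int) set)"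
    and "y \<in> rel_subgroup \<Longrightarrow> - y \<in> (rel_subgroup :: (('a, 'r) symb \<Rightarrow>\<^sub>0 int) set)"
proof -
  let ?G = "symb_group :: (('a, 'r) symb \<Rightarrow>\<^sub>0 int) monoid"
  define gens where "gens = ({rel_P \<eta> a | \<eta> a. \<eta> \<in> chars \<and> a \<noteq> 0} \<union>
      {rel_Q \<eta> a | \<eta> a. \<eta> \<in> chars \<and> a \<noteq> 0} \<union>
      {rel_R \<eta> a d | \<eta> a d. \<eta> \<in> chars \<and> a \<noteq> 0 \<and> d > 0 \<and> d dvd CARD('a) - 1} :: (('a, 'r) symb \<Rightarrow>\<^sub>0 int) set)"
  have rel: "rel_subgroup = generate ?G gens" unfolding rel_subgroup_def gens_def ..
  interpret G: group ?G unfolding symb_group_def by simp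
  have "gens \<subseteq> carrier ?G"
  proof
    fix y assume "y \<in> gens"
    hence "Poly_Mapping.keys y \<subseteq> symbols"
      unfolding gens_def by (elim UnE CollectE exE conjE) (simp_all add: rel_generators_keys)
    thus "y \<in> carrier ?G" by (simp add: symb_group_def)
  qed
  from G.generate_is_subgroup[OF this] have sg: "subgroup rel_subgroup ?G" unfolding rel .
  have sub: "Poly_Mapping.keys y \<subseteq> symbols" if "y \<in> rel_subgroup" for y :: "('a, 'r) symb \<Rightarrow>\<^sub>0 int"
  proof -
    have "y \<in> carrier ?G" using subgroup.subset[OF sg] that by blast
    thus ?thesis by (simp add: symb_group_def)
  qed
  show "0 \<in> (rel_subgroup :: (('a, 'r) symb \<Rightarrow>\<^sub>0 int) set)" using subgroup.one_closed[OF sg] by (simp add: symb_group_def)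
  show "y \<in> rel_subgroup \<Longrightarrow> z \<in> rel_subgroup \<Longrightarrow> y + z \<in> rel_subgroup"
    using subgroup.m_closed[OF sg, of y z] by (simp add: symb_group_def)
  show "y \<in> rel_subgroup \<Longrightarrow> - y \<in> rel_subgroup"
    using subgroup.m_inv_closed[OF sg, of y] sub[of y] by (simp add: symb_group_def)
qed

lemma rel_subgroup_diff:
  fixes y z :: "('a, 'r::finite) symb \<Rightarrow>\<^sub>0 int"
  assumes "y \<in> rel_subgroup" "z \<in> rel_subgroup"
  shows "y - z \<in> rel_subgroup"
  using rel_subgroup_closed(2)[OF assms(1) rel_subgroup_closed(3)[OF assms(2)]] by simp

lemma rel_in:
  assumes "\<eta> \<in> chars" "a \<noteq> 0"
  shows "rel_P \<eta> a \<in> rel_subgroup" "rel_Q \<eta> a \<in> rel_subgroup"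
    "d > 0 \<Longrightarrow> d dvd Q \<Longrightarrow> rel_R \<eta> a d \<in> rel_subgroup"
  unfolding rel_subgroup_def Q_def by (rule generate.incl, use assms in blast)+

lemma lam_rel_subgroup:
  fixes y :: "('a, 'r::finite) symb \<Rightarrow>\<^sub>0 int"
  assumes M: "M > 0" "\<not> CHAR('a) dvd M" and "y \<in> rel_subgroup"
  shows "frag_sum (lam w A M) y = 0"
  using assms(3) unfolding rel_subgroup_def
proof (induction rule: generate.induct)
  case one
  show ?case by (simp add: symb_group_def frag_sum_zero)
next
  case (incl y)
  thus ?case by (elim UnE CollectE exE conjE) (simp_all only: lam_P lam_Q[OF _ M] lam_R flip: Q_def)
next
  case (inv y)
  hence "Poly_Mapping.keys y \<subseteq> symbols"
    by (elim UnE CollectE exE conjE) (simp_all add: rel_generators_keys)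
  hence "inv\<^bsub>symb_group\<^esub> y = - y" by (simp add: symb_group_def)
  moreover have "frag_sum (lam w A M) y = 0" using inv
    by (elim UnE CollectE exE conjE) (simp_all only: lam_P lam_Q[OF _ M] lam_R flip: Q_def)
  ultimately show ?case by (simp add: frag_sum_minus)
next
  case (eng y z)
  thus ?case by (simp add: symb_group_def frag_sum_add)
qed

subsection \<open>Normal forms\<close>

text \<open>Symbols that no relation simplifies: \<open>rel_P\<close> fixes the sign,
  \<open>rel_Q\<close> removes a factor p of the vector (every character has a p-th root), and
  \<open>rel_R\<close> removes a d that divides vector and character simultaneously.\<close>

definition normal :: "int ^ 'r \<Rightarrow> ('a, 'r) symb \<Rightarrow> bool" where
  "normal w b \<longleftrightarrow> b \<in> symbols \<and> dot w (snd b) > 0 \<and> \<not> (\<forall>j. int CHAR('a) dvd snd b $ j) \<and>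
     (\<forall>d>1. d dvd Q \<longrightarrow> (\<forall>j. int d dvd snd b $ j) \<longrightarrow> \<not> (\<exists>\<eta>\<in>chars. fst b = (\<lambda>t. \<eta> t ^ d)))"

lemma divide_vector:
  fixes a :: "int ^ 'r::finite"
  assumes "\<forall>j. int d dvd a $ j" "d > 1" "a \<noteq> 0"
  obtains a' :: "int ^ 'r" where "a = of_nat d *s a'" "a' \<noteq> 0" "(\<Sum>j\<in>UNIV. nat \<bar>a' $ j\<bar>) < (\<Sum>j\<in>UNIV. nat \<bar>a $ j\<bar>)"
proof -
  define a' where "a' = (\<chi> j. a $ j div int d)"
  have eq: "a = of_nat d *s a'" using assms(1) by (simp add: a'_def Finite_Cartesian_Product.vec_eq_iff)
  have a'0: "a' \<noteq> 0" using eq assms(3) by auto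
  then obtain i where i: "a' $ i \<noteq> 0" by (auto simp: Finite_Cartesian_Product.vec_eq_iff)
  have comp: "nat \<bar>a $ j\<bar> = d * nat \<bar>a' $ j\<bar>" for j
    unfolding eq by (simp add: abs_mult nat_mult_distrib)
  have "(\<Sum>j\<in>UNIV. nat \<bar>a' $ j\<bar>) < (\<Sum>j\<in>UNIV. nat \<bar>a $ j\<bar>)"
    by (rule sum_strict_mono_ex1) (use comp assms(2) i in \<open>auto intro!: bexI[of _ i]\<close>)
  thus ?thesis using that eq a'0 by blast
qed

lemma char_CHAR_root:
  assumes "\<eta> \<in> chars"
  shows "\<exists>\<xi>\<in>chars. \<eta> = (\<lambda>t. \<xi> t ^ CHAR('a))"
proof -
  let ?p = "CHAR('a)"
  have "coprime ?p Q" using not_CHAR_dvd_Q CHAR_prime[where ?'a = 'a] by (metis prime_imp_coprime)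
  then obtain i where i: "[?p * i = 1] (mod Q)" using cong_solve_coprime_nat by auto
  have p: "?p > 0" using CHAR_prime[where ?'a = 'a] prime_gt_0_nat by blast
  have "(\<eta> \<gamma> ^ i) ^ Q = 1" using char_root[OF assms] by (metis mult.commute power_mult power_one)
  then obtain \<xi> where \<xi>: "\<xi> \<in> chars" "\<xi> \<gamma> = \<eta> \<gamma> ^ i" using char_ex by blast
  have "\<gamma> ^ (?p * i) = \<gamma> ^ 1" unfolding gen_power_eq_iff by (rule i)
  hence "\<eta> \<gamma> = \<eta> (\<gamma> ^ (i * ?p))" by (simp add: mult.commute)
  also have "\<dots> = \<xi> \<gamma> ^ ?p" by (simp add: char_power[OF assms] \<xi>(2) flip: power_mult)
  finally have "\<eta> = (\<lambda>t. \<xi> t ^ ?p)" by (intro char_eqI assms chars_closed(2) \<xi>(1) p)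
  thus ?thesis using \<xi> by blast
qed

text \<open>Induction on the size of the vector: \<open>rel_Q\<close> and \<open>rel_R\<close>
  divide it by p or by d > 1, the latter at the cost of a sum over several characters, and both keep
  \<open>dot w a\<close> positive.\<close>

lemma reduce_pos:
  fixes w a :: "int ^ 'r::finite"
  assumes "\<eta> \<in> chars" "dot w a > 0"
  shows "\<exists>y. Poly_Mapping.keys y \<subseteq> Collect (normal w) \<and> frag_of (\<eta>, a) - y \<in> rel_subgroup"
  using assms
proof (induction "\<Sum>j\<in>UNIV. nat \<bar>a $ j\<bar>" arbitrary: a \<eta> rule: less_induct)
  case less
  let ?p = "CHAR('a)"
  have a0: "a \<noteq> 0"
  proof
    assume "a = 0"
    thus False using less.prems(2) by (simp add: dot_def)
  qed
  have p1: "?p > 1" using CHAR_prime[where ?'a = 'a] prime_gt_1_nat by blast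
  consider "\<forall>j. int ?p dvd a $ j" | d \<xi> where "d > 1" "d dvd Q" "\<forall>j. int d dvd a $ j" "\<xi> \<in> chars" "\<eta> = (\<lambda>t. \<xi> t ^ d)"
    | "normal w (\<eta>, a)"
    using less.prems a0 unfolding normal_def symbols_def by auto
  thus ?case
  proof cases
    case 1
    obtain a' :: "int ^ 'r" where a': "a = of_nat ?p *s a'" "a' \<noteq> 0" "(\<Sum>j\<in>UNIV. nat \<bar>a' $ j\<bar>) < (\<Sum>j\<in>UNIV. nat \<bar>a $ j\<bar>)"
      by (rule divide_vector[OF 1 p1 a0])
    obtain \<xi> where \<xi>: "\<xi> \<in> chars" "\<eta> = (\<lambda>t. \<xi> t ^ ?p)" using char_CHAR_root[OF less.prems(1)] by blast
    have "dot w a' > 0" using less.prems(2) p1 unfolding a'(1) by (simp add: dot_scale_right zero_less_mult_iff)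
    then obtain y where y: "Poly_Mapping.keys y \<subseteq> Collect (normal w)" "frag_of (\<xi>, a') - y \<in> rel_subgroup"
      using less.hyps[OF a'(3) \<xi>(1)] by blast
    have "frag_of (\<xi>, a') - y - rel_Q \<xi> a' \<in> rel_subgroup"
      by (intro rel_subgroup_diff y(2) rel_in \<xi>(1) a'(2))
    also have "frag_of (\<xi>, a') - y - rel_Q \<xi> a' = frag_of (\<eta>, a) - y"
      by (simp add: rel_Q_def \<xi>(2) a'(1))
    finally show ?thesis using y(1) by blast
  next
    case (2 d \<xi>)
    obtain a' :: "int ^ 'r" where a': "a = of_nat d *s a'" "a' \<noteq> 0" "(\<Sum>j\<in>UNIV. nat \<bar>a' $ j\<bar>) < (\<Sum>j\<in>UNIV. nat \<bar>a $ j\<bar>)"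
      by (rule divide_vector[OF 2(3,1) a0])
    have pos: "dot w a' > 0" using less.prems(2) 2(1) unfolding a'(1) by (simp add: dot_scale_right zero_less_mult_iff)
    define X0 where "X0 = {\<zeta> \<in> chars. (\<lambda>t. \<zeta> t ^ d) = triv_char}"
    have "\<forall>\<zeta>\<in>X0. \<exists>y. Poly_Mapping.keys y \<subseteq> Collect (normal w) \<and> frag_of (\<lambda>t. \<xi> t * \<zeta> t, a') - y \<in> rel_subgroup"
      using less.hyps[OF a'(3) _ pos] chars_closed(1)[OF 2(4)] unfolding X0_def by blast
    then obtain Y where Y: "\<And>\<zeta>. \<zeta> \<in> X0 \<Longrightarrow> Poly_Mapping.keys (Y \<zeta>) \<subseteq> Collect (normal w)"
      "\<And>\<zeta>. \<zeta> \<in> X0 \<Longrightarrow> frag_of (\<lambda>t. \<xi> t * \<zeta> t, a') - Y \<zeta> \<in> rel_subgroup" by metis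
    have fin: "finite X0" unfolding X0_def using finite_chars by simp
    have keys: "Poly_Mapping.keys (sum Y J) \<subseteq> Collect (normal w)" if "J \<subseteq> X0" "finite J" for J
      using that(2,1)
    proof (induction J rule: finite_induct)
      case (insert j J)
      thus ?case using Y(1)[of j] Poly_Mapping.keys_add[of "Y j" "sum Y J"] by fastforce
    qed simp
    have "(\<Sum>\<zeta>\<in>J. frag_of (\<lambda>t. \<xi> t * \<zeta> t, a') - Y \<zeta>) \<in> rel_subgroup" if "J \<subseteq> X0" "finite J" for J
      using that(2,1) by (induction J rule: finite_induct) (auto intro!: rel_subgroup_closed Y)
    hence "(\<Sum>\<zeta>\<in>X0. frag_of (\<lambda>t. \<xi> t * \<zeta> t, a') - Y \<zeta>) \<in> rel_subgroup" using fin by blast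
    hence "(\<Sum>\<zeta>\<in>X0. frag_of (\<lambda>t. \<xi> t * \<zeta> t, a') - Y \<zeta>) - rel_R \<xi> a' d \<in> rel_subgroup"
      using 2 a' by (intro rel_subgroup_diff rel_in) auto
    also have "(\<Sum>\<zeta>\<in>X0. frag_of (\<lambda>t. \<xi> t * \<zeta> t, a') - Y \<zeta>) - rel_R \<xi> a' d = frag_of (\<eta>, a) - sum Y X0"
      by (simp add: rel_R_def X0_def[symmetric] sum_subtractf 2(5) a'(1))
    finally show ?thesis using keys[OF order_refl fin] by blast
  next
    case 3
    show ?thesis using 3 by (intro exI[of _ "frag_of (\<eta>, a)"]) (simp add: rel_subgroup_closed)
  qed
qed

lemma reduce:
  fixes w :: "int ^ 'r::finite" and x :: "('a, 'r) symb \<Rightarrow>\<^sub>0 int"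
  assumes "Poly_Mapping.keys x \<subseteq> {b \<in> symbols. dot w (snd b) \<noteq> 0}"
  shows "\<exists>y. Poly_Mapping.keys y \<subseteq> Collect (normal w) \<and> x - y \<in> rel_subgroup"
  using assms
proof (induction x rule: frag_induction)
  case zero
  show ?case by (intro exI[of _ 0]) (simp add: rel_subgroup_closed)
next
  case (one b)
  obtain \<eta> a where b: "b = (\<eta>, a)" by (cases b)
  have \<eta>: "\<eta> \<in> chars" "a \<noteq> 0" "dot w a \<noteq> 0" using one by (auto simp: b symbols_def)
  show ?case
  proof (cases "dot w a > 0")
    case True
    thus ?thesis unfolding b by (intro reduce_pos \<eta>)
  next
    case False
    hence "dot w (- a) > 0" using \<eta>(3) by (simp add: dot_minus_right)
    then obtain y where y: "Poly_Mapping.keys y \<subseteq> Collect (normal w)"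
      "frag_of (\<lambda>t. cnj (\<eta> t), - a) - y \<in> rel_subgroup"
      using reduce_pos[OF chars_closed(3)[OF \<eta>(1)]] by blast
    have "rel_P \<eta> a - (frag_of (\<lambda>t. cnj (\<eta> t), - a) - y) \<in> rel_subgroup"
      by (intro rel_subgroup_diff rel_in \<eta> y)
    also have "rel_P \<eta> a - (frag_of (\<lambda>t. cnj (\<eta> t), - a) - y) = frag_of b - (- y)"
      by (simp add: rel_P_def b)
    finally show ?thesis using y(1) by (intro exI[of _ "- y"]) simp
  qed
next
  case (diff x1 x2)
  then obtain y1 y2 where y: "Poly_Mapping.keys y1 \<subseteq> Collect (normal w)" "x1 - y1 \<in> rel_subgroup"
    "Poly_Mapping.keys y2 \<subseteq> Collect (normal w)" "x2 - y2 \<in> rel_subgroup" by blast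
  have "(x1 - y1) - (x2 - y2) \<in> rel_subgroup" by (intro rel_subgroup_diff y)
  also have "(x1 - y1) - (x2 - y2) = (x1 - x2) - (y1 - y2)" by simp
  finally show ?case using y(1,3) keys_diff[of y1 y2] by blast
qed

end

text \<open>Move \<open>w\<close> along the new vector \<open>c\<close>: each hyperplane excludes at
  most one multiple of \<open>c\<close>, since \<open>dot c c\<close> is nonzero.\<close>

lemma generic_vector:
  fixes C :: "(int ^ 'r::finite) set"
  assumes "finite C" "0 \<notin> C"
  shows "\<exists>w. \<forall>c\<in>C. dot w c \<noteq> 0"
  using assms
proof (induction C rule: finite_induct)
  case (insert c C)
  then obtain w where w: "\<forall>c\<in>C. dot w c \<noteq> 0" by auto
  have cc: "dot c c \<noteq> 0"
  proof
    assume "dot c c = 0"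
    hence "\<forall>j. c $ j * c $ j = 0" unfolding dot_def by (subst (asm) sum_nonneg_eq_0_iff) auto
    hence "c = 0" by (simp add: Finite_Cartesian_Product.vec_eq_iff)
    thus False using insert.prems by simp
  qed
  have "\<exists>k :: int. \<forall>c'\<in>insert c C. dot w c' + k * dot c c' \<noteq> 0"
  proof -
    have "finite {k :: int. dot w c' + k * dot c c' = 0}" if "c' \<in> insert c C" for c'
    proof (cases "dot c c' = 0")
      case True
      thus ?thesis using that w cc by auto
    next
      case False
      have "{k. dot w c' + k * dot c c' = 0} \<subseteq> {- dot w c' div dot c c'}"
      proof safe
        fix k assume "dot w c' + k * dot c c' = 0"
        hence "- dot w c' = k * dot c c'" by simp
        thus "k = - dot w c' div dot c c'" using False by simp
      qed
      thus ?thesis by (rule finite_subset) simp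
    qed
    hence "finite (\<Union>c'\<in>insert c C. {k :: int. dot w c' + k * dot c c' = 0})" using insert.hyps by blast
    then obtain k where "k \<notin> (\<Union>c'\<in>insert c C. {k :: int. dot w c' + k * dot c c' = 0})"
      using ex_new_if_finite[OF infinite_UNIV_int] by blast
    thus ?thesis by blast
  qed
  then obtain k where "\<forall>c'\<in>insert c C. dot w c' + k * dot c c' \<noteq> 0" by blast
  thus ?case by (intro exI[of _ "w + k *s c"]) (simp add: dot_add dot_scale)
qed simp

text \<open>Let k be the product of the primes of d that do not divide e. A prime of d then divides
  exactly one of e and k Q, hence not their difference. Reducing k modulo d brings it into the
  required range.\<close>

lemma coprime_in_progression:
  fixes e Q :: int and d :: nat
  assumes "d > 0" "\<And>l. Factorial_Ring.prime l \<Longrightarrow> l dvd d \<Longrightarrow> int l dvd e \<Longrightarrow> int l dvd Q \<Longrightarrow> False"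
  shows "\<exists>j\<in>{1..int d}. coprime (e - j * Q) (int d)"
proof -
  define k where "k = (\<Prod>l\<in>{l \<in> prime_factors d. \<not> int l dvd e}. int l)"
  have cop: "coprime (e - k * Q) (int d)"
  proof (rule ccontr)
    assume "\<not> coprime (e - k * Q) (int d)"
    then obtain c where c: "c dvd e - k * Q" "c dvd int d" "\<not> is_unit c" by (auto simp: coprime_def)
    have "c \<noteq> 0" using c(2) assms(1) by auto
    then obtain l' where l': "Factorial_Ring.prime l'" "l' dvd c" using prime_divisor_exists[of c] c(3) by blast
    define l where "l = nat l'"
    have ll: "l' = int l" using prime_gt_0_int[OF l'(1)] by (simp add: l_def)
    have l: "Factorial_Ring.prime l" using l'(1) unfolding ll by simp
    have "int l dvd int d" using l'(2) c(2) dvd_trans unfolding ll by blast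
    hence ld: "l dvd d" by simp
    have lk: "int l dvd e - k * Q" using l'(2) c(1) dvd_trans unfolding ll by blast
    have pl: "Factorial_Ring.prime (int l)" using l by simp
    show False
    proof (cases "int l dvd e")
      case True
      hence "int l dvd e - (e - k * Q)" using lk by (rule dvd_diff)
      hence "int l dvd k * Q" by simp
      moreover have "\<not> int l dvd k"
      proof
        assume "int l dvd k"
        then obtain l2 where l2: "l2 \<in> prime_factors d" "\<not> int l2 dvd e" "int l dvd int l2"
          unfolding k_def using pl by (subst (asm) prime_dvd_prod_iff) auto
        hence "l = l2" using l by (auto simp: in_prime_factors_iff primes_dvd_imp_eq)
        thus False using l2 True by simp
      qed
      ultimately have "int l dvd Q" using pl by (simp add: prime_dvd_mult_iff)
      thus False using assms(2)[OF l ld True] by simp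
    next
      case False
      hence "int l dvd k" unfolding k_def using l ld assms(1)
        by (intro dvd_prodI) (auto simp: in_prime_factors_iff)
      hence "int l dvd e - k * Q + k * Q" using lk by (intro dvd_add dvd_mult2)
      thus False using False by simp
    qed
  qed
  define j where "j = (k - 1) mod int d + 1"
  have "0 \<le> (k - 1) mod int d" "(k - 1) mod int d < int d" using assms(1) by simp_all
  hence "j \<in> {1..int d}" unfolding j_def atLeastAtMost_iff by linarith
  moreover have "coprime (e - j * Q) (int d)"
  proof -
    have "[j = k] (mod int d)" unfolding j_def cong_def by (simp add: mod_simps)
    hence "[e - j * Q = e - k * Q] (mod int d)" by (intro cong_diff cong_mult cong_refl)
    thus ?thesis using cop cong_imp_coprime cong_sym by blast
  qed
  ultimately show ?thesis by blast
qed

section \<open>Separating normal forms by functionals\<close>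

context ground_generator
begin

definition content :: "int ^ 'r::finite \<Rightarrow> nat" where
  "content a = nat (Gcd (range (\<lambda>j. a $ j)))"

lemma content_dvd:
  fixes a :: "int ^ 'r::finite"
  shows "int (content a) dvd a $ j"
  unfolding content_def by (simp add: Gcd_int_greater_eq_0)

lemma content_parallel:
  fixes a b :: "int ^ 'r::finite"
  assumes "\<forall>j. c * a $ j = c' * b $ j"
  shows "\<bar>c\<bar> * int (content a) = \<bar>c'\<bar> * int (content b)"
proof -
  have g: "int (content a) = Gcd (range (\<lambda>j. a $ j))" for a :: "int ^ 'r"
    unfolding content_def by (simp add: Gcd_int_greater_eq_0)
  have eq: "(\<lambda>j. c * a $ j) = (\<lambda>j. c' * b $ j)" using assms by auto
  have m: "\<bar>c\<bar> * Gcd (range (\<lambda>j. a $ j)) = Gcd (range (\<lambda>j. c * a $ j))" for c and a :: "int ^ 'r"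
    using Gcd_mult[of c "range (\<lambda>j. a $ j)"] by (simp add: image_image abs_mult)
  show ?thesis unfolding g m eq ..
qed

text \<open>
  Take a symbol of maximal content \<open>d\<close>.  The point \<open>A / M\<close> is chosen on one of its hyperplanes, where it has a
  coordinate of maximal denominator \<open>d * Q\<close> along \<open>a0\<close>, so that it avoids the hyperplanes of all other symbols
  parallel to \<open>a0\<close>, and far out in a direction orthogonal to \<open>a0\<close>, so that it leaves the windows of the non-parallel ones.
\<close>

lemma normal_detected:
  fixes w :: "int ^ 'r::finite" and y :: "('a, 'r) symb \<Rightarrow>\<^sub>0 int"
  assumes y: "Poly_Mapping.keys y \<subseteq> Collect (normal w)" "y \<noteq> 0"
  shows "\<exists>A M. M > 0 \<and> \<not> CHAR('a) dvd M \<and> frag_sum (lam w A M) y \<noteq> 0"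
proof -
  let ?p = "CHAR('a)" and ?F = "Poly_Mapping.keys y"
  have fin: "finite ?F" by simp
  have ne: "?F \<noteq> {}" using y(2) by simp
  have nor: "normal w b" if "b \<in> ?F" for b using y(1) that by blast
  obtain b0 where b0: "b0 \<in> ?F" "\<And>b. b \<in> ?F \<Longrightarrow> content (snd b) \<le> content (snd b0)"
  proof -
    have "Max ((content \<circ> snd) ` ?F) \<in> (content \<circ> snd) ` ?F" using fin ne by (intro Max_in) auto
    then obtain b0 where "b0 \<in> ?F" "content (snd b0) = Max ((content \<circ> snd) ` ?F)" by auto
    thus ?thesis using that[of b0] fin by simp
  qed
  obtain \<eta>0 a0 where b0': "b0 = (\<eta>0, a0)" by (cases b0)
  define d where "d = content a0"
  have n0: "\<eta>0 \<in> chars" "a0 \<noteq> 0" "dot w a0 > 0" "\<not> (\<forall>j. int ?p dvd a0 $ j)"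
    "\<And>d \<xi>. d > 1 \<Longrightarrow> d dvd Q \<Longrightarrow> (\<forall>j. int d dvd a0 $ j) \<Longrightarrow> \<xi> \<in> chars \<Longrightarrow> \<eta>0 \<noteq> (\<lambda>t. \<xi> t ^ d)"
    using nor[OF b0(1)] unfolding b0' normal_def symbols_def by auto
  \<comment> \<open>This coordinate of \<open>a0\<close> enters the denominator \<open>M\<close>,
    which must be prime to p.\<close>
  obtain j0 where j0: "\<not> int ?p dvd a0 $ j0" using n0(4) by blast
  define \<delta> where "\<delta> = a0 $ j0"
  have \<delta>: "\<delta> \<noteq> 0" "\<not> int ?p dvd \<delta>" using j0 unfolding \<delta>_def by auto
  have dd: "int d dvd a0 $ j" for j unfolding d_def by (rule content_dvd)
  have d0: "d > 0" using dd[of j0] \<delta> unfolding \<delta>_def by (cases "d = 0") auto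
  obtain j1 where j1: "j1 < Q" "\<eta>0 \<gamma> = cis (2 * pi * real j1 / real Q)"
    using root_of_unity_cis[OF char_root[OF n0(1)] Q_pos] .
  define e where "e = - int j1 mod int Q"
  have e: "0 \<le> e" "e < int Q" using Q_pos by (simp_all add: e_def)
  have cQ: "cis (2 * pi / Q) powi k = cis (2 * pi / Q) powi l" if "[k = l] (mod int Q)" for k l
  proof -
    have "int Q dvd k - l" using that by (simp add: cong_iff_dvd_diff)
    then obtain i where "k - l = int Q * i" by blast
    hence i: "k = l + int Q * i" by simp
    have "cis (2 * pi / Q) ^ Q = 1" using Q_pos by (simp add: Complex.DeMoivre)
    thus ?thesis unfolding i by (simp add: power_int_add power_int_mult)
  qed
  have \<eta>0e: "\<eta>0 \<gamma> = cis (2 * pi / Q) powi (- e)"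
  proof -
    have "\<eta>0 \<gamma> = cis (2 * pi / Q) powi (int j1)" using j1 by (simp add: cis_power_int Complex.DeMoivre mult_ac)
    also have "\<dots> = cis (2 * pi / Q) powi (- e)"
      by (rule cQ) (simp add: e_def cong_def mod_minus_eq)
    finally show ?thesis .
  qed
  \<comment> \<open>Normality enters here: a prime dividing d, e and Q would make
    \<open>\<eta>0\<close> an l-th power and \<open>a0\<close> divisible by l. The bound j \<le> d
    keeps the hyperplane inside the window, because d divides \<open>dot w a0\<close>.\<close>
  have "\<exists>j\<in>{1..int d}. coprime (e - j * int Q) (int d)"
  proof (rule coprime_in_progression[OF d0])
    fix l assume l: "Factorial_Ring.prime l" "l dvd d" "int l dvd e" "int l dvd int Q"
    obtain f where f: "e = int l * f" using l(3) by blast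
    obtain Q' where Q': "Q = l * Q'" using l(4) by auto
    have "(cis (2 * pi / Q) powi (- f)) ^ Q = 1"
    proof -
      have "(cis (2 * pi / Q) powi (- f)) ^ Q = cis (2 * pi / Q) powi (- f * int Q)"
        by (subst power_int_mult) simp
      also have "\<dots> = cis (2 * pi / Q) powi 0" by (rule cQ) (simp add: cong_0_iff)
      finally show ?thesis by simp
    qed
    then obtain \<xi> where \<xi>: "\<xi> \<in> chars" "\<xi> \<gamma> = cis (2 * pi / Q) powi (- f)" using char_ex by blast
    have l0: "l > 1" using l(1) prime_gt_1_nat by blast
    have "\<xi> \<gamma> ^ l = cis (2 * pi / Q) powi (- f * int l)" unfolding \<xi>(2) by (subst power_int_mult) simp
    hence "\<eta>0 \<gamma> = \<xi> \<gamma> ^ l" unfolding \<eta>0e f by (simp add: mult.commute)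
    hence "\<eta>0 = (\<lambda>t. \<xi> t ^ l)" using l0 by (intro char_eqI n0(1) chars_closed(2) \<xi>(1)) auto
    moreover have "int l dvd a0 $ j" for j using dd[of j] l(2) by (meson dvd_trans of_nat_dvd_iff)
    ultimately show False using n0(5)[OF l0 _ _ \<xi>(1)] l(4) by auto
  qed
  then obtain j where j: "1 \<le> j" "j \<le> int d" and cop: "coprime (e - j * int Q) (int d)" by auto
  define h where "h = e - j * int Q"
  have h0: "h < 0"
  proof -
    have "1 * int Q \<le> j * int Q" using j by (intro mult_right_mono) auto
    thus ?thesis using e unfolding h_def by linarith
  qed
  \<comment> \<open>With this denominator A / M will pair with \<open>a0\<close> to h / Q = e / Q -
    j.\<close>
  define M where "M = Q * nat \<bar>\<delta>\<bar>"
  have M: "int M = int Q * \<bar>\<delta>\<bar>" by (simp add: M_def)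
  have M0: "M > 0" using Q_pos \<delta> by (simp add: M_def)
  have pM: "\<not> ?p dvd M"
  proof
    assume "?p dvd M"
    hence "?p dvd nat \<bar>\<delta>\<bar>"
      using not_CHAR_dvd_Q CHAR_prime[where ?'a = 'a] by (simp add: M_def prime_dvd_mult_iff)
    hence "int ?p dvd int (nat \<bar>\<delta>\<bar>)" by (simp only: of_nat_dvd_iff)
    thus False using \<delta>(2) by simp
  qed
  define c where "c b = \<delta> *s snd b - (snd b $ j0) *s a0" for b :: "('a, 'r) symb"
  obtain \<zeta> where \<zeta>: "\<forall>v\<in>c ` ?F - {0}. dot \<zeta> v \<noteq> 0" using generic_vector[of "c ` ?F - {0}"] fin by blast
  \<comment> \<open>Orthogonal to \<open>a0\<close> by the correction along the axis
    \<open>j0\<close>, while its pairing with \<open>snd b\<close> is that of \<open>\<zeta>\<close>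
    with \<open>c b\<close>: nonzero unless \<open>snd b\<close> is parallel to
    \<open>a0\<close>.\<close>
  define z0 where "z0 = \<delta> *s \<zeta> - dot \<zeta> a0 *s axis j0 1"
  have dot_diff: "dot (u - v) a = dot u a - dot v a" for u v a :: "int ^ 'r"
    by (simp add: dot_def algebra_simps sum_subtractf)
  have dot_diff_right: "dot a (u - v) = dot a u - dot a v" for u v a :: "int ^ 'r"
    by (simp add: dot_def algebra_simps sum_subtractf)
  have dot_axis: "dot (axis j0 1) a = a $ j0" for a :: "int ^ 'r"
    unfolding dot_def by (subst sum.remove[of _ j0]) (auto simp: axis_def intro!: sum.neutral)
  have z0: "dot z0 (snd b) = dot \<zeta> (c b)" for b
    unfolding z0_def c_def dot_diff dot_diff_right dot_scale dot_scale_right dot_axis by (simp add: algebra_simps)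
  have z00: "dot z0 a0 = 0" unfolding z0_def dot_diff dot_scale dot_axis \<delta>_def by simp
  define T where "T = (\<Sum>b\<in>?F. \<bar>h * (snd b $ j0)\<bar> + int M * \<bar>dot w (snd b)\<bar>) + 1"
  have T: "\<bar>h * (snd b $ j0)\<bar> + int M * \<bar>dot w (snd b)\<bar> < T" if "b \<in> ?F" for b
  proof -
    have "\<bar>h * (snd b $ j0)\<bar> + int M * \<bar>dot w (snd b)\<bar> \<le> (\<Sum>b\<in>?F. \<bar>h * (snd b $ j0)\<bar> + int M * \<bar>dot w (snd b)\<bar>)"
      by (rule member_le_sum[OF that _ fin]) simp
    thus ?thesis by (simp add: T_def)
  qed
  have "(\<Sum>b\<in>?F. \<bar>h * (snd b $ j0)\<bar> + int M * \<bar>dot w (snd b)\<bar>) \<ge> 0" by (intro sum_nonneg) simp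
  hence T0: "T > 0" unfolding T_def by linarith
  define A where "A = (sgn \<delta> * h) *s axis j0 1 + T *s z0"
  have A: "dot A a = sgn \<delta> * h * a $ j0 + T * dot z0 a" for a
    unfolding A_def dot_add dot_scale dot_axis ..
  have A0: "dot A a0 = h * \<bar>\<delta>\<bar>" unfolding A z00 by (simp add: \<delta>_def abs_sgn mult_ac)
  have powi_A0: "cis (2 * pi / M) powi (- dot A a0) = \<eta>0 \<gamma>"
  proof -
    have "int Q * (h * \<bar>\<delta>\<bar>) - int M * e = int M * int Q * (- j)" unfolding M h_def by (simp add: algebra_simps)
    hence "int M * int Q dvd int Q * dot A a0 - int M * e" unfolding A0 by (metis dvd_triv_left)
    thus ?thesis using cis_powi_eq_iff[OF M0, of e "dot A a0"] \<eta>0e by simp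
  qed
  have hit0: "hit w A M b0"
  proof -
    have "int d dvd dot w a0" unfolding dot_def by (intro dvd_sum dvd_mult dd)
    hence dw: "int d \<le> dot w a0" using n0(3) by (rule zdvd_imp_le)
    have "j * int Q \<le> dot w a0 * int Q" using j dw by (intro mult_right_mono) auto
    hence "- (int Q * dot w a0) \<le> h" using e unfolding h_def mult.commute[of "int Q"] by linarith
    hence "- (int Q * dot w a0) * \<bar>\<delta>\<bar> \<le> h * \<bar>\<delta>\<bar>" by (intro mult_right_mono) auto
    hence "- (int M * dot w a0) \<le> h * \<bar>\<delta>\<bar>" unfolding M by (simp add: algebra_simps)
    moreover have "h * \<bar>\<delta>\<bar> < 0" using h0 \<delta>(1) by (simp add: mult_neg_pos)
    ultimately show ?thesis unfolding hit_def b0' using n0(3) powi_A0 A0 by simp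
  qed
  have only: "b = b0" if b: "b \<in> ?F" and hit: "hit w A M b" for b
  proof -
    obtain \<eta> a where b': "b = (\<eta>, a)" by (cases b)
    have na: "\<eta> \<in> chars" "a \<noteq> 0" "dot w a > 0" using nor[OF b] unfolding b' normal_def symbols_def by auto
    have bound: "\<bar>dot A a\<bar> \<le> int M * \<bar>dot w a\<bar>" using hit na(3) unfolding hit_def b' by simp
    have cb: "c b = 0"
    proof (rule ccontr)
      assume "c b \<noteq> 0"
      hence "dot z0 a \<noteq> 0" using \<zeta> b z0[of b] unfolding b' by auto
      hence "T * 1 \<le> T * \<bar>dot z0 a\<bar>" using T0 by (intro mult_left_mono) auto
      hence "T \<le> \<bar>T * dot z0 a\<bar>" using T0 by (simp add: abs_mult)
      moreover have "\<bar>sgn \<delta> * h * a $ j0\<bar> = \<bar>h * a $ j0\<bar>" using \<delta>(1) by (simp add: abs_mult)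
      moreover have "\<bar>T * dot z0 a\<bar> \<le> \<bar>dot A a\<bar> + \<bar>sgn \<delta> * h * a $ j0\<bar>" unfolding A by linarith
      ultimately show False using T[OF b] bound unfolding b' snd_conv by linarith
    qed
    hence par: "\<forall>j. \<delta> * a $ j = a $ j0 * a0 $ j" unfolding c_def b' by (simp add: Finite_Cartesian_Product.vec_eq_iff)
    have zz: "dot z0 a = 0" using z0[of b] cb unfolding b' by (simp add: dot_def)
    have Aa: "dot A a = sgn \<delta> * h * a $ j0" unfolding A zz by simp
    obtain j2 where j2: "j2 < Q" "\<eta> \<gamma> = cis (2 * pi * real j2 / real Q)"
      using root_of_unity_cis[OF char_root[OF na(1)] Q_pos] .
    have \<eta>hit: "\<eta> \<gamma> = cis (2 * pi / M) powi (- dot A a)" using hit unfolding hit_def b' by simp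
    \<comment> \<open>A value of a character of k is a Q-th root of unity, so a hit forces M to
      divide Q \<open>dot A a\<close>, that is, \<open>\<delta>\<close> to divide
      \<open>h * a $ j0\<close>.\<close>
    have "cis (2 * pi / Q) powi (- (- int j2)) = \<eta> \<gamma>" using j2 by (simp add: cis_power_int Complex.DeMoivre mult_ac)
    hence "int M * int Q dvd int Q * dot A a - int M * (- int j2)"
      using cis_powi_eq_iff[OF M0, of "- int j2" "dot A a"] \<eta>hit by simp
    hence "int M dvd int Q * dot A a - int M * (- int j2)" by (rule dvd_mult_left)
    hence "int M dvd int Q * dot A a - int M * (- int j2) + int M * (- int j2)" by (intro dvd_add dvd_triv_left)
    hence "int Q * \<bar>\<delta>\<bar> dvd int Q * dot A a" unfolding M by simp
    hence "\<bar>\<delta>\<bar> dvd dot A a" using Q_pos by simp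
    hence "\<delta> dvd sgn \<delta> * h * a $ j0" unfolding Aa by simp
    hence "\<delta> dvd h * a $ j0" using \<delta>(1) by (cases "\<delta> > 0") (auto simp: sgn_if)
    hence "\<delta> * int d dvd h * a $ j0 * int d" by (rule mult_dvd_mono) simp
    moreover have cont: "\<bar>\<delta>\<bar> * int (content a) = \<bar>a $ j0\<bar> * int d"
      unfolding d_def by (rule content_parallel[OF par])
    moreover have "\<bar>h * a $ j0 * int d\<bar> = \<bar>h\<bar> * (\<bar>a $ j0\<bar> * int d)" by (simp add: abs_mult)
    ultimately have "\<bar>\<delta> * int d\<bar> dvd \<bar>h\<bar> * (\<bar>\<delta>\<bar> * int (content a))"
      by (metis abs_dvd_iff dvd_abs_iff)
    hence "\<bar>\<delta>\<bar> * int d dvd \<bar>\<delta>\<bar> * (\<bar>h\<bar> * int (content a))"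
      by (simp only: abs_mult abs_of_nat mult.left_commute)
    hence "int d dvd \<bar>h\<bar> * int (content a)" using \<delta>(1) by simp
    moreover have "coprime (int d) \<bar>h\<bar>" using cop unfolding h_def[symmetric] by (simp add: coprime_commute)
    \<comment> \<open>By maximality the content of \<open>a\<close> is then d. Parallel vectors of
      equal content agree up to sign, and the sign is settled by pairing with
      \<open>w\<close>.\<close>
    ultimately have "int d dvd int (content a)" by (simp only: coprime_dvd_mult_right_iff)
    moreover have "content a > 0"
    proof -
      obtain i where "a $ i \<noteq> 0" using na(2) by (auto simp: Finite_Cartesian_Product.vec_eq_iff)
      thus ?thesis using content_dvd[of a i] by (cases "content a = 0") auto
    qed
    ultimately have "d \<le> content a" by (simp add: dvd_imp_le)
    hence "content a = d" using b0(2)[OF b] unfolding d_def b' b0' by simp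
    hence aj: "\<bar>a $ j0\<bar> = \<bar>\<delta>\<bar>" using cont d0 by simp
    have "a $ j0 = \<delta>"
    proof (rule ccontr)
      assume "a $ j0 \<noteq> \<delta>"
      hence "a $ j0 = - \<delta>" using aj by linarith
      hence "\<forall>j. a $ j = - a0 $ j" using par \<delta>(1) by (metis mult_cancel_left mult_minus_left mult_minus_right)
      hence "a = - a0" by (simp add: Finite_Cartesian_Product.vec_eq_iff)
      thus False using na(3) n0(3) by (simp add: dot_minus_right)
    qed
    hence aa: "a = a0" using par \<delta>(1) by (simp add: Finite_Cartesian_Product.vec_eq_iff)
    hence "\<eta> \<gamma> = \<eta>0 \<gamma>" using \<eta>hit powi_A0 by simp
    hence "\<eta> = \<eta>0" by (rule char_eqI[OF na(1) n0(1)])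
    thus ?thesis using aa b' b0' by simp
  qed
  have "frag_sum (lam w A M) y = (\<Sum>b\<in>?F. if b = b0 then Poly_Mapping.lookup y b0 else 0)"
    unfolding frag_sum_def
  proof (rule sum.cong[OF refl])
    fix b assume b: "b \<in> ?F"
    show "Poly_Mapping.lookup y b * lam w A M b = (if b = b0 then Poly_Mapping.lookup y b0 else 0)"
    proof (cases "b = b0")
      case True
      have "lam w A M b0 = 1" unfolding lam_def if_P[OF hit0] using n0(3) by (simp add: b0')
      thus ?thesis by (simp add: True)
    next
      case False
      hence "\<not> hit w A M b" using only[OF b] by blast
      thus ?thesis using False by (simp add: lam_def)
    qed
  qed
  also have "\<dots> = Poly_Mapping.lookup y b0" using b0(1) by simp
  also have "\<dots> \<noteq> 0" using b0(1) by (simp add: in_keys_iff)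
  finally show ?thesis using M0 pM by blast
qed

end

section \<open>A generator of the group of k independent of m, and the conclusion\<close>

lemma (in teichmuller) ground_generatorI:
  assumes "\<gamma> \<noteq> 0" "\<omega> (to_ac \<gamma>) = cis (2 * pi / (CARD('a) - 1))"
  shows "ground_generator \<gamma>"
proof
  fix i assume "\<gamma> ^ i = 1"
  hence "to_ac \<gamma> ^ i = 1" by (simp flip: to_ac_power)
  moreover have "to_ac \<gamma> \<in> Kx" using assms(1) to_ac_Kx by blast
  ultimately have "cis (2 * pi / Q) ^ i = 1"
    using omega_of_power[of "to_ac \<gamma>" i] assms(2) omega_one by (simp add: Q_def)
  hence "cis (2 * pi * (real_of_int (int i) / real Q)) = 1" by (simp add: Complex.DeMoivre mult_ac)
  hence "int Q dvd int i" using Q_pos by (simp only: cis_2pi_mult_eq_1_iff divide_Ints_iff)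
  hence "Q dvd i" by simp
  thus "CARD('a) - 1 dvd i" unfolding Q_def .
qed (rule assms(1))

text \<open>The Teichmueller character varies with m, but k is finite: by the pigeonhole principle
  one \<open>\<gamma>\<close> serves infinitely many m, so the exponents \<open>e\<close> can be
  fixed before m is chosen.\<close>

lemma frequent_ground_generator:
  "\<exists>\<gamma> :: 'a :: finite_field. \<gamma> \<noteq> 0 \<and> (\<exists>\<^sub>\<infinity>m. \<exists>R (\<phi> :: complex \<Rightarrow> 'a alg_closure) \<omega>. teichmuller m R \<phi> \<omega> \<and>
       \<omega> (to_ac \<gamma>) = cis (2 * pi / (CARD('a) - 1)))"
proof -
  let ?P = "\<lambda>m \<gamma> :: 'a. \<exists>R (\<phi> :: complex \<Rightarrow> 'a alg_closure) \<omega>. teichmuller m R \<phi> \<omega> \<and>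
       \<omega> (to_ac \<gamma>) = cis (2 * pi / (CARD('a) - 1))"
  have "\<exists>\<gamma>\<in>UNIV - {0}. ?P m \<gamma>" if m: "m \<ge> 2" for m
  proof -
    obtain R and \<phi> :: "complex \<Rightarrow> 'a alg_closure" and \<omega> where T: "teichmuller m R \<phi> \<omega>"
      using teichmuller_exists[OF m] by blast
    interpret teichmuller m R \<phi> \<omega> by (rule T)
    obtain \<gamma> where "\<gamma> \<noteq> 0" "\<omega> (to_ac \<gamma>) = cis (2 * pi / Q)" using ground_generator by blast
    thus ?thesis using T unfolding Q_def by blast
  qed
  hence "\<exists>\<^sub>\<infinity>m. \<exists>\<gamma>\<in>UNIV - {0}. ?P m \<gamma>"
    unfolding INFM_nat_le by (metis le_add1 le_add2 le_trans)
  from frequently_bex_finite[OF _ this] show ?thesis by auto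
qed

theorem theorem4p1:
  fixes x :: "('a :: finite_field, 'r :: finite) symb \<Rightarrow>\<^sub>0 int"
    and t :: "'a ^ 'r"
    and N :: int
    and U :: "nat \<Rightarrow> (('a alg_closure \<Rightarrow> complex) ^ 'r) set"
    and D :: "nat \<Rightarrow> complex"
  assumes "x \<in> carrier symb_group"
    and "\<forall>j. t $ j \<noteq> 0"
    and "N \<noteq> 0"
    and "\<forall>m\<ge>1. U m \<subseteq> char_tuples m"
    and "(\<lambda>m. real (card (U m)) /
           real (card (char_tuples m :: (('a alg_closure \<Rightarrow> complex) ^ 'r) set)))
         \<longlonglongrightarrow> 1"
    and "\<forall>m\<ge>1. \<forall>\<omega>\<in>U m. (tuple_eval \<omega> t * ev m \<omega> x) powi N = D m"
  shows "x \<in> rel_subgroup"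
proof -
  let ?F = "Poly_Mapping.keys x"
  have x: "?F \<subseteq> symbols" using assms(1) by (simp add: symb_group_def)
  have "0 \<notin> snd ` ?F" using x by (auto simp: symbols_def)
  then obtain w where w': "\<forall>c\<in>snd ` ?F. dot w c \<noteq> 0"
    using generic_vector[of "snd ` ?F"] by auto
  hence w: "dot w (snd b) \<noteq> 0" if "b \<in> ?F" for b using that by blast
  obtain \<gamma> :: 'a where \<gamma>: "\<gamma> \<noteq> 0" and inf: "\<exists>\<^sub>\<infinity>m. \<exists>R (\<phi> :: complex \<Rightarrow> 'a alg_closure) \<omega>. teichmuller m R \<phi> \<omega> \<and>
       \<omega> (to_ac \<gamma>) = cis (2 * pi / (CARD('a) - 1))"
    using frequent_ground_generator by blast
  obtain m R and \<phi> :: "complex \<Rightarrow> 'a alg_closure" and \<omega> where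
    T: "teichmuller m R \<phi> \<omega>" "\<omega> (to_ac \<gamma>) = cis (2 * pi / (CARD('a) - 1))"
    using inf unfolding INFM_nat_le by blast
  interpret G: ground_generator \<gamma>
    by (rule teichmuller.ground_generatorI[OF T(1) \<gamma> T(2)])
  let ?Q = "int (CARD('a) - 1)"
  have Q: "?Q > 0" using G.Q_pos by (simp add: G.Q_def)
  \<comment> \<open>The value at \<open>\<gamma>\<close> determines e modulo q - 1 only; for the
    trivial character the sign of \<open>dot w (snd b)\<close> decides between 0 and q - 1.\<close>
  have "\<exists>e. fst b \<gamma> = cis (2 * pi / (CARD('a) - 1)) powi (- e) \<and>
      (dot w (snd b) > 0 \<longrightarrow> 0 \<le> e \<and> e < ?Q) \<and> (dot w (snd b) < 0 \<longrightarrow> 0 < e \<and> e \<le> ?Q)" if b: "b \<in> ?F" for b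
  proof -
    have "fst b \<in> mult_chars UNIV" using x b by (auto simp: symbols_def)
    hence "fst b \<gamma> ^ G.Q = 1" by (rule G.char_root)
    then obtain j where j: "j < G.Q" "fst b \<gamma> = cis (2 * pi * real j / real G.Q)"
      using G.Q_pos by (rule root_of_unity_cis)
    have j': "fst b \<gamma> = cis (2 * pi / G.Q) powi (int j)" using j by (simp add: cis_power_int Complex.DeMoivre mult_ac)
    have "cis (2 * pi / G.Q) ^ G.Q = 1" using G.Q_pos by (simp add: Complex.DeMoivre)
    hence j'': "fst b \<gamma> = cis (2 * pi / G.Q) powi (- (int G.Q - int j))"
      unfolding j' by (simp add: power_int_diff)
    show ?thesis
    proof (cases "dot w (snd b) > 0 \<and> j = 0")
      case True
      thus ?thesis using j' Q by (intro exI[of _ 0]) simp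
    next
      case False
      thus ?thesis using j'' j(1) unfolding G.Q_def by (intro exI[of _ "?Q - int j"]) auto
    qed
  qed
  then obtain e where e: "\<And>b. b \<in> ?F \<Longrightarrow> fst b \<gamma> = cis (2 * pi / (CARD('a) - 1)) powi (- e b)"
    "\<And>b. b \<in> ?F \<Longrightarrow> dot w (snd b) > 0 \<Longrightarrow> 0 \<le> e b \<and> e b < ?Q"
    "\<And>b. b \<in> ?F \<Longrightarrow> dot w (snd b) < 0 \<Longrightarrow> 0 < e b \<and> e b \<le> ?Q" by metis
  have vanish: "frag_sum (G.lam w A M) x = 0" if M: "M > 0" "\<not> CHAR('a) dvd M" for A M
  proof -
    have "frag_sum (G.lam w A M) x = (\<Sum>b\<in>?F. Poly_Mapping.lookup x b *
      (int (card {j \<in> {1..dot w (snd b)}. ?Q * dot A (snd b) - int M * e b + int M * ?Q * j = 0}) -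
       int (card {j \<in> {dot w (snd b) + 1..0}. ?Q * dot A (snd b) - int M * e b + int M * ?Q * j = 0})))"
      unfolding frag_sum_def
    proof (intro sum.cong refl arg_cong2[where f = "(*)"])
      fix b assume b: "b \<in> ?F"
      have "fst b \<gamma> = cis (2 * pi / M) powi (- dot A (snd b)) \<longleftrightarrow> int M * ?Q dvd ?Q * dot A (snd b) - int M * e b"
        using G.cis_powi_eq_iff[OF M(1), of "e b" "dot A (snd b)"] e(1)[OF b] by (simp add: G.Q_def)
      thus "G.lam w A M b =
        int (card {j \<in> {1..dot w (snd b)}. ?Q * dot A (snd b) - int M * e b + int M * ?Q * j = 0}) -
        int (card {j \<in> {dot w (snd b) + 1..0}. ?Q * dot A (snd b) - int M * e b + int M * ?Q * j = 0})"
        using M(1) Q e(2,3)[OF b] by (subst window_card) (auto simp: G.lam_def G.hit_def)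
    qed
    also have "\<dots> = 0"
      using jump_relation[OF x assms(2-6) inf \<gamma> e w, of "int M" A] M by simp
    finally show ?thesis .
  qed
  have "?F \<subseteq> {b \<in> symbols. dot w (snd b) \<noteq> 0}" using x w by blast
  from G.reduce[OF this] obtain y where y: "Poly_Mapping.keys y \<subseteq> Collect (G.normal w)" "x - y \<in> rel_subgroup"
    by blast
  have "y = 0"
  proof (rule ccontr)
    assume "y \<noteq> 0"
    from G.normal_detected[OF y(1) this] obtain A M where
      AM: "M > 0" "\<not> CHAR('a) dvd M" "frag_sum (G.lam w A M) y \<noteq> 0" by blast
    have "frag_sum (G.lam w A M) (x - y) = 0" by (rule G.lam_rel_subgroup[OF AM(1,2) y(2)])
    thus False using AM(3) vanish[OF AM(1,2), of A] by (simp add: frag_sum_diff)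
  qed
  thus ?thesis using y(2) by simp
qed

end
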